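(* Fix $0<\varepsilon<\frac12$ and put \[ c=(1-\varepsilon)^{1/h}\,\frac{(b_1\cdots b_h)^{1/h^2}}{\Gamma(1/h)}. \] Define the random set $\mathscr{A}\subseteq\mathbb{Z}_{\ge0}$ as follows: $0\in\mathscr{A}$ always, and the events $\{n\in\mathscr{A}\}$ for $n\ge1$ are mutually independent with \[ \Pr(n\in\mathscr{A})=\min\Big\{c\,\frac{(n\log n)^{1/h}}{n},\,1\Big\}. \] Then $\mathbb{E}(r_{\mathscr{A},h}(n))\sim(1-\varepsilon)\log n$ as $n\to\infty$. Moreover, \[ \Pr\big(r_{\mathscr{A},h}(n)=0\text{ for infinitely many } n\big)=1. \]
   Context: Fix an integer $h\ge 2$ and positive integers $b_1,\dots,b_h$, not necessarily distinct, with $\gcd(b_1,\dots,b_h)=1$. For $A\subseteq\mathbb{Z}_{\ge 0}$, $1\le\ell\le h$ and an integer $n\ge 0$, let $r_{A,\ell}(n)$ be the number of $\ell$-tuples $(k_1,\dots,k_\ell)\in A^\ell$ with $b_1k_1+\cdots+b_\ell k_\ell=n$. *)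

theory Defs
  imports "HOL-Probability.Probability" "HOL-Library.Landau_Symbols"
begin

text \<open>Coefficients b_1,...,b_h are represented as b 0, ..., b (h-1).
  r_count b A l n = number of l-tuples (k_1,...,k_l) in A^l with
  b_1 k_1 + ... + b_l k_l = n (tuples indexed by {..<l}).\<close>
definition r_count :: "(nat \<Rightarrow> nat) \<Rightarrow> nat set \<Rightarrow> nat \<Rightarrow> nat \<Rightarrow> nat" where
  "r_count b A l n = card {k \<in> {..<l} \<rightarrow>\<^sub>E A. (\<Sum>i<l. b i * k i) = n}"

end

theory Submission
  imports Defs "HOL-Real_Asymp.Real_Asymp" "HOL-Number_Theory.Cong"
begin

text \<open>
  Expectation. Tuples with a zero, a repeated entry or an entry below \<open>n\<close> divided by a power of
  \<open>ln n\<close> contribute \<open>o(1)\<close>, because the largest entry is of order \<open>n\<close> and is determined by the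
  others. On the remaining tuples every \<open>ln (k i)\<close> is asymptotic to \<open>ln n\<close>, which reduces the
  claim to the limit of the sum of \<open>\<Prod>i. k i powr (1 / h - 1)\<close> over the solutions. That limit follows
  by repeated convolution: for the coefficients \<open>pochhammer \<alpha> n / fact n\<close> in place of
  \<open>n powr (\<alpha> - 1) / Gamma \<alpha>\<close> the convolution is exact (Vandermonde), and the summand has so little
  variation that all residue classes contribute equally.

  Zeros. Let \<open>X\<close> be the number of \<open>n\<close> in \<open>{N..<2 * N}\<close> without a representation. The Harris
  inequality gives \<open>P(r n = 0) \<ge> \<Prod>S. (1 - P(S \<subseteq> A))\<close>, which is at least \<open>n powr (- \<kappa>)\<close> for some
  \<open>\<kappa> < 1\<close>, so \<open>E X\<close> tends to infinity. Janson's inequality, applied only to tuples with large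
  distinct entries, gives \<open>P(r n = 0 \<and> r m = 0) \<le> (1 + o(1)) P(r n = 0) P(r m = 0)\<close> for \<open>n \<noteq> m\<close>;
  for such tuples the dependency sum is controlled by counting alone. Chebyshev's inequality then
  shows that the probability of \<open>X = 0\<close> tends to \<open>0\<close>.
\<close>

section \<open>Convolution of sequences with periodic power asymptotics\<close>

text \<open>The sequence \<open>rising_coeff \<alpha>\<close> lists the coefficients of (1 -
  x)^(-\<alpha>), so multiplying two such series adds the exponents; this is why the convolution is
  exact.

  The constant \<open>c\<close> normalises the limit of \<open>mean_count n / ln n\<close> to
  \<kappa> = 1 - \<epsilon>. Hence a single n is missed with probability about n^(-\<kappa>), and a
  window of N numbers should contain about N^(1 - \<kappa>) missed ones.

  The obstacle is the dependence between tuples. If all entries equal N up to powers of ln N, each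
  is chosen with probability N^(1/h - 1) up to logarithms. Two tuples sharing s entries have 2h - s
  distinct entries tied by two equations, so such pairs have total weight N^((2h - s)/h - 2) =
  N^(-s/h), again up to logarithms. This count fails for tuples with small entries. The upper bound
  ignores them, which only enlarges the event, and the Harris product restores them: their total
  probability is O(1 / ln N), so the product over the large tuples is at most (1 + o(1)) P(r n = 0).
  Equal supports for different n and m need a separate count: there a permutation of one tuple
  solves the other equation.\<close>

definition rising_coeff :: "real \<Rightarrow> nat \<Rightarrow> real" where
  "rising_coeff \<alpha> n = pochhammer \<alpha> n / fact n"

lemma rising_coeff_0 [simp]: "rising_coeff \<alpha> 0 = 1"
  by (simp add: rising_coeff_def)

lemma rising_coeff_one [simp]: "rising_coeff 1 n = 1"
  by (simp add: rising_coeff_def flip: pochhammer_fact)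

lemma rising_coeff_pos: "\<alpha> > 0 \<Longrightarrow> rising_coeff \<alpha> n > 0"
  by (simp add: rising_coeff_def pochhammer_pos)

lemma rising_coeff_Suc: "rising_coeff \<alpha> (Suc n) = rising_coeff \<alpha> n * ((\<alpha> + n) / (1 + n))"
  by (simp add: rising_coeff_def pochhammer_Suc field_simps)

lemma rising_coeff_antimono:
  assumes "0 < \<alpha>" "\<alpha> \<le> 1" "m \<le> n"
  shows "rising_coeff \<alpha> n \<le> rising_coeff \<alpha> m"
  using assms(3)
proof (induction rule: dec_induct)
  case (step k)
  have "rising_coeff \<alpha> (Suc k) \<le> rising_coeff \<alpha> k * 1"
    unfolding rising_coeff_Suc using assms
    by (intro mult_left_mono less_imp_le[OF rising_coeff_pos]) auto
  with step show ?case by simp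
qed auto

lemma rising_coeff_Vandermonde:
  "(\<Sum>k\<le>n. rising_coeff \<alpha> k * rising_coeff \<beta> (n - k)) = rising_coeff (\<alpha> + \<beta>) n"
proof -
  have "(\<Sum>k\<le>n. rising_coeff \<alpha> k * rising_coeff \<beta> (n - k)) =
     (\<Sum>k\<le>n. of_nat (n choose k) * pochhammer \<alpha> k * pochhammer \<beta> (n - k) / fact n)"
    by (intro sum.cong refl) (simp add: rising_coeff_def binomial_fact)
  then show ?thesis
    by (simp add: rising_coeff_def pochhammer_binomial_sum sum_divide_distrib)
qed

text \<open>With \<open>fact n = n * fact (n - 1)\<close>, the quotient is exactly the reciprocal of
  \<open>Gamma_series'\<close>.\<close>

lemma rising_coeff_tendsto:
  assumes "\<alpha> > 0"
  shows "(\<lambda>n. rising_coeff \<alpha> n / real n powr (\<alpha> - 1)) \<longlonglongrightarrow> 1 / Gamma \<alpha>"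
proof -
  have "Gamma_series' \<alpha> \<longlonglongrightarrow> Gamma \<alpha>"
    by (rule Gamma_series'_LIMSEQ)
  moreover have "Gamma \<alpha> > 0" using assms by (rule Gamma_real_pos)
  ultimately have "(\<lambda>n. 1 / Gamma_series' \<alpha> n) \<longlonglongrightarrow> 1 / Gamma \<alpha>"
    by (intro tendsto_intros) auto
  then show ?thesis
  proof (rule Lim_transform_eventually)
    show "\<forall>\<^sub>F n in sequentially. 1 / Gamma_series' \<alpha> n = rising_coeff \<alpha> n / real n powr (\<alpha> - 1)"
      using eventually_gt_at_top[of 0]
    proof eventually_elim
      case (elim n)
      then have f: "fact n = real n * fact (n - 1)" by (subst fact_reduce) auto
      have "real n powr (\<alpha> - 1) = exp (\<alpha> * ln (real n)) / real n"
        using elim by (simp add: powr_diff powr_def[of "real n" \<alpha>])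
      then show ?case using elim
        by (simp add: Gamma_series'_def rising_coeff_def f)
    qed
  qed
qed

text \<open>The error terms of a convolution will be of size
  \<open>rising_coeff \<alpha> (n div 2)\<close>, of order n^(\<alpha> - 1). The main term has order
  n^(\<alpha> + \<beta> - 1), so the gain is n^(-\<beta>).\<close>

lemma rising_coeff_half_little:
  assumes "\<alpha> > 0" "\<beta> > 0"
  shows "(\<lambda>n. rising_coeff \<alpha> (n div 2) / rising_coeff (\<alpha> + \<beta>) n) \<longlonglongrightarrow> 0"
proof -
  have "filterlim (\<lambda>n::nat. n div 2) at_top at_top"
    unfolding filterlim_at_top
  proof
    fix Z :: nat
    show "\<forall>\<^sub>F n in at_top. Z \<le> n div 2"
      using eventually_ge_at_top[of "2 * Z"] by eventually_elim auto
  qed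
  from filterlim_compose[OF rising_coeff_tendsto[OF assms(1)] this]
  have 1: "(\<lambda>n. rising_coeff \<alpha> (n div 2) / real (n div 2) powr (\<alpha> - 1)) \<longlonglongrightarrow> 1 / Gamma \<alpha>" .
  have 2: "(\<lambda>n. rising_coeff (\<alpha>+\<beta>) n / real n powr (\<alpha> + \<beta> - 1)) \<longlonglongrightarrow> 1 / Gamma (\<alpha>+\<beta>)"
    using assms by (intro rising_coeff_tendsto) auto
  have 3: "(\<lambda>n. real (n div 2) / real n) \<longlonglongrightarrow> 1/2"
  proof (rule real_tendsto_sandwich)
    show "\<forall>\<^sub>F n in sequentially. (real n / 2 - 1/2) / real n \<le> real (n div 2) / real n"
      by (intro always_eventually allI divide_right_mono) linarith+
    show "\<forall>\<^sub>F n in sequentially. real (n div 2) / real n \<le> (real n / 2) / real n"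
      by (intro always_eventually allI divide_right_mono) linarith+
  qed real_asymp+
  have 4: "(\<lambda>n. (real (n div 2) / real n) powr (\<alpha> - 1) * real n powr (-\<beta>)) \<longlonglongrightarrow> (1/2) powr (\<alpha> - 1) * 0"
    using assms by (intro tendsto_mult tendsto_powr 3 tendsto_const tendsto_neg_powr filterlim_real_sequentially) auto
  have "Gamma (\<alpha>+\<beta>) > 0" using assms by (intro Gamma_real_pos) auto
  then have "(\<lambda>n. (rising_coeff \<alpha> (n div 2) / real (n div 2) powr (\<alpha> - 1)) /
         (rising_coeff (\<alpha>+\<beta>) n / real n powr (\<alpha> + \<beta> - 1)) *
         ((real (n div 2) / real n) powr (\<alpha> - 1) * real n powr (-\<beta>))) \<longlonglongrightarrow>
       (1 / Gamma \<alpha>) / (1 / Gamma (\<alpha>+\<beta>)) * ((1/2) powr (\<alpha> - 1) * 0)"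
    by (intro tendsto_mult[OF tendsto_divide[OF 1 2] 4]) auto
  then have L: "(\<lambda>n. (rising_coeff \<alpha> (n div 2) / real (n div 2) powr (\<alpha> - 1)) /
         (rising_coeff (\<alpha>+\<beta>) n / real n powr (\<alpha> + \<beta> - 1)) *
         ((real (n div 2) / real n) powr (\<alpha> - 1) * real n powr (-\<beta>))) \<longlonglongrightarrow> 0"
    by simp
  then show ?thesis
  proof (rule Lim_transform_eventually)
    show "\<forall>\<^sub>F n in sequentially. (rising_coeff \<alpha> (n div 2) / real (n div 2) powr (\<alpha> - 1)) /
         (rising_coeff (\<alpha>+\<beta>) n / real n powr (\<alpha> + \<beta> - 1)) *
         ((real (n div 2) / real n) powr (\<alpha> - 1) * real n powr (-\<beta>))
         = rising_coeff \<alpha> (n div 2) / rising_coeff (\<alpha> + \<beta>) n"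
      using eventually_ge_at_top[of 2]
    proof eventually_elim
      case (elim n)
      then have p: "real n > 0" "real (n div 2) > 0" by auto
      have e: "real n powr (\<alpha> + \<beta> - 1) * real n powr (-\<beta>) = real n powr (\<alpha> - 1)"
        by (simp flip: powr_add)
      have d: "(real (n div 2) / real n) powr (\<alpha> - 1) = real (n div 2) powr (\<alpha> - 1) / real n powr (\<alpha> - 1)"
        by (rule powr_divide)
      have "X / Y / (Z / V) * (Y / W * T) = X / Z" if "V * T = W" "Y \<noteq> 0" "W \<noteq> 0" for X Y Z V W T :: real
        using that by (auto simp: field_simps)
      from this[OF e] show ?case unfolding d using p by auto
    qed
  qed
qed

text \<open>Cut the range into blocks of length \<open>m\<close>. The representatives of two classes
  in one block differ by at most the variation inside it, so any two class sums differ by at most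
  the total variation; averaging over the \<open>m\<close> classes compares one with the total.
  Extending \<phi> by zero lets all classes use the same blocks and produces a last jump, the term
  \<open>\<bar>\<phi> n\<bar>\<close>.\<close>

lemma residue_class_sum:
  fixes \<phi> :: "nat \<Rightarrow> real"
  assumes m: "m > 0" and z: "\<And>k. k > n \<Longrightarrow> \<phi> k = 0"
  shows "\<bar>real m * (\<Sum>k | k \<le> n \<and> k mod m = r mod m. \<phi> k) - (\<Sum>k\<le>n. \<phi> k)\<bar>
           \<le> real m * ((\<Sum>k<n. \<bar>\<phi> (Suc k) - \<phi> k\<bar>) + \<bar>\<phi> n\<bar>)"
proof -
  define S where "S r = (\<Sum>j\<le>n. \<phi> (j * m + r))" for r
  define TV where "TV = (\<Sum>k<Suc n * m. \<bar>\<phi> (Suc k) - \<phi> k\<bar>)"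
  have nm: "n < Suc n * m" using m by (cases m) auto
  have TV: "TV = (\<Sum>k<n. \<bar>\<phi> (Suc k) - \<phi> k\<bar>) + \<bar>\<phi> n\<bar>"
  proof -
    have "TV = (\<Sum>k<Suc n. \<bar>\<phi> (Suc k) - \<phi> k\<bar>)"
      unfolding TV_def using nm z by (intro sum.mono_neutral_right) auto
    then show ?thesis by (simp add: z)
  qed
  have Sr: "(\<Sum>k | k \<le> n \<and> k mod m = r mod m. \<phi> k) = S (r mod m)" for r
  proof -
    have "S (r mod m) = sum \<phi> ((\<lambda>j. j * m + r mod m) ` {..n})"
      unfolding S_def using m by (subst sum.reindex) (auto simp: inj_on_def)
    also have "\<dots> = (\<Sum>k | k \<le> n \<and> k mod m = r mod m. \<phi> k)"
    proof (intro sum.mono_neutral_right)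
      show "{k. k \<le> n \<and> k mod m = r mod m} \<subseteq> (\<lambda>j. j * m + r mod m) ` {..n}"
      proof safe
        fix k assume k: "k \<le> n" "k mod m = r mod m"
        then have "k = (k div m) * m + r mod m" by (metis div_mult_mod_eq)
        moreover have "k div m \<le> n" using k(1) div_le_dividend le_trans by blast
        ultimately show "k \<in> (\<lambda>j. j * m + r mod m) ` {..n}" by blast
      qed
    next
      show "\<forall>i\<in>(\<lambda>j. j * m + r mod m) ` {..n} - {k. k \<le> n \<and> k mod m = r mod m}. \<phi> i = 0"
      proof
        fix i assume i: "i \<in> (\<lambda>j. j * m + r mod m) ` {..n} - {k. k \<le> n \<and> k mod m = r mod m}"
        then have "i mod m = r mod m" by auto
        with i have "i > n" by auto
        then show "\<phi> i = 0" by (rule z)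
      qed
    qed auto
    finally show ?thesis ..
  qed
  have tot: "(\<Sum>k\<le>n. \<phi> k) = (\<Sum>r<m. S r)"
  proof -
    have "(\<Sum>k\<le>n. \<phi> k) = (\<Sum>k<Suc n * m. \<phi> k)"
      using nm z by (intro sum.mono_neutral_left) auto
    also have "\<dots> = (\<Sum>j<Suc n. sum \<phi> {j * m..<j * m + m})"
      by (rule sum.nat_group[symmetric])
    also have "\<dots> = (\<Sum>j<Suc n. \<Sum>r<m. \<phi> (j * m + r))"
    proof (rule sum.cong)
      fix j :: nat
      show "sum \<phi> {j * m..<j * m + m} = (\<Sum>r<m. \<phi> (j * m + r))"
        using sum.shift_bounds_nat_ivl[of \<phi> 0 "j*m" m] by (simp add: lessThan_atLeast0 add.commute)
    qed simp
    finally show ?thesis unfolding S_def lessThan_Suc_atMost by (subst sum.swap) simp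
  qed
  have tele: "\<bar>\<phi> (x + d) - \<phi> x\<bar> \<le> (\<Sum>k\<in>{x..<x+d}. \<bar>\<phi> (Suc k) - \<phi> k\<bar>)" for x d
  proof -
    have "\<phi> (x + d) - \<phi> x = (\<Sum>k\<in>{x..<x+d}. \<phi> (Suc k) - \<phi> k)"
      by (subst sum_Suc_diff') auto
    then show ?thesis by (simp add: sum_abs)
  qed
  have SS: "\<bar>S b - S a\<bar> \<le> TV" if ab: "a \<le> b" "b < m" for a b
  proof -
    have "\<bar>S b - S a\<bar> \<le> (\<Sum>j\<le>n. \<bar>\<phi> (j * m + b) - \<phi> (j * m + a)\<bar>)"
      unfolding S_def sum_subtractf[symmetric] by (rule sum_abs)
    also have "\<dots> \<le> (\<Sum>j\<le>n. \<Sum>k\<in>{j*m..<j*m+m}. \<bar>\<phi> (Suc k) - \<phi> k\<bar>)"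
    proof (rule sum_mono)
      fix j
      have "\<bar>\<phi> (j * m + b) - \<phi> (j * m + a)\<bar> \<le> (\<Sum>k\<in>{j*m+a..<j*m+a+(b-a)}. \<bar>\<phi> (Suc k) - \<phi> k\<bar>)"
        using tele[of "j*m+a" "b-a"] ab by simp
      also have "\<dots> \<le> (\<Sum>k\<in>{j*m..<j*m+m}. \<bar>\<phi> (Suc k) - \<phi> k\<bar>)"
        using ab by (intro sum_mono2) auto
      finally show "\<bar>\<phi> (j * m + b) - \<phi> (j * m + a)\<bar> \<le> (\<Sum>k\<in>{j*m..<j*m+m}. \<bar>\<phi> (Suc k) - \<phi> k\<bar>)" .
    qed
    also have "\<dots> = TV"
      unfolding TV_def using sum.nat_group[of "\<lambda>k. \<bar>\<phi> (Suc k) - \<phi> k\<bar>" m "Suc n"]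
      by (simp only: lessThan_Suc_atMost)
    finally show ?thesis .
  qed
  have SS': "\<bar>S b - S a\<bar> \<le> TV" if "a < m" "b < m" for a b
    using SS[of a b] SS[of b a] that by (cases "a \<le> b") (auto simp: abs_minus_commute)
  have "\<bar>real m * S (r mod m) - (\<Sum>r<m. S r)\<bar> = \<bar>\<Sum>i<m. S (r mod m) - S i\<bar>"
    by (simp add: sum_subtractf)
  also have "\<dots> \<le> (\<Sum>i<m. \<bar>S (r mod m) - S i\<bar>)" by (rule sum_abs)
  also have "\<dots> \<le> (\<Sum>i<m. TV)" using m by (intro sum_mono SS') auto
  finally show ?thesis by (simp add: Sr tot TV)
qed

text \<open>On the first half \<open>v\<close> is evaluated at or above the midpoint, on the second
  half \<open>u\<close> is; that factor is small there while the other one varies by at most 1.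
  Hence each half has variation at most twice a midpoint value, and the boundary term supplies a
  third copy of \<open>u (n div 2)\<close>.\<close>

lemma antimono_convolution_variation:
  fixes u v :: "nat \<Rightarrow> real"
  assumes u: "\<And>m n. m \<le> n \<Longrightarrow> u n \<le> u m" "\<And>n. u n \<ge> 0" "u 0 = 1"
    and v: "\<And>m n. m \<le> n \<Longrightarrow> v n \<le> v m" "\<And>n. v n \<ge> 0" "v 0 = 1"
  shows "(\<Sum>k<n. \<bar>u (Suc k) * v (n - Suc k) - u k * v (n - k)\<bar>) + u n * v 0
           \<le> 3 * (u (n div 2) + v (n div 2))"
proof -
  define H where "H = n div 2"
  have H: "H \<le> n" "H \<le> n - H" by (auto simp: H_def)
  define dv where "dv k = v (n - Suc k) - v (n - k)" for k
  define du where "du k = u k - u (Suc k)" for k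
  have dv0: "dv k \<ge> 0" for k unfolding dv_def using v(1)[of "n - Suc k" "n - k"] by auto
  have du0: "du k \<ge> 0" for k unfolding du_def using u(1)[of k "Suc k"] by auto
  have step: "\<bar>u (Suc k) * v (n - Suc k) - u k * v (n - k)\<bar> \<le> u k * dv k + v (n - Suc k) * du k" for k
  proof -
    have "u (Suc k) * v (n - Suc k) - u k * v (n - k) = u k * dv k - v (n - Suc k) * du k"
      by (simp add: dv_def du_def algebra_simps)
    moreover have "u k * dv k \<ge> 0" "v (n - Suc k) * du k \<ge> 0" using u v dv0 du0 by auto
    ultimately show ?thesis by linarith
  qed
  have su: "(\<Sum>k\<in>{a..<b}. du k) = u a - u b" if "a \<le> b" for a b
    using sum_Suc_diff'[of a b "\<lambda>k. - u k"] that by (simp add: du_def)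
  have sv: "(\<Sum>k\<in>{a..<b}. dv k) = v (n - b) - v (n - a)" if "a \<le> b" for a b
    using sum_Suc_diff'[of a b "\<lambda>k. v (n - k)"] that by (simp add: dv_def)
  have le1: "u k \<le> 1" "v k \<le> 1" for k using u(1)[of 0 k] u(3) v(1)[of 0 k] v(3) by auto
  have "(\<Sum>k\<in>{0..<H}. \<bar>u (Suc k) * v (n - Suc k) - u k * v (n - k)\<bar>)
      \<le> (\<Sum>k\<in>{0..<H}. 1 * dv k + v (n - H) * du k)"
    by (intro sum_mono order_trans[OF step] add_mono mult_right_mono le1 dv0 du0 v) auto
  also have "\<dots> = (v (n - H) - v n) + v (n - H) * (1 - u H)"
    using su[of 0 H] sv[of 0 H] u(3) by (simp add: sum.distrib flip: sum_distrib_left)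
  also have "\<dots> \<le> v (n - H) + v (n - H) * 1"
    using v(2) u(2) by (intro add_mono mult_left_mono) auto
  also have "\<dots> \<le> 2 * v H" using v(1)[OF H(2)] by simp
  finally have A: "(\<Sum>k\<in>{0..<H}. \<bar>u (Suc k) * v (n - Suc k) - u k * v (n - k)\<bar>) \<le> 2 * v H" .
  have "(\<Sum>k\<in>{H..<n}. \<bar>u (Suc k) * v (n - Suc k) - u k * v (n - k)\<bar>)
      \<le> (\<Sum>k\<in>{H..<n}. u H * dv k + 1 * du k)"
    by (intro sum_mono order_trans[OF step] add_mono mult_right_mono le1 dv0 du0 u) auto
  also have "\<dots> = u H * (1 - v (n - H)) + (u H - u n)"
    using su[of H n] sv[of H n] v(3) H by (simp add: sum.distrib flip: sum_distrib_left)
  also have "\<dots> \<le> u H * 1 + u H"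
    using v(2) u(2) by (intro add_mono mult_left_mono) auto
  finally have B: "(\<Sum>k\<in>{H..<n}. \<bar>u (Suc k) * v (n - Suc k) - u k * v (n - k)\<bar>) \<le> 2 * u H" by simp
  have "(\<Sum>k<n. \<bar>u (Suc k) * v (n - Suc k) - u k * v (n - k)\<bar>) =
     (\<Sum>k\<in>{0..<H}. \<bar>u (Suc k) * v (n - Suc k) - u k * v (n - k)\<bar>) +
     (\<Sum>k\<in>{H..<n}. \<bar>u (Suc k) * v (n - Suc k) - u k * v (n - k)\<bar>)"
    using H by (subst sum.atLeastLessThan_concat) (auto simp: lessThan_atLeast0)
  moreover have "u n * v 0 \<le> u H" using u(1)[OF H(1)] v(3) by simp
  moreover have "x + y \<le> 3 * (a + c)" if "x = p + q" "y \<le> a" "p \<le> 2 * c" "q \<le> 2 * a" "0 \<le> c"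
    for x y a c p q :: real using that by (auto simp: distrib_left)
  ultimately show ?thesis using A B v(2)[of H] unfolding H_def[symmetric] by blast
qed

text \<open>Every residue class carries the same share of the Vandermonde sum, because two
  classes differ by at most the total variation of the summand.\<close>
lemma rising_coeff_class_convolution:
  assumes ab: "0 < \<alpha>" "\<alpha> \<le> 1" "0 < \<beta>" "\<beta> \<le> 1" and m: "m > 0"
  shows "(\<lambda>n. (\<Sum>k | k \<le> n \<and> k mod m = r n mod m. rising_coeff \<alpha> k * rising_coeff \<beta> (n - k))
             / rising_coeff (\<alpha> + \<beta>) n) \<longlonglongrightarrow> 1 / real m"
proof -
  define S where "S n = (\<Sum>k | k \<le> n \<and> k mod m = r n mod m. rising_coeff \<alpha> k * rising_coeff \<beta> (n - k))" for n
  have bound: "\<bar>S n / rising_coeff (\<alpha> + \<beta>) n - 1 / real m\<bar> \<le>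
     3 * (rising_coeff \<alpha> (n div 2) / rising_coeff (\<alpha> + \<beta>) n + rising_coeff \<beta> (n div 2) / rising_coeff (\<alpha> + \<beta>) n)" for n
  proof -
    define \<phi> where "\<phi> k = (if k \<le> n then rising_coeff \<alpha> k * rising_coeff \<beta> (n - k) else 0)" for k
    define R where "R = rising_coeff (\<alpha> + \<beta>) n"
    have R: "R > 0" using ab unfolding R_def by (intro rising_coeff_pos) auto
    have S: "S n = (\<Sum>k | k \<le> n \<and> k mod m = r n mod m. \<phi> k)"
      unfolding S_def \<phi>_def by (intro sum.cong) auto
    have T: "(\<Sum>k\<le>n. \<phi> k) = R"
      unfolding R_def \<phi>_def rising_coeff_Vandermonde[symmetric] by (intro sum.cong) auto
    have "\<bar>real m * S n - R\<bar> \<le> real m * ((\<Sum>k<n. \<bar>\<phi> (Suc k) - \<phi> k\<bar>) + \<bar>\<phi> n\<bar>)"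
      unfolding S T[symmetric] using m by (intro residue_class_sum) (auto simp: \<phi>_def)
    moreover have "(\<Sum>k<n. \<bar>\<phi> (Suc k) - \<phi> k\<bar>) + \<bar>\<phi> n\<bar> \<le> 3 * (rising_coeff \<alpha> (n div 2) + rising_coeff \<beta> (n div 2))"
    proof -
    have "(\<Sum>k<n. \<bar>\<phi> (Suc k) - \<phi> k\<bar>) + \<bar>\<phi> n\<bar> =
       (\<Sum>k<n. \<bar>rising_coeff \<alpha> (Suc k) * rising_coeff \<beta> (n - Suc k) - rising_coeff \<alpha> k * rising_coeff \<beta> (n - k)\<bar>)
         + rising_coeff \<alpha> n * rising_coeff \<beta> 0"
      using rising_coeff_pos[OF ab(1), of n]
      by (intro arg_cong2[where f = "(+)"] sum.cong) (auto simp: \<phi>_def)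
    also have "\<dots> \<le> 3 * (rising_coeff \<alpha> (n div 2) + rising_coeff \<beta> (n div 2))"
      using ab by (intro antimono_convolution_variation)
        (auto intro: rising_coeff_antimono less_imp_le[OF rising_coeff_pos])
    finally show ?thesis .
    qed
    ultimately have bnd: "\<bar>real m * S n - R\<bar> \<le> real m * (3 * (rising_coeff \<alpha> (n div 2) + rising_coeff \<beta> (n div 2)))"
      by (meson mult_left_mono of_nat_0_le_iff order_trans)
    have eq: "\<bar>S n / R - 1 / real m\<bar> = \<bar>real m * S n - R\<bar> / (real m * R)"
    proof -
      have "S n / R - 1 / real m = (real m * S n - R) / (real m * R)"
        using R m by (simp add: field_simps)
      then show ?thesis using R m by (simp add: abs_mult)
    qed
    have "\<bar>S n / R - 1 / real m\<bar> \<le> real m * (3 * (rising_coeff \<alpha> (n div 2) + rising_coeff \<beta> (n div 2))) / (real m * R)"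
      unfolding eq by (rule divide_right_mono[OF bnd]) (use R m in auto)
    then show ?thesis unfolding R_def[symmetric] using m by (simp add: add_divide_distrib)
  qed
  have "(\<lambda>n. 3 * (rising_coeff \<alpha> (n div 2) / rising_coeff (\<alpha> + \<beta>) n + rising_coeff \<beta> (n div 2) / rising_coeff (\<alpha> + \<beta>) n)) \<longlonglongrightarrow> 3 * (0 + 0)"
    using rising_coeff_half_little[OF ab(1,3)] rising_coeff_half_little[OF ab(3,1)]
    by (intro tendsto_intros) (auto simp: add.commute)
  then have lim: "(\<lambda>n. 3 * (rising_coeff \<alpha> (n div 2) / rising_coeff (\<alpha> + \<beta>) n + rising_coeff \<beta> (n div 2) / rising_coeff (\<alpha> + \<beta>) n)) \<longlonglongrightarrow> 0"
    by simp
  have "(\<lambda>n. S n / rising_coeff (\<alpha> + \<beta>) n - 1 / real m) \<longlonglongrightarrow> 0"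
    by (rule Lim_null_comparison[OF always_eventually lim]) (simp only: real_norm_def bound simp_thms)
  then show ?thesis unfolding S_def by (rule LIM_zero_cancel)
qed

text \<open>The difference is taken after dividing, so that one limit covers both the asymptotics on
  the multiples of \<open>d\<close> and the smaller order elsewhere. \<open>U = 0\<close> is
  possible and describes a negligible sequence.\<close>

definition periodic_asymp :: "(nat \<Rightarrow> real) \<Rightarrow> nat \<Rightarrow> real \<Rightarrow> real \<Rightarrow> bool" where
  "periodic_asymp u d U \<alpha> \<longleftrightarrow> (\<lambda>n. u n / rising_coeff \<alpha> n - (if d dvd n then U else 0)) \<longlonglongrightarrow> 0"

definition cauchy_conv :: "(nat \<Rightarrow> real) \<Rightarrow> (nat \<Rightarrow> real) \<Rightarrow> nat \<Rightarrow> real" where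
  "cauchy_conv u v n = (\<Sum>k\<le>n. u k * v (n - k))"

lemma cauchy_conv_commute: "cauchy_conv u v = cauchy_conv v u"
proof
  fix n
  show "cauchy_conv u v n = cauchy_conv v u n" unfolding cauchy_conv_def
    by (rule sum.reindex_bij_witness[of _ "\<lambda>k. n - k" "\<lambda>k. n - k"]) auto
qed

lemma periodic_asymp_bounded:
  assumes "periodic_asymp u d U \<alpha>" "\<alpha> > 0"
  obtains C where "C > 0" "\<And>n. \<bar>u n\<bar> \<le> C * rising_coeff \<alpha> n"
proof -
  from assms(1) have "Bseq (\<lambda>n. u n / rising_coeff \<alpha> n - (if d dvd n then U else 0))"
    unfolding periodic_asymp_def by (meson convergent_imp_Bseq convergentI)
  then obtain K where K: "K > 0" "\<And>n. \<bar>u n / rising_coeff \<alpha> n - (if d dvd n then U else 0)\<bar> \<le> K"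
    unfolding Bseq_def by auto
  show thesis
  proof
    show "K + \<bar>U\<bar> > 0" using K by auto
    fix n
    have "\<bar>u n / rising_coeff \<alpha> n\<bar> \<le> K + \<bar>U\<bar>" using K(2)[of n] by (auto split: if_splits)
    then show "\<bar>u n\<bar> \<le> (K + \<bar>U\<bar>) * rising_coeff \<alpha> n"
      using rising_coeff_pos[OF assms(2), of n] by (simp add: abs_div field_simps)
  qed
qed

text \<open>Beyond an index \<open>K\<close> the factor \<open>e\<close> is at most \<delta> times
  the coefficient, and Vandermonde sums these terms exactly. Each of the first \<open>K\<close>
  terms meets \<open>v\<close> at an index of at least \<open>n div 2\<close>, which
  \<open>rising_coeff_half_little\<close> makes negligible.\<close>

lemma cauchy_conv_negligible:
  assumes ab: "0 < \<alpha>" "\<alpha> \<le> 1" "0 < \<beta>" "\<beta> \<le> 1"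
    and e: "(\<lambda>n. e n / rising_coeff \<alpha> n) \<longlonglongrightarrow> 0"
    and v: "\<And>n. \<bar>v n\<bar> \<le> C * rising_coeff \<beta> n" and C: "C > 0"
  shows "(\<lambda>n. cauchy_conv e v n / rising_coeff (\<alpha> + \<beta>) n) \<longlonglongrightarrow> 0"
proof -
  have "periodic_asymp e 1 0 \<alpha>" using e by (simp add: periodic_asymp_def)
  then obtain C' where C': "C' > 0" "\<And>n. \<bar>e n\<bar> \<le> C' * rising_coeff \<alpha> n"
    using ab periodic_asymp_bounded by blast
  have "\<forall>\<^sub>F n in sequentially. \<bar>cauchy_conv e v n / rising_coeff (\<alpha> + \<beta>) n\<bar> < r" if r: "r > 0" for r
  proof -
    define \<delta> where "\<delta> = r / (2 * C)"
    have \<delta>: "\<delta> > 0" "\<delta> * C = r / 2" using r C by (auto simp: \<delta>_def)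
    from e[unfolded tendsto_iff, rule_format, OF \<delta>(1)]
    obtain K where K: "\<And>n. n \<ge> K \<Longrightarrow> \<bar>e n / rising_coeff \<alpha> n\<bar> < \<delta>"
      unfolding eventually_sequentially by auto
    have K': "\<bar>e n\<bar> \<le> \<delta> * rising_coeff \<alpha> n" if "n \<ge> K" for n
      using K[OF that] rising_coeff_pos[OF ab(1), of n] by (simp add: abs_div field_simps)
    have "(\<lambda>n. real K * (C' * C) * (rising_coeff \<beta> (n div 2) / rising_coeff (\<beta> + \<alpha>) n)) \<longlonglongrightarrow> real K * (C' * C) * 0"
      by (intro tendsto_intros rising_coeff_half_little ab)
    then have "\<forall>\<^sub>F n in sequentially. real K * (C' * C) * (rising_coeff \<beta> (n div 2) / rising_coeff (\<beta> + \<alpha>) n) < r / 2"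
      by (rule order_tendstoD) (use r in auto)
    then show ?thesis using eventually_ge_at_top[of "2 * K"]
    proof eventually_elim
      case (elim n)
      have Rp: "rising_coeff (\<alpha> + \<beta>) n > 0" using ab by (intro rising_coeff_pos) auto
      have "\<bar>cauchy_conv e v n\<bar> \<le> (\<Sum>k\<le>n. \<bar>e k\<bar> * \<bar>v (n - k)\<bar>)"
        unfolding cauchy_conv_def abs_mult[symmetric] by (rule sum_abs)
      also have "\<dots> \<le> (\<Sum>k\<le>n. (if k < K then C' * C * rising_coeff \<beta> (n div 2) else 0)
                         + \<delta> * C * (rising_coeff \<alpha> k * rising_coeff \<beta> (n - k)))"
      proof (rule sum_mono)
        fix k assume k: "k \<in> {..n}"
        have p: "rising_coeff \<alpha> k > 0" "rising_coeff \<beta> (n - k) > 0" using ab rising_coeff_pos by auto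
        show "\<bar>e k\<bar> * \<bar>v (n - k)\<bar> \<le> (if k < K then C' * C * rising_coeff \<beta> (n div 2) else 0)
                         + \<delta> * C * (rising_coeff \<alpha> k * rising_coeff \<beta> (n - k))"
        proof (cases "k < K")
          case True
          have "rising_coeff \<alpha> k \<le> 1" using rising_coeff_antimono[OF ab(1,2), of 0 k] by simp
          then have 1: "\<bar>e k\<bar> \<le> C' * 1"
            using C'(2)[of k] C'(1) by (meson less_imp_le mult_left_mono order_trans)
          have "rising_coeff \<beta> (n - k) \<le> rising_coeff \<beta> (n div 2)"
            using True elim ab by (intro rising_coeff_antimono) auto
          then have 2: "\<bar>v (n - k)\<bar> \<le> C * rising_coeff \<beta> (n div 2)"
            using v[of "n - k"] C by (meson less_imp_le mult_left_mono order_trans)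
          have "\<bar>e k\<bar> * \<bar>v (n - k)\<bar> \<le> (C' * 1) * (C * rising_coeff \<beta> (n div 2))"
            using C'(1) by (intro mult_mono 1 2) auto
          moreover have "\<delta> * C * (rising_coeff \<alpha> k * rising_coeff \<beta> (n - k)) \<ge> 0" using p \<delta> C by auto
          ultimately show ?thesis using True by (simp add: mult.assoc)
        next
          case False
          have "\<bar>e k\<bar> * \<bar>v (n - k)\<bar> \<le> (\<delta> * rising_coeff \<alpha> k) * (C * rising_coeff \<beta> (n - k))"
            using False p \<delta> by (intro mult_mono v K') auto
          then show ?thesis using False by (simp add: algebra_simps)
        qed
      qed
      also have "\<dots> = (\<Sum>k\<le>n. if k < K then C' * C * rising_coeff \<beta> (n div 2) else 0)
                      + \<delta> * C * rising_coeff (\<alpha> + \<beta>) n"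
        by (simp add: sum.distrib rising_coeff_Vandermonde flip: sum_distrib_left)
      also have "(\<Sum>k\<le>n. if k < K then C' * C * rising_coeff \<beta> (n div 2) else 0)
          = real (card ({..n} \<inter> {k. k < K})) * (C' * C * rising_coeff \<beta> (n div 2))"
        by (simp add: sum.If_cases)
      also have "\<dots> \<le> real K * (C' * C * rising_coeff \<beta> (n div 2))"
      proof (rule mult_right_mono)
        have "card ({..n} \<inter> {k. k < K}) \<le> card {..<K}" by (intro card_mono) auto
        then show "real (card ({..n} \<inter> {k. k < K})) \<le> real K" by simp
      qed (use C C' rising_coeff_pos[OF ab(3), of "n div 2"] in auto)
      finally have "\<bar>cauchy_conv e v n\<bar> \<le> real K * (C' * C * rising_coeff \<beta> (n div 2)) + r / 2 * rising_coeff (\<alpha> + \<beta>) n"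
        by (simp add: \<delta>)
      then have "\<bar>cauchy_conv e v n\<bar> / rising_coeff (\<alpha> + \<beta>) n \<le>
          (real K * (C' * C * rising_coeff \<beta> (n div 2)) + r / 2 * rising_coeff (\<alpha> + \<beta>) n) / rising_coeff (\<alpha> + \<beta>) n"
        by (rule divide_right_mono) (use Rp in auto)
      also have "\<dots> = real K * (C' * C) * (rising_coeff \<beta> (n div 2) / rising_coeff (\<beta> + \<alpha>) n) + r / 2"
        using Rp by (simp add: add_divide_distrib add.commute mult.assoc)
      also have "\<dots> < r" using elim(1) by linarith
      finally show ?case using Rp by (simp add: abs_div)
    qed
  qed
  then show ?thesis by (simp add: tendsto_iff)
qed

lemma cong_lcm_nat: "[x = y] (mod a) \<Longrightarrow> [x = y] (mod b) \<Longrightarrow> [x = y] (mod lcm a b)"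
  for x y a b :: nat
  by (metis cong_altdef_nat' lcm_least)

text \<open>Chinese remainder theorem for moduli that need not be coprime: \<open>d * x\<close> is
  the gcd modulo \<open>e\<close>, so a multiple of it is 0 modulo \<open>d\<close> and
  \<open>n\<close> modulo \<open>e\<close>, and such a number is unique modulo the lcm.\<close>

lemma dvd_pair_residue_class:
  fixes d e n :: nat
  assumes "gcd d e dvd n" "d > 0" "e > 0"
  obtains r where "\<And>k. k \<le> n \<Longrightarrow> (d dvd k \<and> e dvd (n - k)) \<longleftrightarrow> k mod lcm d e = r mod lcm d e"
proof -
  obtain x where x: "[d * x = gcd d e] (mod e)" using cong_solve_nat[of d e] by auto
  define r where "r = d * x * (n div gcd d e)"
  have "[r = gcd d e * (n div gcd d e)] (mod e)"
    unfolding r_def by (intro cong_mult x) auto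
  then have r: "[r = n] (mod e)" using assms(1) by simp
  have dr: "d dvd r" by (simp add: r_def)
  show thesis
  proof
    fix k assume k: "k \<le> n"
    have "d dvd k \<longleftrightarrow> [k = r] (mod d)"
      using dr by (metis cong_dvd_iff cong_def dvd_eq_mod_eq_0)
    moreover have "e dvd (n - k) \<longleftrightarrow> [k = n] (mod e)"
      using k by (subst cong_sym_eq) (simp add: cong_altdef_nat)
    moreover have "[k = n] (mod e) \<longleftrightarrow> [k = r] (mod e)"
      using r by (meson cong_sym cong_trans)
    moreover have "[k = r] (mod d) \<and> [k = r] (mod e) \<longleftrightarrow> [k = r] (mod lcm d e)"
      by (meson cong_lcm_nat cong_dvd_modulus_nat dvd_lcm1 dvd_lcm2)
    ultimately show "(d dvd k \<and> e dvd (n - k)) \<longleftrightarrow> k mod lcm d e = r mod lcm d e"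
      by (simp add: cong_def)
  qed
qed

lemma cauchy_conv_add:
  "cauchy_conv (\<lambda>k. u k + u' k) v n = cauchy_conv u v n + cauchy_conv u' v n"
  "cauchy_conv u (\<lambda>k. v k + v' k) n = cauchy_conv u v n + cauchy_conv u v' n"
  by (simp_all add: cauchy_conv_def algebra_simps sum.distrib)

text \<open>After removing negligible parts, \<open>u\<close> lives on the multiples of
  \<open>d\<close> and \<open>v\<close> on those of \<open>e\<close>. The summand is then supported
  on one residue class modulo the lcm, which receives the fraction 1 / lcm of the Vandermonde
  sum.\<close>

lemma periodic_asymp_cauchy_conv:
  assumes ab: "0 < \<alpha>" "\<alpha> \<le> 1" "0 < \<beta>" "\<beta> \<le> 1"
    and d: "d > 0" "e > 0"
    and u: "periodic_asymp u d U \<alpha>" and v: "periodic_asymp v e V \<beta>"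
  shows "periodic_asymp (cauchy_conv u v) (gcd d e) (U * V / real (lcm d e)) (\<alpha> + \<beta>)"
proof -
  define u0 where "u0 k = (if d dvd k then U * rising_coeff \<alpha> k else 0)" for k
  define v0 where "v0 k = (if e dvd k then V * rising_coeff \<beta> k else 0)" for k
  define R where "R = rising_coeff (\<alpha> + \<beta>)"
  have Rp: "R n > 0" for n unfolding R_def using ab by (intro rising_coeff_pos) auto
  have split: "cauchy_conv u v n = cauchy_conv u0 v0 n + (cauchy_conv (\<lambda>k. u k - u0 k) v n
      + cauchy_conv (\<lambda>k. v k - v0 k) u0 n)" for n
  proof -
    have "cauchy_conv u v n = cauchy_conv u0 v n + cauchy_conv (\<lambda>k. u k - u0 k) v n"
      by (simp flip: cauchy_conv_add)
    also have "cauchy_conv u0 v n = cauchy_conv u0 v0 n + cauchy_conv u0 (\<lambda>k. v k - v0 k) n"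
      by (simp flip: cauchy_conv_add)
    finally show ?thesis by (simp add: cauchy_conv_commute[of u0 "\<lambda>k. v k - v0 k"])
  qed
  have ue: "(\<lambda>n. (u n - u0 n) / rising_coeff \<alpha> n) \<longlonglongrightarrow> 0"
    using u unfolding periodic_asymp_def
  proof (rule Lim_transform_eventually, intro always_eventually allI)
    fix n show "u n / rising_coeff \<alpha> n - (if d dvd n then U else 0) = (u n - u0 n) / rising_coeff \<alpha> n"
      using rising_coeff_pos[OF ab(1), of n] by (auto simp: u0_def field_simps)
  qed
  have ve: "(\<lambda>n. (v n - v0 n) / rising_coeff \<beta> n) \<longlonglongrightarrow> 0"
    using v unfolding periodic_asymp_def
  proof (rule Lim_transform_eventually, intro always_eventually allI)
    fix n show "v n / rising_coeff \<beta> n - (if e dvd n then V else 0) = (v n - v0 n) / rising_coeff \<beta> n"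
      using rising_coeff_pos[OF ab(3), of n] by (auto simp: v0_def field_simps)
  qed
  obtain C where C: "C > 0" "\<And>n. \<bar>v n\<bar> \<le> C * rising_coeff \<beta> n"
    using periodic_asymp_bounded[OF v ab(3)] by blast
  have E1: "(\<lambda>n. cauchy_conv (\<lambda>k. u k - u0 k) v n / R n) \<longlonglongrightarrow> 0"
    unfolding R_def by (rule cauchy_conv_negligible[OF ab ue C(2) C(1)])
  have u0b: "\<bar>u0 n\<bar> \<le> (\<bar>U\<bar> + 1) * rising_coeff \<alpha> n" for n
    using rising_coeff_pos[OF ab(1), of n] by (auto simp: u0_def abs_mult algebra_simps)
  have E2: "(\<lambda>n. cauchy_conv (\<lambda>k. v k - v0 k) u0 n / R n) \<longlonglongrightarrow> 0"
    unfolding R_def add.commute[of \<alpha> \<beta>] by (rule cauchy_conv_negligible[OF ab(3,4,1,2) ve u0b]) auto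
  define L where "L = lcm d e"
  have L: "L > 0" using d by (simp add: L_def lcm_pos_nat)
  \<comment> \<open>The class depends on \<open>n\<close>, which
    \<open>rising_coeff_class_convolution\<close> permits. If the gcd does not divide
    \<open>n\<close>, the value \<open>r n\<close> is arbitrary and the main term is 0.\<close>
  define r where "r n = (SOME r. \<forall>k\<le>n. (d dvd k \<and> e dvd (n - k)) \<longleftrightarrow> k mod L = r mod L)" for n
  have r: "(d dvd k \<and> e dvd (n - k)) \<longleftrightarrow> k mod L = r n mod L" if "gcd d e dvd n" "k \<le> n" for n k
  proof -
    have "\<exists>r. \<forall>k\<le>n. (d dvd k \<and> e dvd (n - k)) \<longleftrightarrow> k mod L = r mod L"
      using dvd_pair_residue_class[OF that(1) d] unfolding L_def by metis
    from someI_ex[OF this] show ?thesis using that(2) unfolding r_def by blast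
  qed
  define T where "T n = (\<Sum>k | k \<le> n \<and> k mod L = r n mod L. rising_coeff \<alpha> k * rising_coeff \<beta> (n - k))" for n
  have T: "(\<lambda>n. T n / R n) \<longlonglongrightarrow> 1 / real L"
    unfolding T_def R_def by (rule rising_coeff_class_convolution[OF ab L])
  have main: "cauchy_conv u0 v0 n = (if gcd d e dvd n then U * V * T n else 0)" for n
  proof (cases "gcd d e dvd n")
    case True
    have "cauchy_conv u0 v0 n = (\<Sum>k\<le>n. if k mod L = r n mod L then U * V * (rising_coeff \<alpha> k * rising_coeff \<beta> (n - k)) else 0)"
      unfolding cauchy_conv_def u0_def v0_def
      by (intro sum.cong refl) (auto simp flip: r[OF True])
    also have "\<dots> = (\<Sum>k | k \<le> n \<and> k mod L = r n mod L. U * V * (rising_coeff \<alpha> k * rising_coeff \<beta> (n - k)))"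
      by (subst sum.inter_filter[symmetric]) auto
    finally show ?thesis using True by (simp add: T_def sum_distrib_left)
  next
    case False
    have "u0 k * v0 (n - k) = 0" if "k \<le> n" for k
    proof (rule ccontr)
      assume "u0 k * v0 (n - k) \<noteq> 0"
      then have "d dvd k" "e dvd (n - k)" by (auto simp: u0_def v0_def split: if_splits)
      then have "gcd d e dvd k + (n - k)" by (meson dvd_add dvd_trans gcd_dvd1 gcd_dvd2)
      with False that show False by simp
    qed
    then show ?thesis using False unfolding cauchy_conv_def by (auto intro!: sum.neutral)
  qed
  have M: "(\<lambda>n. cauchy_conv u0 v0 n / R n - (if gcd d e dvd n then U * V / real L else 0)) \<longlonglongrightarrow> 0"
  proof (rule Lim_null_comparison)
    show "\<forall>\<^sub>F n in sequentially. norm (cauchy_conv u0 v0 n / R n - (if gcd d e dvd n then U * V / real L else 0))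
        \<le> \<bar>U * V\<bar> * \<bar>T n / R n - 1 / real L\<bar>"
      unfolding main by (intro always_eventually) (auto simp: right_diff_distrib simp flip: abs_mult)
    have "(\<lambda>n. \<bar>U * V\<bar> * \<bar>T n / R n - 1 / real L\<bar>) \<longlonglongrightarrow> \<bar>U * V\<bar> * \<bar>1 / real L - 1 / real L\<bar>"
      by (intro tendsto_intros T)
    then show "(\<lambda>n. \<bar>U * V\<bar> * \<bar>T n / R n - 1 / real L\<bar>) \<longlonglongrightarrow> 0" by simp
  qed
  have "(\<lambda>n. cauchy_conv u0 v0 n / R n - (if gcd d e dvd n then U * V / real L else 0)
         + (cauchy_conv (\<lambda>k. u k - u0 k) v n / R n + cauchy_conv (\<lambda>k. v k - v0 k) u0 n / R n)) \<longlonglongrightarrow> 0 + (0 + 0)"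
    by (intro tendsto_add M E1 E2)
  then show ?thesis unfolding periodic_asymp_def split R_def L_def
    by (simp add: add_divide_distrib algebra_simps)
qed

section \<open>Weighted solutions of a linear equation\<close>

definition sols :: "(nat \<Rightarrow> nat) \<Rightarrow> nat \<Rightarrow> nat \<Rightarrow> (nat \<Rightarrow> nat) set" where
  "sols b l n = {k \<in> {..<l} \<rightarrow>\<^sub>E UNIV. (\<Sum>i<l. b i * k i) = n}"

lemma sols_le:
  assumes "\<forall>i<l. b i > 0" "k \<in> sols b l n" "i < l"
  shows "b i * k i \<le> n" "k i \<le> n"
proof -
  have "b i * k i \<le> (\<Sum>i<l. b i * k i)"
    using assms(3) by (intro member_le_sum) auto
  then show 1: "b i * k i \<le> n" using assms(2) by (simp add: sols_def)
  have "b i > 0" using assms by auto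
  then have "k i \<le> b i * k i" by simp
  from this 1 show "k i \<le> n" by (rule order_trans)
qed

lemma finite_sols:
  assumes "\<forall>i<l. b i > 0"
  shows "finite (sols b l n)"
proof (rule finite_subset)
  show "sols b l n \<subseteq> {..<l} \<rightarrow>\<^sub>E {..n}"
  proof
    fix k assume k: "k \<in> sols b l n"
    then show "k \<in> {..<l} \<rightarrow>\<^sub>E {..n}"
      using sols_le(2)[OF assms k] by (auto simp: sols_def PiE_iff)
  qed
qed (auto intro: finite_PiE)

text \<open>Split off the last coordinate: \<open>j\<close> is the contribution of the first
  \<open>l\<close> coordinates, and \<open>n - j\<close> has to be a multiple of \<open>b l\<close>.
  Thus every variable adds one convolution factor.\<close>

lemma sum_sols_Suc:
  fixes w :: "nat \<Rightarrow> real"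
  assumes b: "\<forall>i<Suc l. b i > 0"
  shows "(\<Sum>k\<in>sols b (Suc l) n. \<Prod>i<Suc l. w (k i)) =
    cauchy_conv (\<lambda>j. \<Sum>k\<in>sols b l j. \<Prod>i<l. w (k i))
                (\<lambda>j. if b l dvd j then w (j div b l) else 0) n"
proof -
  have bl: "b l > 0" and b': "\<forall>i<l. b i > 0" using b by auto
  have "(\<Sum>k\<in>sols b (Suc l) n. \<Prod>i<Suc l. w (k i)) =
    (\<Sum>(j, k)\<in>(SIGMA j:{j. j \<le> n \<and> b l dvd (n - j)}. sols b l j). (\<Prod>i<l. w (k i)) * w ((n - j) div b l))"
  proof (rule sum.reindex_bij_witness[where
        j = "\<lambda>k. (\<Sum>i<l. b i * k i, restrict k {..<l})" and
        i = "\<lambda>(j, k). k(l := (n - j) div b l)"])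
    fix k assume k: "k \<in> sols b (Suc l) n"
    then have s: "(\<Sum>i<l. b i * k i) + b l * k l = n" and ext: "k \<in> {..<Suc l} \<rightarrow>\<^sub>E UNIV"
      by (auto simp: sols_def)
    from s have d: "n - (\<Sum>i<l. b i * k i) = b l * k l" by linarith
    show "(case (\<Sum>i<l. b i * k i, restrict k {..<l}) of (j, k) \<Rightarrow> k(l := (n - j) div b l)) = k"
    proof
      fix i show "(case (\<Sum>i<l. b i * k i, restrict k {..<l}) of (j, k) \<Rightarrow> k(l := (n - j) div b l)) i = k i"
        using d bl ext by (auto simp: PiE_iff extensional_def)
    qed
    show "(\<Sum>i<l. b i * k i, restrict k {..<l}) \<in> (SIGMA j:{j. j \<le> n \<and> b l dvd (n - j)}. sols b l j)"
      using s d by (auto simp: sols_def)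
    show "(case (\<Sum>i<l. b i * k i, restrict k {..<l}) of (j, k) \<Rightarrow> (\<Prod>i<l. w (k i)) * w ((n - j) div b l)) =
         (\<Prod>i<Suc l. w (k i))"
      using d bl by simp
  next
    fix p assume "p \<in> (SIGMA j:{j. j \<le> n \<and> b l dvd (n - j)}. sols b l j)"
    then obtain j k where p: "p = (j, k)" "j \<le> n" "b l dvd (n - j)" "k \<in> sols b l j" by auto
    have e: "(\<Sum>i<l. b i * (k(l := (n - j) div b l)) i) = j"
      using p(4) by (auto simp: sols_def)
    have r: "restrict (k(l := (n - j) div b l)) {..<l} = k"
      using p(4) by (auto simp: sols_def PiE_iff extensional_def restrict_def)
    show "(\<Sum>i<l. b i * (case p of (j, k) \<Rightarrow> k(l := (n - j) div b l)) i,
          restrict (case p of (j, k) \<Rightarrow> k(l := (n - j) div b l)) {..<l}) = p"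
      using e r p(1) by simp
    show "(case p of (j, k) \<Rightarrow> k(l := (n - j) div b l)) \<in> sols b (Suc l) n"
      using p e by (auto simp: sols_def PiE_iff extensional_def)
  qed
  also have "\<dots> = (\<Sum>j | j \<le> n \<and> b l dvd (n - j). (\<Sum>k\<in>sols b l j. (\<Prod>i<l. w (k i))) * w ((n - j) div b l))"
    by (subst sum.Sigma[symmetric]) (auto simp: finite_sols b' sum_distrib_right)
  also have "\<dots> = (\<Sum>j\<le>n. if b l dvd (n - j) then (\<Sum>k\<in>sols b l j. (\<Prod>i<l. w (k i))) * w ((n - j) div b l) else 0)"
    by (subst sum.inter_filter[symmetric]) auto
  finally show ?thesis unfolding cauchy_conv_def by (simp add: if_distrib cong: if_cong)
qed

text \<open>The factor of a single variable: n^(s - 1) is asymptotically Gamma s times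
  \<open>rising_coeff s n\<close>, and the dilation contributes b^(1 - s).\<close>

lemma periodic_asymp_power_dilate:
  assumes s: "s > 0" and b: "b > 0"
  shows "periodic_asymp (\<lambda>j. if b dvd j then real (j div b) powr (s - 1) else 0) b (Gamma s * real b powr (1 - s)) s"
proof -
  have G: "Gamma s > 0" using s by (rule Gamma_real_pos)
  have "(\<lambda>n. real b powr (1 - s) * (1 / (rising_coeff s n / real n powr (s - 1)))) \<longlonglongrightarrow> real b powr (1 - s) * (1 / (1 / Gamma s))"
    by (intro tendsto_intros rising_coeff_tendsto s) (use G in auto)
  then have "(\<lambda>n. \<bar>real b powr (1 - s) * (1 / (rising_coeff s n / real n powr (s - 1))) - real b powr (1 - s) * (1 / (1 / Gamma s))\<bar>) \<longlonglongrightarrow> 0"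
    using LIM_zero tendsto_rabs_zero by blast
  then show ?thesis unfolding periodic_asymp_def
  proof (rule Lim_null_comparison[rotated])
    show "\<forall>\<^sub>F n in sequentially. norm ((if b dvd n then real (n div b) powr (s - 1) else 0) / rising_coeff s n -
              (if b dvd n then Gamma s * real b powr (1 - s) else 0))
         \<le> \<bar>real b powr (1 - s) * (1 / (rising_coeff s n / real n powr (s - 1))) - real b powr (1 - s) * (1 / (1 / Gamma s))\<bar>"
    proof (rule always_eventually, rule allI)
      fix n
      show "norm ((if b dvd n then real (n div b) powr (s - 1) else 0) / rising_coeff s n -
              (if b dvd n then Gamma s * real b powr (1 - s) else 0))
         \<le> \<bar>real b powr (1 - s) * (1 / (rising_coeff s n / real n powr (s - 1))) - real b powr (1 - s) * (1 / (1 / Gamma s))\<bar>"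
      proof (cases "b dvd n")
        case True
        have "real (n div b) powr (s - 1) = (real n / real b) powr (s - 1)"
          using True by (simp add: real_of_nat_div)
        also have "\<dots> = real n powr (s - 1) * real b powr (1 - s)"
          by (simp add: powr_divide powr_diff field_simps)
        finally show ?thesis using True by (simp add: mult.commute)
      qed auto
    qed
  qed
qed

text \<open>By induction on the number of variables, the constant is the gcd of the coefficients
  used so far times the product. With all \<open>h\<close> variables the gcd is 1 and the exponent
  is 1, where \<open>rising_coeff\<close> is constantly 1, so a genuine limit remains. As
  \<open>0 powr x = 0\<close>, tuples with a zero entry contribute nothing.\<close>

lemma power_weighted_sols_tendsto:
  assumes h: "h > 0" and b: "\<forall>i<h. b i > 0" and g: "Gcd (b ` {..<h}) = 1"
  shows "(\<lambda>n. \<Sum>k\<in>sols b h n. \<Prod>i<h. real (k i) powr (1 / real h - 1))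
           \<longlonglongrightarrow> (\<Prod>i<h. Gamma (1 / real h) * real (b i) powr (- 1 / real h))"
proof -
  define s where "s = 1 / real h"
  have s: "0 < s" "s \<le> 1" using h by (auto simp: s_def)
  define D where "D l n = (\<Sum>k\<in>sols b l n. \<Prod>i<l. real (k i) powr (s - 1))" for l n
  define u where "u l j = (if b l dvd j then real (j div b l) powr (s - 1) else 0)" for l j
  have D_Suc: "D (Suc l) = cauchy_conv (D l) (u l)" if "Suc l \<le> h" for l
  proof
    fix n show "D (Suc l) n = cauchy_conv (D l) (u l) n"
      unfolding D_def u_def by (rule sum_sols_Suc) (use b that in auto)
  qed
  have D0: "D 0 n = (if n = 0 then 1 else 0)" for n
    by (auto simp: D_def sols_def)
  have "periodic_asymp (D (Suc l)) (Gcd (b ` {..<Suc l}))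
     (real (Gcd (b ` {..<Suc l})) * (\<Prod>i<Suc l. Gamma s * real (b i) powr (- s))) (real (Suc l) * s)"
    if "Suc l \<le> h" for l
    using that
  proof (induction l)
    \<comment> \<open>The induction starts with one variable: the convolution lemma requires
      positive exponents, whereas \<open>D 0\<close> is the unit of convolution.\<close>
    case 0
    have "D (Suc 0) = u 0"
    proof
      fix n
      have "D (Suc 0) n = (\<Sum>k\<le>n. D 0 k * u 0 (n - k))" using D_Suc[of 0] 0 by (simp add: cauchy_conv_def)
      also have "\<dots> = (\<Sum>k\<in>{0}. D 0 k * u 0 (n - k))"
        by (rule sum.mono_neutral_right) (auto simp: D0)
      finally show "D (Suc 0) n = u 0 n" by (simp add: D0)
    qed
    moreover have b0: "b 0 > 0" using b 0 by auto
    moreover have eq: "real (b 0) * (Gamma s * real (b 0) powr (- s)) = Gamma s * real (b 0) powr (1 - s)"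
      using b0 by (simp add: powr_diff powr_minus field_simps)
    moreover have "periodic_asymp (u 0) (b 0) (Gamma s * real (b 0) powr (1 - s)) s"
      unfolding u_def by (rule periodic_asymp_power_dilate) (use s b0 in auto)
    ultimately show ?case by (simp add: lessThan_Suc eq)
  next
    case (Suc l)
    define g where "g = Gcd (b ` {..<Suc l})"
    define c where "c = b (Suc l)"
    have c: "c > 0" using b Suc by (auto simp: c_def)
    have "g dvd b 0" unfolding g_def by (rule Gcd_dvd) auto
    moreover have "b 0 > 0" using b h by auto
    ultimately have g: "g > 0" by (metis dvd_0_left gr0I less_not_refl)
    have l: "real (Suc l) * s \<le> 1" "real (Suc l) * s > 0"
      using Suc.prems s h by (auto simp: s_def field_simps)
    have "periodic_asymp (cauchy_conv (D (Suc l)) (u (Suc l))) (gcd g c)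
      ((real g * (\<Prod>i<Suc l. Gamma s * real (b i) powr (- s))) * (Gamma s * real c powr (1 - s)) / real (lcm g c))
      (real (Suc l) * s + s)"
    proof (rule periodic_asymp_cauchy_conv)
      show "periodic_asymp (u (Suc l)) c (Gamma s * real c powr (1 - s)) s"
        unfolding u_def c_def[symmetric] by (rule periodic_asymp_power_dilate) (use s c in auto)
      show "periodic_asymp (D (Suc l)) g (real g * (\<Prod>i<Suc l. Gamma s * real (b i) powr (- s))) (real (Suc l) * s)"
        using Suc.IH Suc.prems unfolding g_def by simp
    qed (use s l g c in auto)
    moreover have "Gcd (b ` {..<Suc (Suc l)}) = gcd g c"
      unfolding g_def c_def lessThan_Suc[of "Suc l"] by (simp add: gcd.commute)
    \<comment> \<open>The identity gcd * lcm = product turns the constant for \<open>g\<close> into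
      the one for \<open>gcd g c\<close>.\<close>
    moreover have "(real g * (\<Prod>i<Suc l. Gamma s * real (b i) powr (- s))) * (Gamma s * real c powr (1 - s)) / real (lcm g c)
       = real (gcd g c) * (\<Prod>i<Suc (Suc l). Gamma s * real (b i) powr (- s))"
    proof -
      have "real (gcd g c) * real (lcm g c) = real g * real c"
        by (simp only: of_nat_mult[symmetric] prod_gcd_lcm_nat[symmetric])
      moreover have "real c powr (1 - s) = real c * real c powr (- s)"
        using c by (simp add: powr_diff powr_minus field_simps)
      moreover have "real (lcm g c) > 0" using g c by (simp add: lcm_pos_nat)
      moreover have "(G * P) * (W * C) / L = X * (P * (W * C'))" if "X * L = G * c'" "C = c' * C'" "L > 0"
        for G P W C L X c' C' :: real
      proof -
        have "(G * P) * (W * C) = (G * c') * (P * W * C')" by (simp add: that(2))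
        also have "\<dots> = X * (P * (W * C')) * L" by (simp flip: that(1))
        finally show ?thesis using that(3) by (simp add: field_simps)
      qed
      ultimately show ?thesis unfolding prod.lessThan_Suc[of _ "Suc l"] c_def[symmetric] by blast
    qed
    moreover have "real (Suc l) * s + s = real (Suc (Suc l)) * s" by (simp add: algebra_simps)
    ultimately show ?case using D_Suc[of "Suc l"] Suc.prems by simp
  qed
  from this[of "h - 1"] have "periodic_asymp (D h) 1 (\<Prod>i<h. Gamma s * real (b i) powr (- s)) (real h * s)"
    using h g by simp
  moreover have "real h * s = 1" using h by (simp add: s_def)
  ultimately have "(\<lambda>n. D h n - (\<Prod>i<h. Gamma s * real (b i) powr (- s))) \<longlonglongrightarrow> 0"
    by (simp add: periodic_asymp_def)
  then have "D h \<longlonglongrightarrow> (\<Prod>i<h. Gamma s * real (b i) powr (- s))" by (rule LIM_zero_cancel)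
  then show ?thesis by (simp add: D_def[abs_def] s_def)
qed

section \<open>Supports, coincidence patterns, and tuples that are degenerate or have small
  entries\<close>

definition nz_supp :: "nat \<Rightarrow> (nat \<Rightarrow> nat) \<Rightarrow> nat set" where
  "nz_supp h k = k ` {..<h} - {0}"

definition good_sols :: "(nat \<Rightarrow> nat) \<Rightarrow> nat \<Rightarrow> real \<Rightarrow> nat \<Rightarrow> (nat \<Rightarrow> nat) set" where
  "good_sols b h t n = {k \<in> sols b h n. inj_on k {..<h} \<and> (\<forall>i<h. t \<le> real (k i))}"

lemma finite_nz_supp [simp]: "finite (nz_supp h k)"
  by (simp add: nz_supp_def)

text \<open>Telescope against \<open>h * m powr (1 / h)\<close>, whose increments dominate the
  summands by concavity of the root. The concavity is Bernoulli's inequality for y^h = m / (m +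
  1).\<close>

lemma sum_powr_le:
  assumes h: "h > 0"
  shows "(\<Sum>v=1..m. real v powr (1 / real h - 1)) \<le> real h * real m powr (1 / real h)"
proof (induction m)
  case 0
  then show ?case by simp
next
  case (Suc m)
  define s where "s = 1 / real h"
  define x where "x = real m / real (Suc m)"
  define y where "y = x powr s"
  have x: "0 \<le> x" by (simp add: x_def)
  have "y ^ h = x"
  proof (cases "x = 0")
    case True
    then show ?thesis using h by (simp add: y_def)
  next
    case False
    then have "y ^ h = x powr (s * real h)" using x by (simp add: y_def powr_powr flip: powr_realpow)
    then show ?thesis using h x False by (simp add: s_def)
  qed
  moreover have "1 + real h * (y - 1) \<le> (1 + (y - 1)) ^ h"
    by (rule Bernoulli_inequality) (simp add: y_def)
  ultimately have "real h * y \<le> real h - (1 - x)" by (simp add: algebra_simps)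
  moreover have "1 - x = 1 / real (Suc m)" by (simp add: x_def field_simps)
  ultimately have 1: "real h * y \<le> real h - 1 / real (Suc m)" by simp
  have "real m powr s = y * real (Suc m) powr s"
    by (simp add: y_def x_def powr_divide)
  then have "real h * real m powr s = (real h * y) * real (Suc m) powr s" by simp
  also have "\<dots> \<le> (real h - 1 / real (Suc m)) * real (Suc m) powr s"
    by (rule mult_right_mono[OF 1]) simp
  also have "\<dots> = real h * real (Suc m) powr s - real (Suc m) powr (s - 1)"
    by (simp add: algebra_simps powr_diff)
  finally show ?case using Suc.IH by (simp add: s_def)
qed

lemma sum_weight_le:
  fixes w :: "nat \<Rightarrow> real"
  assumes h: "h > 0" and L: "L \<ge> 0" and w: "\<And>v. 1 \<le> v \<Longrightarrow> v \<le> n \<Longrightarrow> w v \<le> L * real v powr (1 / real h - 1)"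
    and x: "0 \<le> x" "x \<le> real n" and V: "V \<subseteq> {v. 1 \<le> v \<and> real v \<le> x}" and w0: "\<And>v. 0 \<le> w v"
  shows "(\<Sum>v\<in>V. w v) \<le> L * (real h * x powr (1 / real h))"
proof -
  define m where "m = nat \<lfloor>x\<rfloor>"
  have m: "real m \<le> x" "m \<le> n" using x by (auto simp: m_def) linarith+
  have V': "V \<subseteq> {1..m}" using V by (auto simp: m_def le_nat_floor)
  have "(\<Sum>v\<in>V. w v) \<le> (\<Sum>v=1..m. w v)"
    by (rule sum_mono2) (use V' w0 in auto)
  also have "\<dots> \<le> (\<Sum>v=1..m. L * real v powr (1 / real h - 1))"
    by (rule sum_mono) (use w m in auto)
  also have "\<dots> = L * (\<Sum>v=1..m. real v powr (1 / real h - 1))" by (simp add: sum_distrib_left)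
  also have "\<dots> \<le> L * (real h * real m powr (1 / real h))"
    by (intro mult_left_mono sum_powr_le h L)
  also have "\<dots> \<le> L * (real h * x powr (1 / real h))"
    using m L by (intro mult_left_mono powr_mono2) auto
  finally show ?thesis .
qed

text \<open>The coordinates in \<open>G\<close> determine the tuple, so the sum embeds into a sum
  over a box, which factorises.\<close>

lemma sum_prod_inj_le:
  fixes w :: "nat \<Rightarrow> real" and X :: "(nat \<Rightarrow> nat) set"
  assumes G: "finite G" and inj: "inj_on (\<lambda>k. restrict k G) X"
    and V: "\<And>i. i \<in> G \<Longrightarrow> finite (V i)" "\<And>k i. k \<in> X \<Longrightarrow> i \<in> G \<Longrightarrow> k i \<in> V i"
    and w: "\<And>v. 0 \<le> w v"
  shows "(\<Sum>k\<in>X. \<Prod>i\<in>G. w (k i)) \<le> (\<Prod>i\<in>G. \<Sum>v\<in>V i. w v)"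
proof -
  have "(\<Sum>k\<in>X. \<Prod>i\<in>G. w (k i)) = (\<Sum>f\<in>(\<lambda>k. restrict k G) ` X. \<Prod>i\<in>G. w (f i))"
    using inj by (subst sum.reindex) (auto intro!: sum.cong prod.cong)
  also have "\<dots> \<le> (\<Sum>f\<in>PiE G V. \<Prod>i\<in>G. w (f i))"
    using G V w by (intro sum_mono2 finite_PiE) (auto intro!: prod_nonneg)
  also have "\<dots> = (\<Prod>i\<in>G. \<Sum>v\<in>V i. w v)"
    using G V by (subst prod_sum_PiE) auto
  finally show ?thesis .
qed

text \<open>The out-of-range value \<open>h\<close> marks the zero entries of \<open>k\<close>.\<close>
definition pattern :: "nat \<Rightarrow> (nat \<Rightarrow> nat) \<Rightarrow> nat \<Rightarrow> nat" where
  "pattern h k = (\<lambda>i\<in>{..<h}. if k i = 0 then h else LEAST j. k j = k i)"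

text \<open>One index per distinct nonzero entry: the coordinates that can vary within a given
  pattern.\<close>

definition reps :: "nat \<Rightarrow> (nat \<Rightarrow> nat) \<Rightarrow> nat set" where
  "reps h \<pi> = \<pi> ` {..<h} - {h}"

lemma pattern_nz:
  assumes "i < h" "k i \<noteq> 0"
  shows "pattern h k i < h" "k (pattern h k i) = k i" "pattern h k i \<in> reps h (pattern h k)"
proof -
  have e: "pattern h k i = (LEAST j. k j = k i)" using assms by (simp add: pattern_def)
  show "k (pattern h k i) = k i" unfolding e by (rule LeastI) simp
  \<comment> \<open>\<open>LEAST\<close> ranges over all naturals, but \<open>i\<close> is a
    candidate and keeps the result below \<open>h\<close>.\<close>
  have "(LEAST j. k j = k i) \<le> i" by (rule Least_le) simp
  with assms e show lt: "pattern h k i < h" by simp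
  then show "pattern h k i \<in> reps h (pattern h k)" using assms by (auto simp: reps_def)
qed

lemma pattern_funcset: "pattern h k \<in> {..<h} \<rightarrow>\<^sub>E {..h}"
proof (rule PiE_I)
  fix i assume "i \<in> {..<h}"
  then show "pattern h k i \<in> {..h}"
    using pattern_nz(1)[of i h k] by (cases "k i = 0") (auto simp: pattern_def)
qed (auto simp: pattern_def)

lemma pattern_eq_h_iff: "i < h \<Longrightarrow> pattern h k i = h \<longleftrightarrow> k i = 0"
  using pattern_nz(1)[of i h k] by (auto simp: pattern_def)

lemma reps_patternD:
  assumes "i \<in> reps h (pattern h k)"
  shows "i < h" "k i \<noteq> 0" "pattern h k i = i"
proof -
  from assms obtain j where j: "j < h" "i = pattern h k j" "i \<noteq> h" by (auto simp: reps_def)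
  then have nz: "k j \<noteq> 0" using pattern_eq_h_iff by metis
  note * = pattern_nz[of j h k, OF j(1) nz]
  show lt: "i < h" using * j by simp
  show i0: "k i \<noteq> 0" using * j nz by simp
  have "pattern h k i = (LEAST l. k l = k i)" using lt i0 by (simp add: pattern_def)
  also have "k i = k j" using * j by simp
  also have "(LEAST l. k l = k j) = i" using j nz by (simp add: pattern_def)
  finally show "pattern h k i = i" .
qed

lemma inj_on_reps: "inj_on k (reps h (pattern h k))"
proof (rule inj_onI)
  fix i j assume ij: "i \<in> reps h (pattern h k)" "j \<in> reps h (pattern h k)" "k i = k j"
  have "pattern h k i = pattern h k j"
    using reps_patternD(1)[OF ij(1)] reps_patternD(1)[OF ij(2)] ij(3) by (simp add: pattern_def)
  then show "i = j" using reps_patternD(3)[OF ij(1)] reps_patternD(3)[OF ij(2)] by simp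
qed

lemma image_reps: "k ` reps h (pattern h k) = nz_supp h k"
proof (intro equalityI subsetI)
  fix x assume "x \<in> k ` reps h (pattern h k)"
  then show "x \<in> nz_supp h k" using reps_patternD by (auto simp: nz_supp_def)
next
  fix x assume "x \<in> nz_supp h k"
  then obtain i where "i < h" "x = k i" "k i \<noteq> 0" by (auto simp: nz_supp_def)
  then show "x \<in> k ` reps h (pattern h k)" using pattern_nz[of i h k] by (metis imageI)
qed

lemma prod_nz_supp: "(\<Prod>u\<in>nz_supp h k. w u) = (\<Prod>i\<in>reps h (pattern h k). w (k i))"
  unfolding image_reps[symmetric] by (subst prod.reindex[OF inj_on_reps]) simp

lemma reps_fullD:
  assumes "reps h (pattern h k) = {..<h}"
  shows "inj_on k {..<h}" "nz_supp h k = k ` {..<h}"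
  using inj_on_reps[of k h] image_reps[of k h] assms by auto

locale positive_form =
  fixes b :: "nat \<Rightarrow> nat" and h :: nat
  assumes h2: "h \<ge> 2" and bpos: "\<forall>i<h. b i > 0"
begin

definition "bsum = (\<Sum>i<h. b i)"

lemma bsum_pos: "bsum > 0"
  unfolding bsum_def using h2 bpos by (intro sum_pos2[of _ 0]) auto

lemma sols_bigE:
  assumes "k \<in> sols b h n" "n > 0"
  obtains i where "i < h" "k i > 0" "n \<le> bsum * k i"
proof -
  define m where "m = Max (k ` {..<h})"
  have ne: "k ` {..<h} \<noteq> {}" using h2 by (auto simp: lessThan_empty_iff)
  have "m \<in> k ` {..<h}" unfolding m_def using ne by (intro Max_in) auto
  then obtain i where i: "i < h" "m = k i" by auto
  have "n = (\<Sum>j<h. b j * k j)" using assms by (simp add: sols_def)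
  also have "\<dots> \<le> (\<Sum>j<h. b j * m)"
    unfolding m_def by (intro sum_mono mult_left_mono Max_ge) auto
  also have "\<dots> = bsum * k i" by (simp add: i sum_distrib_right bsum_def)
  finally have "n \<le> bsum * k i" .
  moreover from this assms(2) have "k i > 0" by (cases "k i = 0") auto
  ultimately show thesis using that i by blast
qed

lemma same_pattern_mono:
  assumes pat: "pattern h k = pattern h k'" and g: "g \<in> reps h (pattern h k)"
    and eq: "\<And>i. i \<in> reps h (pattern h k) - {g} \<Longrightarrow> k i = k' i" and le: "k g \<le> k' g"
  shows "i < h \<Longrightarrow> k i \<le> k' i"
proof -
  assume i: "i < h"
  show "k i \<le> k' i"
  proof (cases "k i = 0")
    case False
    then have F': "k' i \<noteq> 0" using pattern_eq_h_iff[OF i] pat by metis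
    have 1: "k i = k (pattern h k i)" "pattern h k i \<in> reps h (pattern h k)" using pattern_nz[of i h k] i False by auto
    have 2: "k' i = k' (pattern h k i)" using pattern_nz[of i h k'] i F' pat by auto
    show ?thesis using 1 2 eq[of "pattern h k i"] le by (cases "pattern h k i = g") auto
  qed auto
qed

text \<open>For a fixed pattern, raising the value at \<open>g\<close> raises all entries equal to
  it and lowers none; since the coefficients are positive, the value \<open>n\<close> is attained
  only once. So one representative is determined by the others, even with repeated entries.\<close>

lemma same_pattern_eq:
  assumes k: "k \<in> sols b h n" "k' \<in> sols b h n" and pat: "pattern h k = pattern h k'"
    and g: "g \<in> reps h (pattern h k)"
    and eq: "\<And>i. i \<in> reps h (pattern h k) - {g} \<Longrightarrow> k i = k' i"
  shows "k = k'"
proof -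
  have *: "k i = k' i" if A: "k \<in> sols b h n" "k' \<in> sols b h n" "pattern h k = pattern h k'"
    "g \<in> reps h (pattern h k)" "\<And>i. i \<in> reps h (pattern h k) - {g} \<Longrightarrow> k i = k' i" "k g \<le> k' g" "i < h" for k k' i
  proof (rule ccontr)
    assume ne: "k i \<noteq> k' i"
    have le: "k j \<le> k' j" if "j < h" for j
      by (rule same_pattern_mono[of k k' g, OF A(3,4,5,6) that])
    have "(\<Sum>j<h. b j * k j) < (\<Sum>j<h. b j * k' j)"
      by (rule sum_strict_mono_ex1) (use le ne A(7) bpos in \<open>auto intro!: bexI[of _ i] simp: le_neq_implies_less\<close>)
    then show False using A by (simp add: sols_def)
  qed
  have "k i = k' i" if "i < h" for i
  proof (cases "k g \<le> k' g")
    case True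
    then show ?thesis using *[OF k pat g eq True that] by simp
  next
    case False
    have "k' i = k i"
      by (rule *[OF k(2,1) pat[symmetric] _ _ _ that]) (use g eq pat False in auto)
    then show ?thesis by simp
  qed
  then show ?thesis using k by (intro PiE_ext[of k "{..<h}" "\<lambda>_. UNIV" k']) (auto simp: sols_def)
qed

text \<open>The largest entry is at least \<open>n / bsum\<close> and is determined by the other distinct entries, so
  a coincidence, a zero or an entry below \<open>t\<close> costs a factor \<open>(t / n) powr (1 / h)\<close>.\<close>
lemma bad_sols_sum_le:
  fixes w :: "nat \<Rightarrow> real"
  assumes w: "\<And>v. 0 \<le> w v" "\<And>v. 1 \<le> v \<Longrightarrow> v \<le> n \<Longrightarrow> w v \<le> L * real v powr (1 / real h - 1)"
    and L: "L \<ge> 1" and t: "1 \<le> t" "t * real bsum \<le> real n"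
  shows "(\<Sum>k\<in>sols b h n - good_sols b h t n. \<Prod>u\<in>nz_supp h k. w u)
     \<le> (real (h + 1) ^ h * real h * real h * real h ^ h * real bsum) * L ^ h * (t / real n) powr (1 / real h)"
proof -
  define s where "s = 1 / real h"
  have s: "0 < s" "s < 1" using h2 by (auto simp: s_def)
  have Bp: "real bsum \<ge> 1" using bsum_pos by linarith
  have tn: "t \<le> real n"
  proof -
    have "t * 1 \<le> t * real bsum" using t Bp by (intro mult_left_mono) auto
    then show ?thesis using t(2) by linarith
  qed
  have n: "n > 0" using t tn by (cases n) auto
  \<comment> \<open>\<open>q\<close> bounds the weight of the large entry, \<open>P\<close> the
    weight sum of an unrestricted coordinate and \<open>Pt\<close> that of a coordinate below
    \<open>t\<close>.\<close>
  define q where "q = L * (real n / real bsum) powr (s - 1)"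
  define P where "P = L * (real h * real n powr s)"
  define Pt where "Pt = L * (real h * t powr s)"
  have Pt1: "Pt \<ge> 1"
  proof -
    have "1 * (1 * 1) \<le> L * (real h * t powr s)"
      using L h2 t s by (intro mult_mono ge_one_powr_ge_zero) auto
    then show ?thesis by (simp add: Pt_def)
  qed
  have P1: "P \<ge> 1"
  proof -
    have "Pt \<le> P" unfolding P_def Pt_def using L tn t s by (intro mult_left_mono powr_mono2) auto
    with Pt1 show ?thesis by simp
  qed
  have q0: "q \<ge> 0" using L by (simp add: q_def)
  \<comment> \<open>Bad tuples are classified by their pattern, by the representative
    \<open>g\<close> of an entry of size at least \<open>n / bsum\<close>, and by a coordinate
    \<open>i\<close> that witnesses an entry below \<open>t\<close> if the pattern is full.\<close>
  define X where "X = (\<lambda>(\<pi>, g, i). {k \<in> sols b h n. pattern h k = \<pi> \<and> g \<in> reps h \<pi> \<and> n \<le> bsum * k g \<and>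
     (reps h \<pi> \<noteq> {..<h} \<or> real (k i) < t)})"
  define Q where "Q = ({..<h} \<rightarrow>\<^sub>E {..h}) \<times> {..<h} \<times> {..<h}"
  have Qfin: "finite Q" by (auto simp: Q_def intro!: finite_PiE)
  have Xfin: "finite (X x)" for x
    unfolding X_def using finite_sols[OF bpos] by (auto split: prod.splits)
  have w_prod: "0 \<le> (\<Prod>u\<in>U. w u)" for U using w by (intro prod_nonneg) auto
  have Xbound: "(\<Sum>k\<in>X x. \<Prod>u\<in>nz_supp h k. w u) \<le> q * (Pt * P ^ (h - 2))" if xQ: "x \<in> Q" for x
  proof (cases "X x = {}")
    case True
    then show ?thesis using q0 Pt1 P1 by simp
  next
    case False
    obtain \<pi> g i where x: "x = (\<pi>, g, i)" and gi: "g < h" "i < h" using xQ by (auto simp: Q_def)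
    from False obtain k0 where k0: "k0 \<in> X x" by auto
    have g: "g \<in> reps h \<pi>" and pat0: "pattern h k0 = \<pi>" using k0 by (auto simp: X_def x)
    define F where "F = reps h \<pi>"
    have F: "finite F" "F \<subseteq> {..<h}" "g \<in> F" using reps_patternD(1)[of _ h k0] g pat0 by (auto simp: F_def reps_def)
    define V where "V j = {v. 1 \<le> v \<and> v \<le> n \<and> (F = {..<h} \<and> j = i \<longrightarrow> real v < t)}" for j
    have XD: "k \<in> sols b h n" "pattern h k = \<pi>" "n \<le> bsum * k g" "F \<noteq> {..<h} \<or> real (k i) < t"
      if "k \<in> X x" for k using that by (auto simp: X_def x F_def)
    have big: "real n / real bsum \<le> real (k g)" if "k \<in> X x" for k
    proof -
      have "real n \<le> real (bsum * k g)" using XD(3)[OF that] by (rule of_nat_mono)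
      then show ?thesis using Bp by (simp add: divide_le_eq mult.commute)
    qed
    have wg: "w (k g) \<le> q" if k: "k \<in> X x" for k
    proof -
      have "k g \<noteq> 0" using XD(3)[OF k] n by (cases "k g = 0") auto
      moreover have "k g \<le> n" using sols_le(2)[OF bpos XD(1)[OF k] gi(1)] .
      ultimately have "w (k g) \<le> L * real (k g) powr (s - 1)" using w(2)[of "k g"] by (simp add: s_def)
      also have "\<dots> \<le> q" unfolding q_def
        using L s n Bp big[OF k] by (intro mult_left_mono powr_mono2') auto
      finally show ?thesis .
    qed
    have "(\<Sum>k\<in>X x. \<Prod>u\<in>nz_supp h k. w u) = (\<Sum>k\<in>X x. w (k g) * (\<Prod>j\<in>F - {g}. w (k j)))"
    proof (rule sum.cong[OF refl])
      fix k assume "k \<in> X x"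
      then have "(\<Prod>u\<in>nz_supp h k. w u) = (\<Prod>j\<in>F. w (k j))"
        unfolding prod_nz_supp using XD(2) by (simp add: F_def)
      then show "(\<Prod>u\<in>nz_supp h k. w u) = w (k g) * (\<Prod>j\<in>F - {g}. w (k j))"
        using F by (simp add: prod.remove)
    qed
    also have "\<dots> \<le> (\<Sum>k\<in>X x. q * (\<Prod>j\<in>F - {g}. w (k j)))"
      using wg w by (intro sum_mono mult_right_mono prod_nonneg) auto
    also have "\<dots> = q * (\<Sum>k\<in>X x. \<Prod>j\<in>F - {g}. w (k j))" by (simp add: sum_distrib_left)
    also have "\<dots> \<le> q * (\<Prod>j\<in>F - {g}. \<Sum>v\<in>V j. w v)"
    proof (intro mult_left_mono q0 sum_prod_inj_le w)
      show "inj_on (\<lambda>k. restrict k (F - {g})) (X x)"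
      proof (rule inj_onI)
        fix k k' assume k: "k \<in> X x" "k' \<in> X x" "restrict k (F - {g}) = restrict k' (F - {g})"
        show "k = k'"
        proof (rule same_pattern_eq)
          fix j assume "j \<in> reps h (pattern h k) - {g}"
          then have "j \<in> F - {g}" using XD(2)[OF k(1)] by (simp add: F_def)
          then show "k j = k' j" using k(3) by (metis restrict_apply')
        qed (use XD k g in auto)
      qed
      fix k j assume k: "k \<in> X x" and j: "j \<in> F - {g}"
      have "j \<in> reps h (pattern h k)" using j XD(2)[OF k] by (simp add: F_def)
      then have "j < h" "k j \<noteq> 0" using reps_patternD by auto
      then show "k j \<in> V j" unfolding V_def using XD(4)[OF k] sols_le(2)[OF bpos XD(1)[OF k], of j]
        by auto
    qed (use F in \<open>auto simp: V_def\<close>)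
    also have "(\<Prod>j\<in>F - {g}. \<Sum>v\<in>V j. w v) \<le> Pt * P ^ (h - 2)"
    proof (cases "F = {..<h}")
      \<comment> \<open>A coincidence or a zero leaves at most \<open>h - 2\<close> representatives
        besides \<open>g\<close>; inserting \<open>Pt \<ge> 1\<close> gives the same bound as for
        full patterns.\<close>
      case False
      then have "card F < h" using F psubset_card_mono[of "{..<h}" F] by auto
      then have cF: "card (F - {g}) \<le> h - 2" using F by simp
      have "(\<Prod>j\<in>F - {g}. \<Sum>v\<in>V j. w v) \<le> (\<Prod>j\<in>F - {g}. P)"
        unfolding P_def s_def
        by (intro prod_mono conjI sum_nonneg w sum_weight_le[where n=n]) (use h2 L w False in \<open>auto simp: V_def\<close>)
      also have "\<dots> = P ^ card (F - {g})" by simp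
      also have "\<dots> \<le> P ^ (h - 2)" using cF P1 by (rule power_increasing)
      also have "\<dots> \<le> Pt * P ^ (h - 2)" using Pt1 P1 by simp
      finally show ?thesis .
    next
      case True
      \<comment> \<open>The large entry is at least \<open>n / bsum \<ge> t\<close>, so the small
        entry sits elsewhere and contributes \<open>Pt\<close> instead of \<open>P\<close>.\<close>
      have ig: "i \<noteq> g"
      proof
        assume "i = g"
        then have "real n / real bsum < t" using XD(4)[OF k0] big[OF k0] True by simp
        then show False using t Bp by (simp add: divide_less_eq)
      qed
      then have iF: "i \<in> F - {g}" using True gi by simp
      have "(\<Prod>j\<in>F - {g}. \<Sum>v\<in>V j. w v) = (\<Sum>v\<in>V i. w v) * (\<Prod>j\<in>F - {g} - {i}. \<Sum>v\<in>V j. w v)"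
        using iF F by (subst prod.remove[of _ i]) auto
      also have "\<dots> \<le> Pt * (\<Prod>j\<in>F - {g} - {i}. P)"
      proof (intro mult_mono prod_mono conjI sum_nonneg w prod_nonneg)
        show "(\<Sum>v\<in>V i. w v) \<le> Pt" unfolding Pt_def s_def
          by (rule sum_weight_le[where n=n]) (use h2 L w True tn t in \<open>auto simp: V_def\<close>)
        show "(\<Sum>v\<in>V j. w v) \<le> P" for j unfolding P_def s_def
          by (rule sum_weight_le[where n=n]) (use h2 L w in \<open>auto simp: V_def\<close>)
      qed (use Pt1 in auto)
      also have "(\<Prod>j\<in>F - {g} - {i}. P) = P ^ (h - 2)"
        using True gi ig by (simp add: card_Diff_singleton numeral_2_eq_2)
      finally show ?thesis .
    qed
    finally show ?thesis using q0 by (simp add: mult_left_mono)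
  qed
  have "(\<Sum>k\<in>sols b h n - good_sols b h t n. \<Prod>u\<in>nz_supp h k. w u)
      \<le> (\<Sum>(x, k)\<in>Sigma Q X. \<Prod>u\<in>nz_supp h k. w u)"
  proof (rule sum_le_included[where i = snd])
    show "\<forall>k\<in>sols b h n - good_sols b h t n. \<exists>y\<in>Sigma Q X. snd y = k \<and>
        (\<Prod>u\<in>nz_supp h k. w u) \<le> (case y of (x, k) \<Rightarrow> \<Prod>u\<in>nz_supp h k. w u)"
    proof
      fix k assume "k \<in> sols b h n - good_sols b h t n"
      then have k: "k \<in> sols b h n" and bad: "\<not> (inj_on k {..<h} \<and> (\<forall>i<h. t \<le> real (k i)))"
        by (auto simp: good_sols_def)
      from sols_bigE[OF k n] obtain j where j: "j < h" "k j > 0" "n \<le> bsum * k j" .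
      define g where "g = pattern h k j"
      have g: "g \<in> reps h (pattern h k)" "g < h" "n \<le> bsum * k g"
        using pattern_nz[of j h k] j by (auto simp: g_def)
      have "\<exists>i<h. reps h (pattern h k) \<noteq> {..<h} \<or> real (k i) < t"
      proof (cases "reps h (pattern h k) = {..<h}")
        case True
        then show ?thesis using bad reps_fullD(1)[of h k] by (auto simp: not_le)
      next
        case False
        then show ?thesis using h2 by (intro exI[of _ 0]) auto
      qed
      then obtain i where "i < h" "reps h (pattern h k) \<noteq> {..<h} \<or> real (k i) < t" by auto
      then have "((pattern h k, g, i), k) \<in> Sigma Q X"
        using g k pattern_funcset[of h k] by (auto simp: Q_def X_def)
      then show "\<exists>y\<in>Sigma Q X. snd y = k \<and>
        (\<Prod>u\<in>nz_supp h k. w u) \<le> (case y of (x, k) \<Rightarrow> \<Prod>u\<in>nz_supp h k. w u)"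
        by (intro bexI[of _ "((pattern h k, g, i), k)"]) auto
    qed
  qed (use Qfin Xfin w_prod finite_sols[OF bpos] in auto)
  also have "\<dots> = (\<Sum>x\<in>Q. \<Sum>k\<in>X x. \<Prod>u\<in>nz_supp h k. w u)"
    using Qfin Xfin by (subst sum.Sigma) auto
  also have "\<dots> \<le> (\<Sum>x\<in>Q. q * (Pt * P ^ (h - 2)))" by (rule sum_mono) (rule Xbound)
  also have "\<dots> = (real (h + 1) ^ h * real h * real h) * (q * (Pt * P ^ (h - 2)))"
    by (simp add: Q_def card_PiE card_cartesian_product)
  also have "\<dots> \<le> (real (h + 1) ^ h * real h * real h) * (real h ^ h * real bsum * L ^ h * (t / real n) powr s)"
  proof (rule mult_left_mono)
    have hh: "h = Suc (Suc (h - 2))" using h2 by simp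
    have "q * (Pt * P ^ (h - 2)) = (L * (L * L ^ (h - 2))) * (real h * real h ^ (h - 2)) *
       ((real n / real bsum) powr (s - 1) * t powr s * (real n powr s) ^ (h - 2))"
      unfolding q_def Pt_def P_def power_mult_distrib by (simp only: mult_ac)
    also have "L * (L * L ^ (h - 2)) = L ^ h" by (subst (2) hh) simp
    also have "real h * real h ^ (h - 2) = real h ^ (h - 1)"
    proof -
      have "h - 1 = Suc (h - 2)" using h2 by simp
      then show ?thesis by simp
    qed
    \<comment> \<open>The powers of \<open>n\<close> are s - 1 from the large entry and s (h - 2)
      from the others; they add up to -s because s h = 1.\<close>
    also have "(real n / real bsum) powr (s - 1) * t powr s * (real n powr s) ^ (h - 2) = real bsum powr (1 - s) * (t / real n) powr s"
    proof -
      have "(real n powr s) ^ (h - 2) = real n powr (s * real (h - 2))"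
        using n by (simp add: powr_powr flip: powr_realpow)
      moreover have "s * real (h - 2) = 1 - 2 * s" using h2 by (simp add: s_def field_simps of_nat_diff)
      moreover have "(real n / real bsum) powr (s - 1) = real n powr (s - 1) * real bsum powr (1 - s)"
        using bsum_pos by (simp add: powr_divide powr_diff field_simps)
      moreover have "(t / real n) powr s = t powr s * real n powr (- s)"
        by (simp add: powr_divide powr_minus_divide)
      moreover have "real n powr (s - 1) * real n powr (1 - 2 * s) = real n powr (- s)"
        by (simp flip: powr_add)
      moreover have "(N * B) * T * M = B * (T * R)" if "N * M = R" for N B T M R :: real
        unfolding that[symmetric] by (simp only: mult_ac)
      ultimately show ?thesis by presburger
    qed
    also have "L ^ h * real h ^ (h - 1) * (real bsum powr (1 - s) * (t / real n) powr s)
       \<le> L ^ h * real h ^ h * (real bsum * (t / real n) powr s)"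
    proof (intro mult_mono mult_nonneg_nonneg)
      show "real h ^ (h - 1) \<le> real h ^ h" using h2 by (intro power_increasing) auto
      have "real bsum powr (1 - s) \<le> real bsum powr 1" using Bp s by (intro powr_mono) auto
      then show "real bsum powr (1 - s) \<le> real bsum" by simp
    qed (use L in auto)
    finally show "q * (Pt * P ^ (h - 2)) \<le> real h ^ h * real bsum * L ^ h * (t / real n) powr s"
      by (simp add: mult_ac)
  qed auto
  finally show ?thesis by (simp add: s_def mult_ac)
qed

end

section \<open>Counting pairs of solutions that share entries\<close>

lemma sum_union_le:
  fixes f :: "'a \<Rightarrow> real"
  assumes "finite A" "finite B" "\<And>x. f x \<ge> 0"
  shows "sum f (A \<union> B) \<le> sum f A + sum f B"
  using sum.union_inter[OF assms(1,2), of f] sum_nonneg[of "A \<inter> B" f] assms(3) by simp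

lemma card_inj_restrict_le:
  fixes X :: "('i \<Rightarrow> 'v) set"
  assumes G: "finite G" and inj: "inj_on (\<lambda>k. restrict k G) X"
    and V: "\<And>i. i \<in> G \<Longrightarrow> finite (V i)" "\<And>k i. k \<in> X \<Longrightarrow> i \<in> G \<Longrightarrow> k i \<in> V i"
  shows "card X \<le> (\<Prod>i\<in>G. card (V i))"
proof -
  have "card X = card ((\<lambda>k. restrict k G) ` X)" using inj by (rule card_image[symmetric])
  also have "\<dots> \<le> card (PiE G V)"
    using G V by (intro card_mono finite_PiE) auto
  also have "\<dots> = (\<Prod>i\<in>G. card (V i))" using G by (rule card_PiE)
  finally show ?thesis .
qed

text \<open>Both kinds of overlapping pairs will number about Y^(m - 2), where \<open>m\<close> is
  the size of the union of the supports, and weigh q^m each. \<open>Z \<ge> 1\<close> permits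
  replacing the varying \<open>m\<close> by its maximum.\<close>

lemma power_scaling_le:
  fixes Y q Z :: real
  assumes "Y > 0" "q \<ge> 0" "Z \<ge> 1" "Y * q \<le> Z" "m \<ge> 2" "m \<le> M"
  shows "Y ^ (m - 2) * q ^ m \<le> Z ^ M / Y\<^sup>2"
proof -
  have "Y ^ m = Y ^ (m - 2) * Y\<^sup>2" using assms(5) by (metis le_add_diff_inverse2 power_add)
  then have "Y ^ (m - 2) * q ^ m = (Y * q) ^ m / Y\<^sup>2" using assms(1) by (simp add: power_mult_distrib)
  also have "(Y * q) ^ m \<le> Z ^ m" using assms by (intro power_mono) auto
  also have "Z ^ m \<le> Z ^ M" using assms by (intro power_increasing) auto
  finally show ?thesis using assms(1) by (simp add: divide_right_mono)
qed

context positive_form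
begin

lemma sols_eqI:
  assumes k: "k \<in> sols b h n" "k' \<in> sols b h n" and j: "j < h"
    and eq: "\<And>i. i < h \<Longrightarrow> i \<noteq> j \<Longrightarrow> k i = k' i"
  shows "k = k'"
proof -
  have "(\<Sum>i<h. b i * k i) = b j * k j + (\<Sum>i\<in>{..<h} - {j}. b i * k i)"
    "(\<Sum>i<h. b i * k' i) = b j * k' j + (\<Sum>i\<in>{..<h} - {j}. b i * k' i)"
    using j by (auto intro: sum.remove)
  moreover have "(\<Sum>i\<in>{..<h} - {j}. b i * k i) = (\<Sum>i\<in>{..<h} - {j}. b i * k' i)"
    using eq by (intro sum.cong) auto
  moreover have "(\<Sum>i<h. b i * k i) = (\<Sum>i<h. b i * k' i)" using k by (simp add: sols_def)
  ultimately have "b j * k j = b j * k' j" by linarith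
  then have "k j = k' j" using bpos j by auto
  with eq have "k i = k' i" if "i < h" for i using that by (cases "i = j") auto
  then show ?thesis using k by (intro PiE_ext[of k "{..<h}" "\<lambda>_. UNIV" k']) (auto simp: sols_def)
qed

lemma inj_on_sols_restrict:
  assumes "j < h" "X \<subseteq> sols b h n"
  shows "inj_on (\<lambda>k. restrict k ({..<h} - {j})) X"
proof (rule inj_onI)
  fix k k' assume k: "k \<in> X" "k' \<in> X" and eq: "restrict k ({..<h} - {j}) = restrict k' ({..<h} - {j})"
  show "k = k'"
  proof (rule sols_eqI[of k n k' j])
    fix i assume "i < h" "i \<noteq> j"
    then show "k i = k' i" using fun_cong[OF eq, of i] by simp
  qed (use assms k in auto)
qed

lemma card_sols_le: "card (sols b h n) \<le> (n + 1) ^ (h - 1)"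
proof -
  have "card (sols b h n) \<le> (\<Prod>i\<in>{..<h} - {0}. card {..n})"
  proof (rule card_inj_restrict_le)
    show "inj_on (\<lambda>k. restrict k ({..<h} - {0})) (sols b h n)"
      using h2 by (intro inj_on_sols_restrict) auto
  qed (use sols_le(2)[OF bpos] in auto)
  then show ?thesis using h2 by (simp add: card_Diff_singleton)
qed

text \<open>Fix which \<open>s\<close> positions take values in \<open>S\<close>, and these values;
  of the other \<open>h - s\<close> coordinates one is determined by the equation. The assumption
  \<open>s < h\<close> guarantees that such a coordinate exists.\<close>

lemma card_overlapping_sols_le:
  assumes S: "finite S" "card S \<le> h" and s: "s < h"
  shows "card {k \<in> sols b h n. inj_on k {..<h} \<and> card (k ` {..<h} \<inter> S) = s} \<le> 2 ^ h * (h ^ h * (n + 1) ^ (h - 1 - s))"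
proof -
  define X where "X J = {k \<in> sols b h n. {j. j < h \<and> k j \<in> S} = J}" for J
  define \<J> where "\<J> = {J. J \<subseteq> {..<h} \<and> card J = s}"
  have fJ: "finite \<J>" unfolding \<J>_def by (rule finite_subset[of _ "Pow {..<h}"]) auto
  have fX: "finite (X J)" for J unfolding X_def using finite_sols[OF bpos] by auto
  have cX: "card (X J) \<le> h ^ h * (n + 1) ^ (h - 1 - s)" if J: "J \<in> \<J>" for J
  proof -
    have Js: "J \<subseteq> {..<h}" "card J = s" "finite J" using J finite_subset[of J "{..<h}"] by (auto simp: \<J>_def)
    then have "J \<noteq> {..<h}" using s by auto
    then obtain j0 where j0: "j0 < h" "j0 \<notin> J" using Js by auto
    define V where "V j = (if j \<in> J then S else {..n})" for j
    have "card (X J) \<le> (\<Prod>i\<in>{..<h} - {j0}. card (V i))"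
    proof (rule card_inj_restrict_le)
      show "inj_on (\<lambda>k. restrict k ({..<h} - {j0})) (X J)"
        using j0 by (intro inj_on_sols_restrict) (auto simp: X_def)
      show "finite (V i)" for i using S by (simp add: V_def)
      show "k i \<in> V i" if "k \<in> X J" "i \<in> {..<h} - {j0}" for k i
        using that sols_le(2)[OF bpos, of k n i] by (auto simp: V_def X_def)
    qed auto
    also have "{..<h} - {j0} = J \<union> ({..<h} - {j0} - J)" using Js j0 by auto
    also have "(\<Prod>i\<in>J \<union> ({..<h} - {j0} - J). card (V i)) = (\<Prod>i\<in>J. card (V i)) * (\<Prod>i\<in>{..<h} - {j0} - J. card (V i))"
      using Js by (intro prod.union_disjoint) auto
    also have "(\<Prod>i\<in>J. card (V i)) = card S ^ s" using Js by (simp add: V_def)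
    also have "(\<Prod>i\<in>{..<h} - {j0} - J. card (V i)) = (n + 1) ^ card ({..<h} - {j0} - J)"
      by (simp add: V_def)
    also have "card ({..<h} - {j0} - J) = h - 1 - s"
      using Js j0 by (subst card_Diff_subset) auto
    also have "card S ^ s \<le> h ^ s" using S by (intro power_mono) auto
    also have "h ^ s \<le> h ^ h" using h2 s by (intro power_increasing) auto
    finally show ?thesis by simp
  qed
  have "{k \<in> sols b h n. inj_on k {..<h} \<and> card (k ` {..<h} \<inter> S) = s} \<subseteq> (\<Union>J\<in>\<J>. X J)"
  proof
    fix k assume k: "k \<in> {k \<in> sols b h n. inj_on k {..<h} \<and> card (k ` {..<h} \<inter> S) = s}"
    define J where "J = {j. j < h \<and> k j \<in> S}"
    have "k ` J = k ` {..<h} \<inter> S" by (auto simp: J_def)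
    moreover have "inj_on k J" using k by (auto simp: J_def intro: inj_on_subset)
    ultimately have "card J = s" using k card_image[of k J] by simp
    then have "J \<in> \<J>" by (auto simp: \<J>_def J_def)
    moreover have "k \<in> X J" using k by (simp add: X_def J_def)
    ultimately show "k \<in> (\<Union>J\<in>\<J>. X J)" by blast
  qed
  then have "card {k \<in> sols b h n. inj_on k {..<h} \<and> card (k ` {..<h} \<inter> S) = s} \<le> card (\<Union>J\<in>\<J>. X J)"
    using fJ fX by (intro card_mono) auto
  also have "\<dots> \<le> (\<Sum>J\<in>\<J>. card (X J))" using fJ by (rule card_UN_le)
  also have "\<dots> \<le> (\<Sum>J\<in>\<J>. h ^ h * (n + 1) ^ (h - 1 - s))" by (rule sum_mono) (rule cX)
  also have "\<dots> = card \<J> * (h ^ h * (n + 1) ^ (h - 1 - s))" by simp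
  also have "card \<J> \<le> card (Pow {..<h})" by (intro card_mono) (auto simp: \<J>_def)
  also have "card (Pow {..<h}) = 2 ^ h" by (simp add: card_Pow)
  finally show ?thesis by simp
qed

text \<open>The two equations are linearly independent: a permutation of the coefficients that is
  proportional to them is equal to them, which would force \<open>x = y\<close>.\<close>
lemma card_permuted_sols_le:
  assumes \<sigma>: "bij_betw \<sigma> {..<h} {..<h}" and xy: "x \<noteq> y"
  shows "card {k \<in> sols b h x. (\<Sum>j<h. b j * k (\<sigma> j)) = y} \<le> (x + 1) ^ (h - 2)"
proof (cases "{k \<in> sols b h x. (\<Sum>j<h. b j * k (\<sigma> j)) = y} = {}")
  case False
  define X where "X = {k \<in> sols b h x. (\<Sum>j<h. b j * k (\<sigma> j)) = y}"
  from False obtain k0 where k0: "k0 \<in> X" by (auto simp: X_def)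
  \<comment> \<open>Rewrites the second equation in the variables of the first: \<open>L\<close> is
    the permuted coefficient vector.\<close>
  define L where "L i = b (inv_into {..<h} \<sigma> i)" for i
  have L: "L (\<sigma> j) = b j" if "j < h" for j
    unfolding L_def using \<sigma> that by (simp add: bij_betw_def)
  have L_sum: "(\<Sum>j<h. b j * k (\<sigma> j)) = (\<Sum>i<h. L i * k i)" for k
  proof -
    have "(\<Sum>j<h. b j * k (\<sigma> j)) = (\<Sum>j<h. L (\<sigma> j) * k (\<sigma> j))" using L by (intro sum.cong) auto
    also have "\<dots> = (\<Sum>i<h. L i * k i)" by (rule sum.reindex_bij_betw[OF \<sigma>])
    finally show ?thesis .
  qed
  have Lb: "(\<Sum>i<h. L i) = bsum" using L_sum[of "\<lambda>_. 1"] by (simp add: bsum_def)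
  have "\<exists>j<h. b 0 * L j \<noteq> b j * L 0"
  proof (rule ccontr)
    assume "\<not> ?thesis"
    then have propto: "b 0 * L j = b j * L 0" if "j < h" for j using that by auto
    then have "(\<Sum>j<h. b 0 * L j) = (\<Sum>j<h. b j * L 0)" by (intro sum.cong) auto
    then have "b 0 * bsum = bsum * L 0" unfolding bsum_def Lb[unfolded bsum_def, symmetric]
      using Lb by (simp add: bsum_def flip: sum_distrib_left sum_distrib_right)
    then have "b 0 = L 0" using bsum_pos by (simp add: mult.commute)
    moreover have "b 0 > 0" using bpos h2 by auto
    ultimately have "L j = b j" if "j < h" for j using propto[OF that] by (simp add: mult.commute)
    then have "(\<Sum>i<h. L i * k0 i) = (\<Sum>i<h. b i * k0 i)" by (intro sum.cong) auto
    then show False using k0 xy L_sum[of k0] by (simp add: X_def sols_def)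
  qed
  then obtain j where j: "j < h" "b 0 * L j \<noteq> b j * L 0" by blast
  then have j0: "j \<noteq> 0" by (cases "j = 0") auto
  have split: "(\<Sum>i<h. f i) = f 0 + f j + (\<Sum>i\<in>{..<h} - {0, j}. f i)" for f :: "nat \<Rightarrow> int"
  proof -
    have "(\<Sum>i<h. f i) = f 0 + (\<Sum>i\<in>{..<h} - {0}. f i)" using j by (intro sum.remove) auto
    also have "(\<Sum>i\<in>{..<h} - {0}. f i) = f j + (\<Sum>i\<in>{..<h} - {0} - {j}. f i)"
      using j j0 by (intro sum.remove) auto
    also have "{..<h} - {0} - {j} = {..<h} - {0, j}" by auto
    finally show ?thesis by simp
  qed
  have "card X \<le> (\<Prod>i\<in>{..<h} - {0, j}. card {..x})"
  proof (rule card_inj_restrict_le)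
    show "inj_on (\<lambda>k. restrict k ({..<h} - {0, j})) X"
    proof (rule inj_onI)
      fix k k' assume k: "k \<in> X" "k' \<in> X" and e: "restrict k ({..<h} - {0, j}) = restrict k' ({..<h} - {0, j})"
      have eq: "k i = k' i" if "i < h" "i \<noteq> 0" "i \<noteq> j" for i
        using fun_cong[OF e, of i] that by simp
      define a where "a = int (k 0) - int (k' 0)"
      define c where "c = int (k j) - int (k' j)"
      have lin: "int (f 0) * a + int (f j) * c = 0" if "(\<Sum>i<h. f i * k i) = (\<Sum>i<h. f i * k' i)" for f :: "nat \<Rightarrow> nat"
      proof -
        have "0 = (\<Sum>i<h. int (f i) * (int (k i) - int (k' i)))"
          using arg_cong[OF that, of int] by (simp add: right_diff_distrib sum_subtractf)
        also have "\<dots> = int (f 0) * a + int (f j) * c + (\<Sum>i\<in>{..<h} - {0, j}. int (f i) * (int (k i) - int (k' i)))"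
          unfolding a_def c_def by (rule split)
        also have "(\<Sum>i\<in>{..<h} - {0, j}. int (f i) * (int (k i) - int (k' i))) = 0"
          using eq by (intro sum.neutral) auto
        finally show ?thesis by simp
      qed
      have 1: "int (b 0) * a + int (b j) * c = 0" by (rule lin) (use k in \<open>auto simp: X_def sols_def\<close>)
      have 2: "int (L 0) * a + int (L j) * c = 0" by (rule lin) (use k L_sum in \<open>auto simp: X_def\<close>)
      \<comment> \<open>Eliminating \<open>a\<close> leaves \<open>c\<close> times a 2 by 2 minor of
        the two coefficient vectors, nonzero by the choice of \<open>j\<close>.\<close>
      have "(int (b 0) * int (L j) - int (b j) * int (L 0)) * c = 0"
        using 1 2 by algebra
      moreover have "int (b 0) * int (L j) - int (b j) * int (L 0) \<noteq> 0"
        using j(2) by (metis eq_iff_diff_eq_0 of_nat_eq_iff of_nat_mult)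
      ultimately have c: "c = 0" by simp
      show "k = k'"
      proof (rule sols_eqI[of k x k' 0])
        fix i assume "i < h" "i \<noteq> 0"
        then show "k i = k' i" using eq[of i] c by (cases "i = j") (auto simp: c_def)
      qed (use k h2 in \<open>auto simp: X_def\<close>)
    qed
  qed (use sols_le(2)[OF bpos] in \<open>auto simp: X_def\<close>)
  also have "\<dots> = (x + 1) ^ (h - 2)"
  proof -
    have "card ({..<h} - {0, j}) = h - 2" using j j0 h2 by (subst card_Diff_subset) auto
    then show ?thesis by simp
  qed
  finally show ?thesis by (simp add: X_def)
qed (simp only: card.empty)

text \<open>Up to constants, an overlap in s < h entries allows Y^(h - 1) choices of
  \<open>k\<close>, then Y^(h - 1 - s) of \<open>k'\<close>, with a union of 2h - s entries. For
  equal supports and \<open>x \<noteq> y\<close>, \<open>k'\<close> permutes \<open>k\<close>, which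
  then satisfies two independent equations; this leaves Y^(h - 2) choices and a union of h entries.
  Both fit \<open>power_scaling_le\<close>, the largest union having 2h - 1 entries.\<close>

lemma overlap_sum_le:
  fixes q Z t :: real
  assumes xy: "x < Y" "y < Y" and q: "0 \<le> q" and Z: "Z \<ge> 1" "real Y * q \<le> Z"
  defines "R \<equiv> {(k, k') \<in> good_sols b h t x \<times> good_sols b h t y.
     k ` {..<h} \<inter> k' ` {..<h} \<noteq> {} \<and> (x \<noteq> y \<or> k ` {..<h} \<noteq> k' ` {..<h})}"
  shows "(\<Sum>(k, k')\<in>R. q ^ card (k ` {..<h} \<union> k' ` {..<h})) \<le> 2 * real h * 2 ^ h * real h ^ h * (Z ^ (2 * h - 1) / (real Y)\<^sup>2)"
proof -
  define R1 where "R1 s = {(k, k') \<in> good_sols b h t x \<times> good_sols b h t y. card (k' ` {..<h} \<inter> k ` {..<h}) = s}" for s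
  define R2 where "R2 = {(k, k') \<in> good_sols b h t x \<times> good_sols b h t y. x \<noteq> y \<and> k ` {..<h} = k' ` {..<h}}"
  have fin: "finite (good_sols b h t n)" for n using finite_sols[OF bpos] by (simp add: good_sols_def)
  have finR: "finite (R1 s)" "finite R2" for s
    by (rule finite_subset[of _ "good_sols b h t x \<times> good_sols b h t y"]; use fin in \<open>auto simp: R1_def R2_def\<close>)+
  have gc: "card (k ` {..<h}) = h" if "k \<in> good_sols b h t n" for k n
    using that by (auto simp: good_sols_def card_image)
  have Y: "real Y > 0" "Y > 0" using xy by auto
  let ?f = "\<lambda>(k, k'). q ^ card (k ` {..<h} \<union> k' ` {..<h})"
  let ?D = "Z ^ (2 * h - 1) / (real Y)\<^sup>2"
  have f0: "?f z \<ge> 0" for z using q by (auto split: prod.splits)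
  have sub: "R \<subseteq> (\<Union>s\<in>{1..<h}. R1 s) \<union> R2"
  proof safe
    fix k k' assume R: "(k, k') \<in> R" "(k, k') \<notin> R2"
    then have k: "k \<in> good_sols b h t x" "k' \<in> good_sols b h t y" by (auto simp: R_def)
    have ne: "k ` {..<h} \<noteq> k' ` {..<h}" using R k by (auto simp: R_def R2_def)
    have "card (k' ` {..<h} \<inter> k ` {..<h}) < h"
    proof (rule ccontr)
      assume "\<not> ?thesis"
      then have *: "h \<le> card (k' ` {..<h} \<inter> k ` {..<h})" by simp
      have "k' ` {..<h} \<inter> k ` {..<h} = k' ` {..<h}"
        by (rule card_seteq) (use * gc[OF k(2)] in auto)
      moreover have "k' ` {..<h} \<inter> k ` {..<h} = k ` {..<h}"
        by (rule card_seteq) (use * gc[OF k(1)] in auto)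
      ultimately show False using ne by simp
    qed
    moreover have "card (k' ` {..<h} \<inter> k ` {..<h}) > 0"
      using R by (auto simp: R_def card_gt_0_iff)
    ultimately show "(k, k') \<in> (\<Union>s\<in>{1..<h}. R1 s)" using k by (auto simp: R1_def)
  qed
  have B1: "(\<Sum>z\<in>R1 s. ?f z) \<le> 2 ^ h * real h ^ h * ?D" if s: "s \<in> {1..<h}" for s
  proof -
    have "(\<Sum>z\<in>R1 s. ?f z) = (\<Sum>z\<in>R1 s. q ^ (2 * h - s))"
    proof (rule sum.cong[OF refl])
      fix z assume "z \<in> R1 s"
      then obtain k k' where z: "z = (k, k')" "k \<in> good_sols b h t x" "k' \<in> good_sols b h t y"
        "card (k' ` {..<h} \<inter> k ` {..<h}) = s" by (auto simp: R1_def)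
      have "card (k ` {..<h} \<union> k' ` {..<h}) + card (k ` {..<h} \<inter> k' ` {..<h}) = 2 * h"
        using card_Un_Int[of "k ` {..<h}" "k' ` {..<h}"] gc[OF z(2)] gc[OF z(3)] by simp
      then have "card (k ` {..<h} \<union> k' ` {..<h}) = 2 * h - s" using z(4) by (simp add: Int_commute)
      then show "?f z = q ^ (2 * h - s)" using z by simp
    qed
    also have "\<dots> = real (card (R1 s)) * q ^ (2 * h - s)" by simp
    also have "\<dots> \<le> (real Y ^ (h - 1) * (2 ^ h * (real h ^ h * real Y ^ (h - 1 - s)))) * q ^ (2 * h - s)"
    proof (rule mult_right_mono)
      have "R1 s \<subseteq> Sigma (good_sols b h t x) (\<lambda>k. {k' \<in> sols b h y. inj_on k' {..<h} \<and> card (k' ` {..<h} \<inter> k ` {..<h}) = s})"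
        by (auto simp: R1_def good_sols_def)
      then have "card (R1 s) \<le> card (Sigma (good_sols b h t x) (\<lambda>k. {k' \<in> sols b h y. inj_on k' {..<h} \<and> card (k' ` {..<h} \<inter> k ` {..<h}) = s}))"
        using fin finite_sols[OF bpos] by (intro card_mono) auto
      also have "\<dots> = (\<Sum>k\<in>good_sols b h t x. card {k' \<in> sols b h y. inj_on k' {..<h} \<and> card (k' ` {..<h} \<inter> k ` {..<h}) = s})"
        using fin finite_sols[OF bpos] by (intro card_SigmaI) auto
      also have "\<dots> \<le> (\<Sum>k\<in>good_sols b h t x. 2 ^ h * (h ^ h * (y + 1) ^ (h - 1 - s)))"
        using s gc by (intro sum_mono card_overlapping_sols_le) auto
      also have "\<dots> = card (good_sols b h t x) * (2 ^ h * (h ^ h * (y + 1) ^ (h - 1 - s)))" by simp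
      also have "\<dots> \<le> Y ^ (h - 1) * (2 ^ h * (h ^ h * Y ^ (h - 1 - s)))"
      proof (intro mult_mono)
        have "card (good_sols b h t x) \<le> card (sols b h x)"
          using finite_sols[OF bpos] by (intro card_mono) (auto simp: good_sols_def)
        also have "\<dots> \<le> (x + 1) ^ (h - 1)" by (rule card_sols_le)
        also have "\<dots> \<le> Y ^ (h - 1)" using xy by (intro power_mono) auto
        finally show "card (good_sols b h t x) \<le> Y ^ (h - 1)" .
        show "(y + 1) ^ (h - 1 - s) \<le> Y ^ (h - 1 - s)" using xy by (intro power_mono) auto
      qed auto
      finally have "real (card (R1 s)) \<le> real (Y ^ (h - 1) * (2 ^ h * (h ^ h * Y ^ (h - 1 - s))))"
        by (rule of_nat_mono)
      then show "real (card (R1 s)) \<le> real Y ^ (h - 1) * (2 ^ h * (real h ^ h * real Y ^ (h - 1 - s)))"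
        by simp
    qed (use q in auto)
    also have "\<dots> = 2 ^ h * real h ^ h * (real Y ^ (2 * h - s - 2) * q ^ (2 * h - s))"
    proof -
      have "(h - 1) + (h - 1 - s) = 2 * h - s - 2" using s by auto
      then have "real Y ^ (2 * h - s - 2) = real Y ^ (h - 1) * real Y ^ (h - 1 - s)" by (metis power_add)
      then show ?thesis by simp
    qed
    also have "\<dots> \<le> 2 ^ h * real h ^ h * ?D"
      using s Y q Z by (intro mult_left_mono power_scaling_le) auto
    finally show ?thesis .
  qed
  have B2: "(\<Sum>z\<in>R2. ?f z) \<le> real h ^ h * ?D"
  proof (cases "x = y")
    case True
    then have "R2 = {}" by (auto simp: R2_def)
    then show ?thesis using Z by simp
  next
    case False
    define \<Sigma> where "\<Sigma> = {\<sigma> \<in> {..<h} \<rightarrow>\<^sub>E {..<h}. bij_betw \<sigma> {..<h} {..<h}}"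
    define X where "X \<sigma> = {k \<in> sols b h x. (\<Sum>j<h. b j * k (\<sigma> j)) = y}" for \<sigma>
    have f\<Sigma>: "finite \<Sigma>" unfolding \<Sigma>_def by (rule finite_subset[OF _ finite_PiE[of "{..<h}" "\<lambda>_. {..<h}"]]) auto
    have "card \<Sigma> \<le> card ({..<h} \<rightarrow>\<^sub>E {..<h})"
      by (rule card_mono) (auto simp: \<Sigma>_def intro!: finite_PiE)
    then have c\<Sigma>: "card \<Sigma> \<le> h ^ h" by (simp add: card_PiE)
    have fX: "finite (X \<sigma>)" for \<sigma> unfolding X_def using finite_sols[OF bpos] by auto
    have "R2 \<subseteq> (\<lambda>(\<sigma>, k). (k, \<lambda>j\<in>{..<h}. k (\<sigma> j))) ` Sigma \<Sigma> X"
    proof safe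
      fix k k' assume "(k, k') \<in> R2"
      then have k: "k \<in> good_sols b h t x" "k' \<in> good_sols b h t y" "k ` {..<h} = k' ` {..<h}"
        by (auto simp: R2_def)
      have inj: "inj_on k {..<h}" "inj_on k' {..<h}" using k by (auto simp: good_sols_def)
      define \<sigma> where "\<sigma> = (\<lambda>j\<in>{..<h}. inv_into {..<h} k (k' j))"
      have kin: "k' j \<in> k ` {..<h}" if "j < h" for j using k(3) that by auto
      have \<sigma>: "\<sigma> j < h" "k (\<sigma> j) = k' j" if "j < h" for j
        using that inv_into_into[OF kin[OF that]] f_inv_into_f[OF kin[OF that]] by (auto simp: \<sigma>_def)
      have "inj_on \<sigma> {..<h}"
      proof (rule inj_onI)
        fix i j assume "i \<in> {..<h}" "j \<in> {..<h}" "\<sigma> i = \<sigma> j"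
        then show "i = j" using \<sigma>(2) inj(2) by (metis inj_onD lessThan_iff)
      qed
      moreover have "\<sigma> ` {..<h} \<subseteq> {..<h}" using \<sigma> by auto
      ultimately have "bij_betw \<sigma> {..<h} {..<h}"
        by (auto simp: bij_betw_def endo_inj_surj)
      moreover have "\<sigma> \<in> {..<h} \<rightarrow>\<^sub>E {..<h}"
      proof (rule PiE_I)
        fix j assume "j \<notin> {..<h}"
        then show "\<sigma> j = undefined" by (simp add: \<sigma>_def)
      qed (use \<sigma>(1) in auto)
      ultimately have "\<sigma> \<in> \<Sigma>" by (simp add: \<Sigma>_def)
      moreover have "k \<in> X \<sigma>"
        using k(1,2) \<sigma> by (auto simp: X_def good_sols_def sols_def)
      moreover have "k' = (\<lambda>j\<in>{..<h}. k (\<sigma> j))"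
        using k(2) \<sigma> by (auto simp: good_sols_def sols_def PiE_iff extensional_def fun_eq_iff)
      ultimately show "(k, k') \<in> (\<lambda>(\<sigma>, k). (k, \<lambda>j\<in>{..<h}. k (\<sigma> j))) ` Sigma \<Sigma> X"
        by (intro image_eqI[of _ _ "(\<sigma>, k)"]) auto
    qed
    then have "card R2 \<le> card (Sigma \<Sigma> X)" using f\<Sigma> fX by (intro surj_card_le) auto
    also have "\<dots> = (\<Sum>\<sigma>\<in>\<Sigma>. card (X \<sigma>))" using f\<Sigma> fX by (intro card_SigmaI) auto
    also have "\<dots> \<le> (\<Sum>\<sigma>\<in>\<Sigma>. (x + 1) ^ (h - 2))"
      unfolding X_def by (intro sum_mono card_permuted_sols_le) (use False in \<open>auto simp: \<Sigma>_def\<close>)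
    also have "\<dots> = card \<Sigma> * (x + 1) ^ (h - 2)" by simp
    also have "\<dots> \<le> h ^ h * Y ^ (h - 2)" using c\<Sigma> xy by (intro mult_mono power_mono) auto
    finally have "real (card R2) \<le> real (h ^ h * Y ^ (h - 2))" by (rule of_nat_mono)
    then have cR: "real (card R2) \<le> real h ^ h * real Y ^ (h - 2)" by simp
    have "(\<Sum>z\<in>R2. ?f z) = (\<Sum>z\<in>R2. q ^ h)"
      by (rule sum.cong[OF refl]) (auto simp: R2_def gc split: prod.splits)
    also have "\<dots> = real (card R2) * q ^ h" by simp
    also have "\<dots> \<le> (real h ^ h * real Y ^ (h - 2)) * q ^ h"
      using cR q by (intro mult_right_mono) auto
    also have "\<dots> = real h ^ h * (real Y ^ (h - 2) * q ^ h)" by simp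
    also have "\<dots> \<le> real h ^ h * ?D"
      using h2 Y q Z by (intro mult_left_mono power_scaling_le) auto
    finally show ?thesis .
  qed
  have D0: "?D \<ge> 0" using Z by auto
  have "(\<Sum>z\<in>R. ?f z) \<le> (\<Sum>z\<in>(\<Union>s\<in>{1..<h}. R1 s) \<union> R2. ?f z)"
    using sub finR f0 by (intro sum_mono2) auto
  also have "\<dots> \<le> (\<Sum>z\<in>(\<Union>s\<in>{1..<h}. R1 s). ?f z) + (\<Sum>z\<in>R2. ?f z)"
    using finR f0 by (intro sum_union_le) auto
  also have "(\<Sum>z\<in>(\<Union>s\<in>{1..<h}. R1 s). ?f z) = (\<Sum>s=1..<h. \<Sum>z\<in>R1 s. ?f z)"
    using finR by (intro sum.UNION_disjoint) (auto simp: R1_def)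
  also have "\<dots> \<le> (\<Sum>s=1..<h. 2 ^ h * real h ^ h * ?D)" by (rule sum_mono) (rule B1)
  also have "\<dots> + (\<Sum>z\<in>R2. ?f z) \<le> real h * (2 ^ h * real h ^ h * ?D) + real h * 2 ^ h * (real h ^ h * ?D)"
  proof (intro add_mono)
    show "(\<Sum>s=1..<h. 2 ^ h * real h ^ h * ?D) \<le> real h * (2 ^ h * real h ^ h * ?D)"
      unfolding sum_constant by (intro mult_right_mono mult_nonneg_nonneg[OF _ D0]) auto
    have "1 * 1 \<le> real h * 2 ^ h" using h2 by (intro mult_mono) auto
    then have "1 * (real h ^ h * ?D) \<le> real h * 2 ^ h * (real h ^ h * ?D)"
      by (intro mult_right_mono mult_nonneg_nonneg[OF _ D0]) auto
    then show "(\<Sum>z\<in>R2. ?f z) \<le> real h * 2 ^ h * (real h ^ h * ?D)" using B2 by linarith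
  qed
  finally show ?thesis by (simp add: algebra_simps)
qed

end

section \<open>Decreasing events of a random set\<close>

text \<open>If none of the events occurs, their number deviates from its mean by the whole mean
  \<mu>, so Chebyshev applies. In the second moment the diagonal costs \<mu> and the other pairs at
  most K \<mu>^2, which leaves 1 / \<mu> + K - 1.\<close>

lemma (in prob_space) second_moment_none:
  assumes I: "finite I" and X: "\<And>i. i \<in> I \<Longrightarrow> X i \<in> events"
    and pair: "\<And>i j. i \<in> I \<Longrightarrow> j \<in> I \<Longrightarrow> i \<noteq> j \<Longrightarrow> prob (X i \<inter> X j) \<le> K * (prob (X i) * prob (X j))"
    and K: "K \<ge> 0" and \<mu>: "\<mu> = (\<Sum>i\<in>I. prob (X i))" "\<mu> > 0"
  shows "prob {\<omega>\<in>space M. \<forall>i\<in>I. \<omega> \<notin> X i} \<le> 1 / \<mu> + K - 1"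
proof -
  define Z where "Z \<omega> = (\<Sum>i\<in>I. indicator (X i) \<omega> :: real)" for \<omega>
  have Zm: "Z \<in> borel_measurable M" unfolding Z_def using X by auto
  have Z_bound: "\<bar>Z \<omega>\<bar> \<le> real (card I)" for \<omega>
  proof -
    have "Z \<omega> \<le> (\<Sum>i\<in>I. 1)" unfolding Z_def by (intro sum_mono) (auto simp: indicator_def)
    moreover have "Z \<omega> \<ge> 0" unfolding Z_def by (intro sum_nonneg) auto
    ultimately show ?thesis by simp
  qed
  have Zi: "integrable M Z"
    by (rule integrable_const_bound[of _ "real (card I)"]) (use Z_bound Zm in auto)
  have Z2i: "integrable M (\<lambda>\<omega>. (Z \<omega>)\<^sup>2)"
  proof (rule integrable_const_bound[of _ "(real (card I))\<^sup>2"])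
    show "AE \<omega> in M. norm ((Z \<omega>)\<^sup>2) \<le> (real (card I))\<^sup>2"
      using Z_bound by (auto simp: abs_le_square_iff[symmetric])
  qed (use Zm in auto)
  have EZ: "expectation Z = \<mu>"
    unfolding Z_def \<mu> using X by (subst Bochner_Integration.integral_sum) (auto simp: emeasure_eq_measure)
  have "expectation (\<lambda>\<omega>. (Z \<omega>)\<^sup>2) = expectation (\<lambda>\<omega>. \<Sum>i\<in>I. \<Sum>j\<in>I. indicator (X i \<inter> X j) \<omega>)"
    by (simp add: Z_def power2_eq_square sum_product indicator_inter_arith)
  also have "\<dots> = (\<Sum>i\<in>I. \<Sum>j\<in>I. prob (X i \<inter> X j))"
    using X by (subst Bochner_Integration.integral_sum, force simp: emeasure_eq_measure)+
      (auto simp: emeasure_eq_measure sets.Int_space_eq2 intro!: sum.cong)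
  also have "\<dots> \<le> (\<Sum>i\<in>I. \<Sum>j\<in>I. (if j = i then prob (X i) else 0) + K * (prob (X i) * prob (X j)))"
  proof (intro sum_mono)
    fix i j assume "i \<in> I" "j \<in> I"
    then show "prob (X i \<inter> X j) \<le> (if j = i then prob (X i) else 0) + K * (prob (X i) * prob (X j))"
      using pair[of i j] K by (cases "i = j") auto
  qed
  also have "\<dots> = \<mu> + K * \<mu>\<^sup>2"
    using I by (simp add: sum.distrib \<mu> power2_eq_square sum_product flip: sum_distrib_left)
  finally have EZ2: "expectation (\<lambda>\<omega>. (Z \<omega>)\<^sup>2) \<le> \<mu> + K * \<mu>\<^sup>2" .
  have "prob {\<omega>\<in>space M. \<forall>i\<in>I. \<omega> \<notin> X i} \<le> prob {\<omega>\<in>space M. \<mu> \<le> \<bar>Z \<omega> - expectation Z\<bar>}"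
  proof (rule finite_measure_mono)
    show "{\<omega>\<in>space M. \<forall>i\<in>I. \<omega> \<notin> X i} \<subseteq> {\<omega>\<in>space M. \<mu> \<le> \<bar>Z \<omega> - expectation Z\<bar>}"
      by (auto simp: EZ Z_def)
    show "{\<omega>\<in>space M. \<mu> \<le> \<bar>Z \<omega> - expectation Z\<bar>} \<in> events" using Zm by measurable
  qed
  also have "\<dots> \<le> variance Z / \<mu>\<^sup>2"
    by (rule Chebyshev_inequality) (use Zm Z2i \<mu> in auto)
  also have "\<dots> \<le> (\<mu> + K * \<mu>\<^sup>2 - \<mu>\<^sup>2) / \<mu>\<^sup>2"
    using EZ2 variance_eq[OF Zi Z2i] by (intro divide_right_mono) (simp_all add: EZ)
  also have "\<dots> = 1 / \<mu> + K - 1" using \<mu>(2) by (simp add: field_simps power2_eq_square)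
  finally show ?thesis .
qed

text \<open>The inclusion probabilities of finite sets determine the law of the random set. In this
  form the element 0, which is always present, needs no exception, although the theorem assumes
  independence only for positive integers.\<close>

locale random_set = prob_space M for M :: "'a measure" +
  fixes A :: "'a \<Rightarrow> nat set" and p :: "nat \<Rightarrow> real"
  assumes mem_events [measurable]: "\<And>n. {\<omega>\<in>space M. n \<in> A \<omega>} \<in> events"
    and prob_subset: "\<And>U. finite U \<Longrightarrow> prob {\<omega>\<in>space M. U \<subseteq> A \<omega>} = (\<Prod>u\<in>U. p u)"
begin

lemma pred_mem [measurable]: "Measurable.pred M (\<lambda>\<omega>. n \<in> A \<omega>)"
  using mem_events[of n] by (simp add: pred_def)

lemma pred_subset [measurable]:
  assumes "finite U"
  shows "Measurable.pred M (\<lambda>\<omega>. U \<subseteq> A \<omega>)"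
proof -
  have "Measurable.pred M (\<lambda>\<omega>. \<forall>u\<in>U. u \<in> A \<omega>)" using assms by measurable
  then show ?thesis by (simp add: subset_eq)
qed

lemma p_range: "0 \<le> p n" "p n \<le> 1"
  using prob_subset[of "{n}"] measure_nonneg[of M "{\<omega>\<in>space M. {n} \<subseteq> A \<omega>}"]
    prob_le_1[of "{\<omega>\<in>space M. {n} \<subseteq> A \<omega>}"] by auto

lemma prod_p_range: "0 \<le> (\<Prod>u\<in>U. p u)" "(\<Prod>u\<in>U. p u) \<le> 1"
  using p_range by (auto intro: prod_nonneg prod_le_1)

text \<open>Inclusion-exclusion, one excluded element at a time: excluding \<open>x\<close>
  subtracts the event that \<open>x\<close> is present. This moves \<open>x\<close> into
  \<open>T\<close>, so \<open>T\<close> has to vary in the induction.\<close>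

lemma prob_pattern:
  assumes "finite T" "finite W" "T \<inter> W = {}"
  shows "prob {\<omega>\<in>space M. T \<subseteq> A \<omega> \<and> A \<omega> \<inter> W = {}} = (\<Prod>u\<in>T. p u) * (\<Prod>u\<in>W. 1 - p u)"
  using assms(2,1,3)
proof (induction W arbitrary: T rule: finite_induct)
  case empty
  then show ?case by (simp add: prob_subset)
next
  case (insert x W)
  have [measurable]: "Measurable.pred M (\<lambda>\<omega>. A \<omega> \<inter> W = {})"
  proof -
    have "Measurable.pred M (\<lambda>\<omega>. \<forall>u\<in>W. u \<notin> A \<omega>)" using insert.hyps by measurable
    moreover have "(\<lambda>\<omega>. A \<omega> \<inter> W = {}) = (\<lambda>\<omega>. \<forall>u\<in>W. u \<notin> A \<omega>)" by auto
    ultimately show ?thesis by simp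
  qed
  note [measurable] = pred_subset[OF \<open>finite T\<close>]
  have eq: "{\<omega>\<in>space M. T \<subseteq> A \<omega> \<and> A \<omega> \<inter> insert x W = {}} =
     {\<omega>\<in>space M. T \<subseteq> A \<omega> \<and> A \<omega> \<inter> W = {}} - {\<omega>\<in>space M. insert x T \<subseteq> A \<omega> \<and> A \<omega> \<inter> W = {}}"
    by auto
  have "prob {\<omega>\<in>space M. T \<subseteq> A \<omega> \<and> A \<omega> \<inter> insert x W = {}} =
      prob {\<omega>\<in>space M. T \<subseteq> A \<omega> \<and> A \<omega> \<inter> W = {}} - prob {\<omega>\<in>space M. insert x T \<subseteq> A \<omega> \<and> A \<omega> \<inter> W = {}}"
    unfolding eq
  proof (rule finite_measure_Diff)
    have [measurable]: "Measurable.pred M (\<lambda>\<omega>. insert x T \<subseteq> A \<omega>)"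
      using insert.prems by (intro pred_subset) auto
    show "{\<omega>\<in>space M. T \<subseteq> A \<omega> \<and> A \<omega> \<inter> W = {}} \<in> events" by measurable
    show "{\<omega>\<in>space M. insert x T \<subseteq> A \<omega> \<and> A \<omega> \<inter> W = {}} \<in> events" by measurable
  qed blast
  also have "\<dots> = (\<Prod>u\<in>T. p u) * (\<Prod>u\<in>W. 1 - p u) - (\<Prod>u\<in>insert x T. p u) * (\<Prod>u\<in>W. 1 - p u)"
    using insert.prems insert.hyps by (intro arg_cong2[where f = "(-)"] insert.IH) auto
  also have "\<dots> = (\<Prod>u\<in>T. p u) * (\<Prod>u\<in>insert x W. 1 - p u)"
  proof -
    have "x \<notin> T" using insert.prems by auto
    then show ?thesis
      unfolding prod.insert[OF \<open>finite T\<close> \<open>x \<notin> T\<close>] prod.insert[OF insert.hyps]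
      by (simp only: algebra_simps mult_1_right)
  qed
  finally show ?case .
qed

lemma pred_Int_eq [measurable]:
  assumes "finite W"
  shows "Measurable.pred M (\<lambda>\<omega>. A \<omega> \<inter> W = T)"
proof -
  have "(\<lambda>\<omega>. A \<omega> \<inter> W = T) = (\<lambda>\<omega>. T \<subseteq> W \<and> (\<forall>u\<in>W. u \<in> A \<omega> \<longleftrightarrow> u \<in> T))"
    by (auto simp: fun_eq_iff)
  moreover have "Measurable.pred M (\<lambda>\<omega>. T \<subseteq> W \<and> (\<forall>u\<in>W. u \<in> A \<omega> \<longleftrightarrow> u \<in> T))"
    using assms by measurable
  ultimately show ?thesis by simp
qed

text \<open>Sum over the possible traces on \<open>W\<close>, each of which is a pattern event with
  a product probability. Taking \<open>V = {}\<close> in the same formula identifies the second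
  factor.\<close>

lemma prob_subset_local:
  assumes U: "finite U" and W: "finite W" and disj: "U \<inter> W = {}"
  shows "prob {\<omega>\<in>space M. U \<subseteq> A \<omega> \<and> F (A \<omega> \<inter> W)} = (\<Prod>u\<in>U. p u) * prob {\<omega>\<in>space M. F (A \<omega> \<inter> W)}"
proof -
  have *: "prob {\<omega>\<in>space M. V \<subseteq> A \<omega> \<and> F (A \<omega> \<inter> W)} =
      (\<Prod>u\<in>V. p u) * (\<Sum>T\<in>{T\<in>Pow W. F T}. (\<Prod>u\<in>T. p u) * (\<Prod>u\<in>W - T. 1 - p u))"
    if V: "finite V" "V \<inter> W = {}" for V
  proof -
    note [measurable] = pred_subset[OF V(1)] pred_Int_eq[OF W]
    have "{\<omega>\<in>space M. V \<subseteq> A \<omega> \<and> F (A \<omega> \<inter> W)} = (\<Union>T\<in>{T\<in>Pow W. F T}. {\<omega>\<in>space M. V \<subseteq> A \<omega> \<and> A \<omega> \<inter> W = T})"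
      by auto
    also have "prob \<dots> = (\<Sum>T\<in>{T\<in>Pow W. F T}. prob {\<omega>\<in>space M. V \<subseteq> A \<omega> \<and> A \<omega> \<inter> W = T})"
      by (rule finite_measure_finite_Union) (use W in \<open>auto simp: disjoint_family_on_def\<close>)
    also have "\<dots> = (\<Sum>T\<in>{T\<in>Pow W. F T}. (\<Prod>u\<in>V. p u) * ((\<Prod>u\<in>T. p u) * (\<Prod>u\<in>W - T. 1 - p u)))"
    proof (intro sum.cong refl)
      fix T assume T: "T \<in> {T\<in>Pow W. F T}"
      then have fT: "finite T" using W finite_subset by auto
      have "{\<omega>\<in>space M. V \<subseteq> A \<omega> \<and> A \<omega> \<inter> W = T} = {\<omega>\<in>space M. V \<union> T \<subseteq> A \<omega> \<and> A \<omega> \<inter> (W - T) = {}}"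
        using T by auto
      also have "prob \<dots> = (\<Prod>u\<in>V \<union> T. p u) * (\<Prod>u\<in>W - T. 1 - p u)"
        by (rule prob_pattern) (use V W T fT in auto)
      also have "(\<Prod>u\<in>V \<union> T. p u) = (\<Prod>u\<in>V. p u) * (\<Prod>u\<in>T. p u)"
        by (rule prod.union_disjoint) (use V fT T in auto)
      finally show "prob {\<omega>\<in>space M. V \<subseteq> A \<omega> \<and> A \<omega> \<inter> W = T} = (\<Prod>u\<in>V. p u) * ((\<Prod>u\<in>T. p u) * (\<Prod>u\<in>W - T. 1 - p u))"
        by simp
    qed
    finally show ?thesis by (simp add: sum_distrib_left)
  qed
  show ?thesis using *[OF U disj] *[of "{}"] by simp
qed

text \<open>Indexed by \<open>I\<close> rather than given as a set of sets, so that a support that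
  serves two different numbers can occur twice and counts as a dependent pair.\<close>

definition avoids :: "'i set \<Rightarrow> ('i \<Rightarrow> nat set) \<Rightarrow> 'a set" where
  "avoids I S = {\<omega>\<in>space M. \<forall>i\<in>I. \<not> S i \<subseteq> A \<omega>}"

lemma avoids_events [measurable]:
  assumes "finite I" "\<And>i. i \<in> I \<Longrightarrow> finite (S i)"
  shows "avoids I S \<in> events"
proof -
  have "Measurable.pred M (\<lambda>\<omega>. \<forall>i\<in>I. \<not> S i \<subseteq> A \<omega>)"
    using assms by (intro pred_intros_finite(3) pred_intros_logic(2) pred_subset) auto
  then show ?thesis unfolding avoids_def by (simp add: pred_def)
qed

text \<open>The only case of the Harris inequality that is needed. Forcing the elements of \<open>U\<close> into
  the random set shrinks a decreasing event to one that no longer depends on \<open>U\<close>.\<close>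
lemma prob_subset_avoids_le:
  assumes U: "finite U" and I: "finite I" and S: "\<And>i. i \<in> I \<Longrightarrow> finite (S i)"
  shows "prob ({\<omega>\<in>space M. U \<subseteq> A \<omega>} \<inter> avoids I S) \<le> (\<Prod>u\<in>U. p u) * prob (avoids I S)"
proof -
  define W where "W = (\<Union>i\<in>I. S i) - U"
  define F where "F X \<longleftrightarrow> (\<forall>i\<in>I. \<not> S i - U \<subseteq> X)" for X
  have W: "finite W" using I S by (auto simp: W_def)
  have F: "F (A \<omega> \<inter> W) \<longleftrightarrow> (\<forall>i\<in>I. \<not> S i - U \<subseteq> A \<omega>)" for \<omega>
    unfolding F_def W_def by blast
  have "{\<omega>\<in>space M. U \<subseteq> A \<omega>} \<inter> avoids I S = {\<omega>\<in>space M. U \<subseteq> A \<omega> \<and> F (A \<omega> \<inter> W)}"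
    unfolding F avoids_def by blast
  then have "prob ({\<omega>\<in>space M. U \<subseteq> A \<omega>} \<inter> avoids I S) = (\<Prod>u\<in>U. p u) * prob {\<omega>\<in>space M. F (A \<omega> \<inter> W)}"
    using prob_subset_local[OF U W, of F] by (auto simp: W_def)
  also have "prob {\<omega>\<in>space M. F (A \<omega> \<inter> W)} \<le> prob (avoids I S)"
    by (rule finite_measure_mono) (auto simp: F avoids_def intro: avoids_events[OF I S, unfolded avoids_def])
  finally show ?thesis by (simp add: mult_left_mono prod_p_range)
qed

lemma prob_avoids_insert:
  assumes I: "finite I" and S: "\<And>i. i \<in> insert j I \<Longrightarrow> finite (S i)"
  shows "prob (avoids (insert j I) S) = prob (avoids I S) - prob ({\<omega>\<in>space M. S j \<subseteq> A \<omega>} \<inter> avoids I S)"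
proof -
  note [measurable] = pred_subset[OF S[of j]] avoids_events[OF I, of S]
  have "avoids (insert j I) S = avoids I S - ({\<omega>\<in>space M. S j \<subseteq> A \<omega>} \<inter> avoids I S)"
    by (auto simp: avoids_def)
  then show ?thesis using S avoids_events[OF I, of S] by (simp add: finite_measure_Diff)
qed

text \<open>Harris' lower bound, one set at a time: avoiding the earlier sets can only lower the
  probability of containing the next one.\<close>

lemma prob_avoids_ge:
  assumes "finite I" "\<And>i. i \<in> I \<Longrightarrow> finite (S i)"
  shows "prob (avoids I S) \<ge> (\<Prod>i\<in>I. 1 - (\<Prod>u\<in>S i. p u))"
  using assms
proof (induction I rule: finite_induct)
  case empty
  then show ?case by (simp add: avoids_def prob_space)
next
  case (insert j I)
  have "(\<Prod>i\<in>insert j I. 1 - (\<Prod>u\<in>S i. p u)) = (1 - (\<Prod>u\<in>S j. p u)) * (\<Prod>i\<in>I. 1 - (\<Prod>u\<in>S i. p u))"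
    using insert by simp
  also have "\<dots> \<le> (1 - (\<Prod>u\<in>S j. p u)) * prob (avoids I S)"
    using insert prod_p_range by (intro mult_left_mono insert.IH) auto
  also have "\<dots> = prob (avoids I S) - (\<Prod>u\<in>S j. p u) * prob (avoids I S)" by (simp add: algebra_simps)
  also have "\<dots> \<le> prob (avoids I S) - prob ({\<omega>\<in>space M. S j \<subseteq> A \<omega>} \<inter> avoids I S)"
    using prob_subset_avoids_le[of "S j" I S] insert by auto
  also have "\<dots> = prob (avoids (insert j I) S)"
    using insert by (subst prob_avoids_insert) auto
  finally show ?case .
qed

text \<open>One step of Janson's inequality. Containing \<open>S j\<close> is independent of
  avoiding the family \<open>E\<close> of sets disjoint from it. Passing from \<open>E\<close> to
  \<open>I\<close> loses at most a sum over the neighbours \<open>N\<close>, in which the Harris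
  inequality for \<open>E\<close> preserves the common factor \<open>prob (avoids E S)\<close>; that
  factor is at least \<open>prob (avoids I S)\<close>.\<close>

lemma prob_avoids_insert_le:
  assumes I: "finite I" and S: "\<And>i. i \<in> insert j I \<Longrightarrow> finite (S i)"
  shows "prob (avoids (insert j I) S) \<le> prob (avoids I S) *
     (1 - (\<Prod>u\<in>S j. p u) + (\<Sum>i | i \<in> I \<and> S i \<inter> S j \<noteq> {}. \<Prod>u\<in>S i \<union> S j. p u))"
proof -
  define N where "N = {i\<in>I. S i \<inter> S j \<noteq> {}}"
  define E where "E = I - N"
  define q where "q = (\<Prod>u\<in>S j. p u)"
  define \<Delta> where "\<Delta> = (\<Sum>i\<in>N. \<Prod>u\<in>S i \<union> S j. p u)"
  have fin: "finite N" "finite E" and sub: "N \<subseteq> I" "E \<subseteq> I" using I by (auto simp: N_def E_def)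
  note ev = avoids_events[OF I, of S] avoids_events[OF fin(2), of S]
  have evI: "avoids I S \<in> events" and evE: "avoids E S \<in> events" using ev S sub by auto
  have evU: "{\<omega>\<in>space M. U \<subseteq> A \<omega>} \<in> events" if "finite U" for U
    using pred_subset[OF that] by (simp add: pred_def)
  have mono: "prob (avoids I S) \<le> prob (avoids E S)"
    by (rule finite_measure_mono) (use evE sub in \<open>auto simp: avoids_def\<close>)
  have indepE: "prob ({\<omega>\<in>space M. S j \<subseteq> A \<omega>} \<inter> avoids E S) = q * prob (avoids E S)"
  proof -
    define W where "W = (\<Union>i\<in>E. S i)"
    define F where "F X \<longleftrightarrow> (\<forall>i\<in>E. \<not> S i \<subseteq> X)" for X
    have F: "F (A \<omega> \<inter> W) \<longleftrightarrow> (\<forall>i\<in>E. \<not> S i \<subseteq> A \<omega>)" for \<omega>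
      unfolding F_def W_def by blast
    have "{\<omega>\<in>space M. S j \<subseteq> A \<omega>} \<inter> avoids E S = {\<omega>\<in>space M. S j \<subseteq> A \<omega> \<and> F (A \<omega> \<inter> W)}"
      "avoids E S = {\<omega>\<in>space M. F (A \<omega> \<inter> W)}"
      unfolding F avoids_def by blast+
    moreover have "S j \<inter> W = {}" unfolding W_def E_def N_def by blast
    moreover have "finite W" "finite (S j)" using S sub fin unfolding W_def by auto
    ultimately show ?thesis using prob_subset_local[of "S j" W F] unfolding q_def by metis
  qed
  have "prob ({\<omega>\<in>space M. S j \<subseteq> A \<omega>} \<inter> avoids E S) \<le>
     prob (({\<omega>\<in>space M. S j \<subseteq> A \<omega>} \<inter> avoids I S) \<union> (\<Union>i\<in>N. {\<omega>\<in>space M. S i \<union> S j \<subseteq> A \<omega>} \<inter> avoids E S))"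
  proof (rule finite_measure_mono)
    show "{\<omega>\<in>space M. S j \<subseteq> A \<omega>} \<inter> avoids E S \<subseteq>
      ({\<omega>\<in>space M. S j \<subseteq> A \<omega>} \<inter> avoids I S) \<union> (\<Union>i\<in>N. {\<omega>\<in>space M. S i \<union> S j \<subseteq> A \<omega>} \<inter> avoids E S)"
      by (auto simp: avoids_def E_def)
  qed (use evI evE evU S sub fin in \<open>auto intro!: sets.Un sets.finite_UN sets.Int\<close>)
  also have "\<dots> \<le> prob ({\<omega>\<in>space M. S j \<subseteq> A \<omega>} \<inter> avoids I S) +
      prob (\<Union>i\<in>N. {\<omega>\<in>space M. S i \<union> S j \<subseteq> A \<omega>} \<inter> avoids E S)"
    by (rule measure_Un_le) (use evI evE evU S sub fin in \<open>auto intro!: sets.finite_UN sets.Int\<close>)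
  also have "prob (\<Union>i\<in>N. {\<omega>\<in>space M. S i \<union> S j \<subseteq> A \<omega>} \<inter> avoids E S)
      \<le> (\<Sum>i\<in>N. prob ({\<omega>\<in>space M. S i \<union> S j \<subseteq> A \<omega>} \<inter> avoids E S))"
    by (rule finite_measure_subadditive_finite) (use evE evU S sub fin in \<open>auto intro!: sets.Int\<close>)
  also have "\<dots> \<le> (\<Sum>i\<in>N. (\<Prod>u\<in>S i \<union> S j. p u) * prob (avoids E S))"
    by (intro sum_mono prob_subset_avoids_le) (use S sub fin in auto)
  also have "\<dots> = \<Delta> * prob (avoids E S)" by (simp add: \<Delta>_def sum_distrib_right)
  finally have "q * prob (avoids E S) \<le> prob ({\<omega>\<in>space M. S j \<subseteq> A \<omega>} \<inter> avoids I S) + \<Delta> * prob (avoids E S)"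
    by (simp add: indepE)
  then have key: "prob ({\<omega>\<in>space M. S j \<subseteq> A \<omega>} \<inter> avoids I S) \<ge> (q - \<Delta>) * prob (avoids E S)"
    by (simp add: algebra_simps)
  have "(q - \<Delta>) * prob (avoids I S) \<le> prob ({\<omega>\<in>space M. S j \<subseteq> A \<omega>} \<inter> avoids I S)"
  \<comment> \<open>Replacing \<open>E\<close> by \<open>I\<close> needs a nonnegative factor;
    otherwise the left side is not positive anyway.\<close>
  proof (cases "q - \<Delta> \<ge> 0")
    case True
    with mono key show ?thesis by (meson mult_left_mono order_trans)
  next
    case False
    then have "(q - \<Delta>) * prob (avoids I S) \<le> 0" by (intro mult_nonpos_nonneg) auto
    then show ?thesis by (meson measure_nonneg order_trans)
  qed
  then have "prob (avoids (insert j I) S) \<le> prob (avoids I S) * (1 - q + \<Delta>)"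
    using prob_avoids_insert[of I j S, OF I S] by (simp add: algebra_simps)
  then show ?thesis by (simp add: q_def \<Delta>_def N_def)
qed

text \<open>Each factor sums over all neighbours in \<open>I\<close>, not only over those inserted
  earlier, so the bound does not depend on the order of insertion.\<close>

lemma Janson_prob_avoids_le:
  assumes I: "finite I" and S: "\<And>i. i \<in> I \<Longrightarrow> finite (S i)" and J: "J \<subseteq> I"
  shows "prob (avoids J S) \<le>
     (\<Prod>i\<in>J. 1 - (\<Prod>u\<in>S i. p u) + (\<Sum>j | j \<in> I \<and> j \<noteq> i \<and> S j \<inter> S i \<noteq> {}. \<Prod>u\<in>S j \<union> S i. p u))"
proof -
  have "finite J" using J I finite_subset by auto
  then show ?thesis using J
  proof (induction J rule: finite_induct)
    case empty
    then show ?case by (simp add: avoids_def prob_space)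
  next
    case (insert i J)
    let ?f = "\<lambda>i. 1 - (\<Prod>u\<in>S i. p u) + (\<Sum>j | j \<in> I \<and> j \<noteq> i \<and> S j \<inter> S i \<noteq> {}. \<Prod>u\<in>S j \<union> S i. p u)"
    have f0: "?f i \<ge> 0" for i
      using prod_p_range by (intro add_nonneg_nonneg sum_nonneg) auto
    have "prob (avoids (insert i J) S) \<le> prob (avoids J S) *
       (1 - (\<Prod>u\<in>S i. p u) + (\<Sum>j | j \<in> J \<and> S j \<inter> S i \<noteq> {}. \<Prod>u\<in>S j \<union> S i. p u))"
      by (rule prob_avoids_insert_le) (use insert S in auto)
    also have "\<dots> \<le> prob (avoids J S) * ?f i"
      using insert I prod_p_range by (intro mult_left_mono add_left_mono sum_mono2) auto
    also have "\<dots> \<le> (\<Prod>i\<in>J. ?f i) * ?f i"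
      using insert f0 by (intro mult_right_mono) auto
    finally show ?case using insert by (simp add: mult.commute)
  qed
qed

end

section \<open>The random set of the theorem\<close>

lemma exp_le_one_minus:
  assumes "0 \<le> x" "x \<le> 1 / 2"
  shows "exp (- x - 2 * x\<^sup>2) \<le> 1 - (x :: real)"
proof -
  have "- x - 2 * x\<^sup>2 \<le> ln (1 - x)" by (rule ln_one_minus_pos_lower_bound) (use assms in auto)
  then have "exp (- x - 2 * x\<^sup>2) \<le> exp (ln (1 - x))" by simp
  then show ?thesis using assms by simp
qed

text \<open>\<kappa> is the limit from \<open>power_weighted_sols_tendsto\<close> scaled by
  \<open>c ^ h\<close>, hence the coefficient of the logarithm in the mean. That it is below 1 makes
  the expected number of missed integers in a window grow.\<close>

locale sparse_random_form = positive_form b h + random_set M A p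
  for b :: "nat \<Rightarrow> nat" and h :: nat and M :: "'a measure" and A :: "'a \<Rightarrow> nat set" and p :: "nat \<Rightarrow> real" +
  fixes c \<kappa> :: real
  assumes gcd_b: "Gcd (b ` {..<h}) = 1"
    and zero_mem: "\<And>\<omega>. \<omega> \<in> space M \<Longrightarrow> 0 \<in> A \<omega>"
    and c_pos: "c > 0"
    and p_eq: "\<And>n. n \<ge> 1 \<Longrightarrow> p n = min (c * (real n * ln (real n)) powr (1 / real h) / real n) 1"
    and \<kappa>_eq: "\<kappa> = c ^ h * (\<Prod>i<h. Gamma (1 / real h) * real (b i) powr (- 1 / real h))"
    and \<kappa>: "0 < \<kappa>" "\<kappa> < 1"
begin

definition "s = 1 / real h"

text \<open>\<open>2 * N\<close> bounds every number of the window \<open>{N..<2 * N}\<close>, so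
  one logarithm serves them all.\<close>

definition "ell N = ln (2 * real N)" for N :: nat

text \<open>The exponent is chosen for \<open>bad_sols_sum_le\<close>: (thr N / N)^(1/h) is ell^(-h
  - 1), which beats the factor ell^h from the probabilities and leaves 1 / ell.\<close>

definition "thr N = real N / ell N ^ (h * (h + 1))" for N :: nat

definition "supp_prob k = (\<Prod>u\<in>nz_supp h k. p u)"

definition "mean_count n = (\<Sum>k\<in>sols b h n. supp_prob k)"

lemma s: "0 < s" "s < 1" and s_h: "s * real h = 1"
  using h2 by (auto simp: s_def)

lemma supp_prob_nonneg: "0 \<le> supp_prob k"
  unfolding supp_prob_def by (rule prod_p_range)

text \<open>Since 0 always belongs to the random set, only the nonzero entries of a tuple impose a
  condition.\<close>

lemma r_count_eq:
  assumes "\<omega> \<in> space M"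
  shows "r_count b (A \<omega>) h n = card {k \<in> sols b h n. nz_supp h k \<subseteq> A \<omega>}"
proof -
  have "{k \<in> {..<h} \<rightarrow>\<^sub>E A \<omega>. (\<Sum>i<h. b i * k i) = n} = {k \<in> sols b h n. nz_supp h k \<subseteq> A \<omega>}"
    using zero_mem[OF assms] by (auto simp: sols_def nz_supp_def PiE_iff)
  then show ?thesis by (simp add: r_count_def)
qed

lemma expectation_r_count: "expectation (\<lambda>\<omega>. real (r_count b (A \<omega>) h n)) = mean_count n"
proof -
  have ev: "{\<omega>\<in>space M. nz_supp h k \<subseteq> A \<omega>} \<in> events" for k
    using pred_subset[OF finite_nz_supp] by (simp add: pred_def)
  have "expectation (\<lambda>\<omega>. real (r_count b (A \<omega>) h n)) =
     expectation (\<lambda>\<omega>. \<Sum>k\<in>sols b h n. indicator {\<omega>\<in>space M. nz_supp h k \<subseteq> A \<omega>} \<omega>)"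
  proof (rule Bochner_Integration.integral_cong[OF refl])
    fix \<omega> assume \<omega>: "\<omega> \<in> space M"
    have "(\<Sum>k\<in>sols b h n. indicator {\<omega>\<in>space M. nz_supp h k \<subseteq> A \<omega>} \<omega>) =
       (\<Sum>k\<in>sols b h n. if nz_supp h k \<subseteq> A \<omega> then 1 else 0 :: real)"
      using \<omega> by (intro sum.cong) (auto simp: indicator_def)
    also have "\<dots> = real (r_count b (A \<omega>) h n)"
      using finite_sols[OF bpos] by (simp add: r_count_eq[OF \<omega>] sum.If_cases Int_def)
    finally show "real (r_count b (A \<omega>) h n) = (\<Sum>k\<in>sols b h n. indicator {\<omega>\<in>space M. nz_supp h k \<subseteq> A \<omega>} \<omega>)" ..
  qed
  also have "\<dots> = (\<Sum>k\<in>sols b h n. prob {\<omega>\<in>space M. nz_supp h k \<subseteq> A \<omega>})"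
    using ev by (subst Bochner_Integration.integral_sum) (auto simp: emeasure_eq_measure)
  also have "\<dots> = mean_count n"
    unfolding mean_count_def supp_prob_def by (intro sum.cong refl prob_subset) auto
  finally show ?thesis .
qed

text \<open>The majorant \<open>x\<close> is free: \<open>x = n\<close> gives the sharp logarithm in
  the upper bound for the mean, \<open>x = 2 * N\<close> a bound valid on a whole window.\<close>

lemma p_le:
  assumes v: "1 \<le> v" "real v \<le> x" and x: "ln x \<ge> 0"
  shows "p v \<le> c * ln x powr s * real v powr (s - 1)"
proof -
  have "p v \<le> c * (real v * ln (real v)) powr s / real v" using p_eq[OF v(1)] by (simp add: s_def)
  also have "\<dots> = c * ln (real v) powr s * (real v powr s / real v)"
    using v by (simp add: powr_mult)
  also have "real v powr s / real v = real v powr (s - 1)" using v by (simp add: powr_diff)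
  also have "c * ln (real v) powr s * real v powr (s - 1) \<le> c * ln x powr s * real v powr (s - 1)"
    using v c_pos s by (intro mult_right_mono mult_left_mono powr_mono2) auto
  finally show ?thesis .
qed

lemma p_le_ell:
  assumes v: "1 \<le> v" "v < 2 * N" and N: "ell N \<ge> 1"
  shows "p v \<le> c * ell N * real v powr (s - 1)"
proof -
  have "p v \<le> c * ell N powr s * real v powr (s - 1)"
    unfolding ell_def by (rule p_le) (use assms in \<open>auto simp: ell_def\<close>)
  also have "ell N powr s \<le> ell N powr 1" using N s by (intro powr_mono) auto
  finally show ?thesis using N c_pos by (simp add: mult_left_mono mult_right_mono)
qed

definition "bad_const = real (h + 1) ^ h * real h * real h * real h ^ h * real bsum"

lemma bad_const_nonneg: "bad_const \<ge> 0"
  by (simp add: bad_const_def)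

lemma thr_ratio:
  assumes N: "ell N \<ge> 1" "N > 0" "n \<ge> N"
  shows "(thr N / real n) powr s \<le> 1 / ell N ^ (h + 1)"
proof -
  have "thr N / real n \<le> thr N / real N"
    using N by (intro divide_left_mono) (auto simp: thr_def)
  also have "\<dots> = 1 / ell N ^ (h * (h + 1))" using N by (simp add: thr_def)
  finally have "(thr N / real n) powr s \<le> (1 / ell N ^ (h * (h + 1))) powr s"
    using N s by (intro powr_mono2) (auto simp: thr_def)
  also have "\<dots> = 1 / (ell N ^ (h * (h + 1))) powr s" by (simp add: powr_divide)
  also have "(ell N ^ (h * (h + 1))) powr s = (ell N powr real (h * (h + 1))) powr s"
    using N by (subst powr_realpow) auto
  also have "\<dots> = ell N powr (real (h * (h + 1)) * s)" by (rule powr_powr)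
  also have "real (h * (h + 1)) * s = real (h + 1)" using h2 by (simp add: s_def field_simps)
  also have "ell N powr real (h + 1) = ell N ^ (h + 1)" using N by (subst powr_realpow) auto
  finally show ?thesis .
qed

lemma bad_sum_le:
  assumes N: "ell N \<ge> 1" "N > 0" "n \<ge> N" "n < 2 * N" and t: "thr N \<ge> 1" "thr N * real bsum \<le> real N"
  shows "(\<Sum>k\<in>sols b h n - good_sols b h (thr N) n. supp_prob k) \<le> bad_const * (1 + c) ^ h / ell N"
    and "(\<Sum>k\<in>sols b h n - good_sols b h (thr N) n. \<Prod>u\<in>nz_supp h k. real u powr (s - 1)) \<le> bad_const / ell N"
proof -
  define L where "L = (1 + c) * ell N"
  have L: "L \<ge> 1" unfolding L_def using N c_pos mult_mono[of 1 "1 + c" 1 "ell N"] by simp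
  have tn: "thr N * real bsum \<le> real n" using t N by simp
  have "(\<Sum>k\<in>sols b h n - good_sols b h (thr N) n. supp_prob k) \<le> bad_const * L ^ h * (thr N / real n) powr (1 / real h)"
    unfolding supp_prob_def bad_const_def
  proof (rule bad_sols_sum_le[OF _ _ L t(1) tn])
    show "0 \<le> p v" for v by (rule p_range)
    fix v assume v: "1 \<le> v" "v \<le> n"
    have "p v \<le> c * ell N * real v powr (s - 1)" by (rule p_le_ell) (use v N in auto)
    also have "\<dots> \<le> L * real v powr (s - 1)" unfolding L_def using N by (intro mult_right_mono) auto
    finally show "p v \<le> L * real v powr (1 / real h - 1)" by (simp add: s_def)
  qed
  also have "\<dots> \<le> bad_const * L ^ h * (1 / ell N ^ (h + 1))"
    unfolding s_def[symmetric] using L bad_const_nonneg by (intro mult_left_mono thr_ratio N) auto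
  also have "\<dots> = bad_const * (1 + c) ^ h / ell N"
    using N by (simp add: L_def power_mult_distrib)
  finally show "(\<Sum>k\<in>sols b h n - good_sols b h (thr N) n. supp_prob k) \<le> bad_const * (1 + c) ^ h / ell N" .
  \<comment> \<open>The pure power weights allow \<open>L = 1\<close>; the surplus powers of
    \<open>ell N\<close> are given away. This serves the lower bound for the mean.\<close>
  have "(\<Sum>k\<in>sols b h n - good_sols b h (thr N) n. \<Prod>u\<in>nz_supp h k. real u powr (s - 1))
      \<le> bad_const * 1 ^ h * (thr N / real n) powr (1 / real h)"
    unfolding bad_const_def
    by (rule bad_sols_sum_le[OF _ _ _ t(1) tn]) (auto simp: s_def)
  also have "\<dots> \<le> bad_const * 1 ^ h * (1 / ell N ^ (h + 1))"
    unfolding s_def[symmetric] using bad_const_nonneg by (intro mult_left_mono thr_ratio N) auto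
  also have "\<dots> \<le> bad_const * 1 ^ h * (1 / ell N ^ 1)"
    using N bad_const_nonneg by (intro mult_left_mono divide_left_mono power_increasing) auto
  finally show "(\<Sum>k\<in>sols b h n - good_sols b h (thr N) n. \<Prod>u\<in>nz_supp h k. real u powr (s - 1)) \<le> bad_const / ell N"
    by simp
qed

lemma good_solsD:
  assumes "k \<in> good_sols b h t n" "t > 0"
  shows "k \<in> sols b h n" "inj_on k {..<h}" "nz_supp h k = k ` {..<h}" "\<And>i. i < h \<Longrightarrow> t \<le> real (k i)"
    "\<And>i. i < h \<Longrightarrow> 1 \<le> k i" "(\<Prod>u\<in>nz_supp h k. f u) = (\<Prod>i<h. f (k i))"
proof -
  show 1: "k \<in> sols b h n" "inj_on k {..<h}" "\<And>i. i < h \<Longrightarrow> t \<le> real (k i)"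
    using assms by (auto simp: good_sols_def)
  show 2: "1 \<le> k i" if "i < h" for i using 1(3)[OF that] assms(2) by (cases "k i") auto
  show 3: "nz_supp h k = k ` {..<h}" using 2 by (fastforce simp: nz_supp_def)
  show "(\<Prod>u\<in>nz_supp h k. f u) = (\<Prod>i<h. f (k i))"
    unfolding 3 by (subst prod.reindex[OF 1(2)]) simp
qed

definition "power_sum n = (\<Sum>k\<in>sols b h n. \<Prod>i<h. real (k i) powr (s - 1))"

lemma power_sum_tendsto: "(\<lambda>n. c ^ h * power_sum n) \<longlonglongrightarrow> \<kappa>"
  unfolding \<kappa>_eq power_sum_def s_def
  using h2 by (intro tendsto_mult tendsto_const power_weighted_sols_tendsto bpos gcd_b) auto

text \<open>The \<open>h\<close> factors \<open>x powr (1 / h)\<close> multiply to one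
  \<open>x\<close>; with \<open>x\<close> a logarithm, this is the source of \<open>ln n\<close> in
  the mean.\<close>

lemma prod_c_powr: "x \<ge> 0 \<Longrightarrow> (\<Prod>i<h. c * x powr s * f i) = c ^ h * x * (\<Prod>i<h. f i)"
proof -
  assume x: "x \<ge> 0"
  have "(x powr s) ^ h = x"
  proof (cases "x = 0")
    case True
    then show ?thesis using h2 by simp
  next
    case False
    then have "(x powr s) ^ h = x powr (s * real h)" using x by (simp add: powr_powr flip: powr_realpow)
    then show ?thesis using s_h x False by simp
  qed
  then show ?thesis by (simp add: prod.distrib power_mult_distrib)
qed

section \<open>Asymptotics of the expected number of representations\<close>

lemma mean_count_le:
  assumes N: "ell N \<ge> 1" "N > 0" "n \<ge> N" "n < 2 * N" and t: "thr N \<ge> 1" "thr N * real bsum \<le> real N"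
  shows "mean_count n \<le> c ^ h * power_sum n * ln (real n) + bad_const * (1 + c) ^ h / ell N"
proof -
  have fin: "finite (sols b h n)" by (rule finite_sols[OF bpos])
  have sub: "good_sols b h (thr N) n \<subseteq> sols b h n" by (auto simp: good_sols_def)
  have tp: "thr N > 0" using t by simp
  have "(\<Sum>k\<in>good_sols b h (thr N) n. supp_prob k)
      \<le> (\<Sum>k\<in>good_sols b h (thr N) n. c ^ h * ln (real n) * (\<Prod>i<h. real (k i) powr (s - 1)))"
  proof (rule sum_mono)
    fix k assume k: "k \<in> good_sols b h (thr N) n"
    note g = good_solsD[OF k tp]
    have "supp_prob k = (\<Prod>i<h. p (k i))" unfolding supp_prob_def by (rule g(6))
    also have "\<dots> \<le> (\<Prod>i<h. c * ln (real n) powr s * real (k i) powr (s - 1))"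
    proof (intro prod_mono conjI p_range p_le)
      fix i assume "i \<in> {..<h}"
      then show "real (k i) \<le> real n" using sols_le(2)[OF bpos g(1), of i] by simp
    qed (use N g(5) in auto)
    also have "\<dots> = c ^ h * ln (real n) * (\<Prod>i<h. real (k i) powr (s - 1))"
      using N by (intro prod_c_powr) auto
    finally show "supp_prob k \<le> c ^ h * ln (real n) * (\<Prod>i<h. real (k i) powr (s - 1))" .
  qed
  also have "\<dots> \<le> (\<Sum>k\<in>sols b h n. c ^ h * ln (real n) * (\<Prod>i<h. real (k i) powr (s - 1)))"
    using fin sub N c_pos by (intro sum_mono2 mult_nonneg_nonneg prod_nonneg) auto
  also have "\<dots> = c ^ h * power_sum n * ln (real n)"
    by (simp add: power_sum_def flip: sum_distrib_left)
  finally have "(\<Sum>k\<in>good_sols b h (thr N) n. supp_prob k) \<le> c ^ h * power_sum n * ln (real n)" .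
  moreover have "mean_count n = (\<Sum>k\<in>sols b h n - good_sols b h (thr N) n. supp_prob k) + (\<Sum>k\<in>good_sols b h (thr N) n. supp_prob k)"
    unfolding mean_count_def by (rule sum.subset_diff[OF sub fin])
  ultimately show ?thesis using bad_sum_le(1)[OF N t] by simp
qed

text \<open>On good tuples every \<open>ln (k i)\<close> is at least \<open>ln (thr N)\<close>, and
  \<open>small\<close> makes the minimum in the probabilities inactive. The tuples left out cost at
  most \<open>bad_const / ell N\<close> in the power sum.\<close>

lemma mean_count_ge:
  assumes N: "ell N \<ge> 1" "N > 0" "n \<ge> N" "n < 2 * N" and t: "thr N \<ge> 1" "thr N * real bsum \<le> real N"
    and small: "\<And>v. real v \<ge> thr N \<Longrightarrow> c * (real v * ln (real v)) powr s / real v \<le> 1"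
  shows "c ^ h * (power_sum n - bad_const / ell N) * ln (thr N) \<le> mean_count n"
proof -
  have fin: "finite (sols b h n)" by (rule finite_sols[OF bpos])
  have sub: "good_sols b h (thr N) n \<subseteq> sols b h n" by (auto simp: good_sols_def)
  have tp: "thr N > 0" using t by simp
  let ?g = "\<lambda>k. \<Prod>i<h. real (k i) powr (s - 1)"
  \<comment> \<open>\<open>bad_sum_le\<close> uses each distinct nonzero entry once. The additional
    factors of the full product are at most 1, also for an entry 0 because
    \<open>0 powr x = 0\<close>.\<close>
  have "(\<Sum>k\<in>sols b h n - good_sols b h (thr N) n. ?g k)
      \<le> (\<Sum>k\<in>sols b h n - good_sols b h (thr N) n. \<Prod>u\<in>nz_supp h k. real u powr (s - 1))"
  proof (rule sum_mono)
    fix k :: "nat \<Rightarrow> nat"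
    have sub': "reps h (pattern h k) \<subseteq> {..<h}" using reps_patternD(1) by auto
    have le1: "real v powr (s - 1) \<le> 1" for v :: nat
    proof (cases "v = 0")
      case False
      then have "real v powr (s - 1) \<le> real v powr 0" using s by (intro powr_mono) auto
      then show ?thesis using False by simp
    qed auto
    have "?g k = (\<Prod>i\<in>{..<h} - reps h (pattern h k). real (k i) powr (s - 1)) * (\<Prod>i\<in>reps h (pattern h k). real (k i) powr (s - 1))"
      by (rule prod.subset_diff[OF sub']) simp
    also have "\<dots> \<le> 1 * (\<Prod>i\<in>reps h (pattern h k). real (k i) powr (s - 1))"
      using le1 by (intro mult_right_mono prod_le_1 prod_nonneg) auto
    finally show "?g k \<le> (\<Prod>u\<in>nz_supp h k. real u powr (s - 1))" by (simp add: prod_nz_supp)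
  qed
  also have "\<dots> \<le> bad_const / ell N" by (rule bad_sum_le(2)[OF N t])
  finally have "power_sum n - bad_const / ell N \<le> (\<Sum>k\<in>good_sols b h (thr N) n. ?g k)"
    unfolding power_sum_def sum.subset_diff[OF sub fin] by simp
  then have "(c ^ h * ln (thr N)) * (power_sum n - bad_const / ell N) \<le> (c ^ h * ln (thr N)) * (\<Sum>k\<in>good_sols b h (thr N) n. ?g k)"
    using c_pos t by (intro mult_left_mono) auto
  also have "\<dots> = (\<Sum>k\<in>good_sols b h (thr N) n. c ^ h * ln (thr N) * ?g k)" by (simp add: sum_distrib_left)
  also have "\<dots> \<le> (\<Sum>k\<in>good_sols b h (thr N) n. supp_prob k)"
  proof (rule sum_mono)
    fix k assume k: "k \<in> good_sols b h (thr N) n"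
    note g = good_solsD[OF k tp]
    have "c ^ h * ln (thr N) * ?g k = (\<Prod>i<h. c * ln (thr N) powr s * real (k i) powr (s - 1))"
      using t by (intro prod_c_powr[symmetric]) auto
    also have "\<dots> \<le> (\<Prod>i<h. p (k i))"
    proof (intro prod_mono conjI)
      fix i assume i: "i \<in> {..<h}"
      then have ki: "1 \<le> k i" "thr N \<le> real (k i)" using g by auto
      show "0 \<le> c * ln (thr N) powr s * real (k i) powr (s - 1)" using c_pos by auto
      have "p (k i) = c * (real (k i) * ln (real (k i))) powr s / real (k i)"
        using p_eq[OF ki(1)] small[OF ki(2)] by (simp add: s_def)
      also have "\<dots> = c * ln (real (k i)) powr s * (real (k i) powr s / real (k i))"
        using ki by (simp add: powr_mult)
      also have "real (k i) powr s / real (k i) = real (k i) powr (s - 1)" using ki by (simp add: powr_diff)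
      also have "c * ln (real (k i)) powr s * real (k i) powr (s - 1) \<ge> c * ln (thr N) powr s * real (k i) powr (s - 1)"
        using ki tp t c_pos s by (intro mult_right_mono mult_left_mono powr_mono2) auto
      finally show "c * ln (thr N) powr s * real (k i) powr (s - 1) \<le> p (k i)" .
    qed
    also have "\<dots> = supp_prob k" unfolding supp_prob_def by (rule g(6)[symmetric])
    finally show "c ^ h * ln (thr N) * ?g k \<le> supp_prob k" .
  qed
  also have "\<dots> \<le> mean_count n"
    unfolding mean_count_def using fin sub supp_prob_nonneg by (intro sum_mono2) auto
  finally show ?thesis by (simp add: mult_ac)
qed

lemma eventually_scales:
  "\<forall>\<^sub>F N in sequentially. ell N \<ge> 1 \<and> N > 0 \<and> thr N \<ge> 1 \<and> thr N * real bsum \<le> real N"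
proof -
  have "\<forall>\<^sub>F N::nat in sequentially. ell N \<ge> 1" unfolding ell_def by real_asymp
  moreover have "\<forall>\<^sub>F N::nat in sequentially. N > 0" by (rule eventually_gt_at_top)
  moreover have "\<forall>\<^sub>F N::nat in sequentially. 1 \<le> real N / ln (2 * real N) ^ (h * (h + 1))" by real_asymp
  moreover have "\<forall>\<^sub>F N::nat in sequentially. K \<le> ln (2 * real N)" for K :: real by real_asymp
  note this[of "real bsum"]
  ultimately show ?thesis
  proof eventually_elim
    case (elim N)
    have "real bsum \<le> ell N ^ 1" using elim by (simp add: ell_def)
    also have "\<dots> \<le> ell N ^ (h * (h + 1))" using elim h2 by (intro power_increasing) auto
    finally have "thr N * real bsum \<le> thr N * ell N ^ (h * (h + 1))"
      using elim by (intro mult_left_mono) (auto simp: thr_def ell_def)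
    also have "\<dots> = real N" using elim by (simp add: thr_def)
    finally show ?case using elim by (auto simp: thr_def ell_def)
  qed
qed

lemma thr_at_top: "filterlim thr at_top sequentially"
proof -
  have "filterlim (\<lambda>N. real N / ln (2 * real N) ^ (h * (h + 1))) at_top sequentially" by real_asymp
  then show ?thesis by (simp add: thr_def[abs_def] ell_def)
qed

text \<open>A squeeze between the window bounds at \<open>N = n\<close>. As \<open>thr n\<close> is
  \<open>n\<close> divided by a power of a logarithm, the ratio of \<open>ln (thr n)\<close> to
  \<open>ln n\<close> tends to 1.\<close>

lemma mean_count_asymp: "(\<lambda>n. mean_count n / ln (real n)) \<longlonglongrightarrow> \<kappa>"
proof -
  have lim0: "(\<lambda>n. K / ell n) \<longlonglongrightarrow> 0" for K unfolding ell_def by real_asymp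
  have up: "\<forall>\<^sub>F n in sequentially. mean_count n / ln (real n) \<le>
      c ^ h * power_sum n + bad_const * (1 + c) ^ h / ell n / ln (real n)"
    using eventually_scales eventually_ge_at_top[of 2]
  proof eventually_elim
    case (elim n)
    have "mean_count n / ln (real n) \<le> (c ^ h * power_sum n * ln (real n) + bad_const * (1 + c) ^ h / ell n) / ln (real n)"
      using elim mean_count_le[of n n] by (intro divide_right_mono) auto
    also have "\<dots> = c ^ h * power_sum n + bad_const * (1 + c) ^ h / ell n / ln (real n)"
      using elim by (simp add: add_divide_distrib)
    finally show ?case .
  qed
  have "(\<lambda>n. K / ell n / ln (real n)) \<longlonglongrightarrow> 0" for K unfolding ell_def by real_asymp
  from tendsto_add[OF power_sum_tendsto this[of "bad_const * (1 + c) ^ h"]]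
  have uplim: "(\<lambda>n. c ^ h * power_sum n + bad_const * (1 + c) ^ h / ell n / ln (real n)) \<longlonglongrightarrow> \<kappa>" by simp
  have "(\<lambda>v. c * (real v * ln (real v)) powr s / real v) \<longlonglongrightarrow> 0" using s by real_asymp
  then have "\<forall>\<^sub>F v in sequentially. c * (real v * ln (real v)) powr s / real v < 1"
    by (rule order_tendstoD) simp
  then obtain V where V: "\<And>v. v \<ge> V \<Longrightarrow> c * (real v * ln (real v)) powr s / real v < 1"
    unfolding eventually_sequentially by auto
  have tV: "\<forall>\<^sub>F n in sequentially. thr n \<ge> real V"
    using thr_at_top by (simp add: filterlim_at_top)
  have lo: "\<forall>\<^sub>F n in sequentially. (c ^ h * power_sum n - c ^ h * (bad_const / ell n)) * (ln (thr n) / ln (real n)) \<le> mean_count n / ln (real n)"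
    using eventually_scales eventually_ge_at_top[of 2] tV
  proof eventually_elim
    case (elim n)
    have "c ^ h * (power_sum n - bad_const / ell n) * ln (thr n) \<le> mean_count n"
    proof (rule mean_count_ge)
      fix v :: nat assume "thr n \<le> real v"
      then have "V \<le> v" using elim by linarith
      then show "c * (real v * ln (real v)) powr s / real v \<le> 1" using V by (auto intro: less_imp_le)
    qed (use elim in auto)
    then have "c ^ h * (power_sum n - bad_const / ell n) * ln (thr n) / ln (real n) \<le> mean_count n / ln (real n)"
      using elim by (intro divide_right_mono) auto
    then show ?case by (simp only: right_diff_distrib times_divide_eq_right)
  qed
  have "(\<lambda>n. (ln (real n) - real (h * (h + 1)) * ln (ln (2 * real n))) / ln (real n)) \<longlonglongrightarrow> 1" by real_asymp
  then have "(\<lambda>n. ln (thr n) / ln (real n)) \<longlonglongrightarrow> 1"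
  proof (rule Lim_transform_eventually)
    show "\<forall>\<^sub>F n in sequentially. (ln (real n) - real (h * (h + 1)) * ln (ln (2 * real n))) / ln (real n) = ln (thr n) / ln (real n)"
      using eventually_scales
    proof eventually_elim
      case (elim n)
      then have "ln (thr n) = ln (real n) - ln (ell n ^ (h * (h + 1)))"
        unfolding thr_def by (subst ln_div) auto
      also have "ln (ell n ^ (h * (h + 1))) = real (h * (h + 1)) * ln (ell n)"
        by (rule ln_realpow)
      finally show ?case by (simp add: ell_def)
    qed
  qed
  from tendsto_mult[OF tendsto_diff[OF power_sum_tendsto tendsto_mult[OF tendsto_const[of "c ^ h"] lim0[of bad_const]]] this]
  have lolim: "(\<lambda>n. (c ^ h * power_sum n - c ^ h * (bad_const / ell n)) * (ln (thr n) / ln (real n))) \<longlonglongrightarrow> \<kappa>" by simp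
  show ?thesis by (rule real_tendsto_sandwich[OF lo up lolim uplim])
qed

section \<open>Probability that one number, or two numbers at once, have no representation\<close>

definition "fam n = nz_supp h ` sols b h n"

definition "good_fam N n = (\<lambda>k. k ` {..<h}) ` good_sols b h (thr N) n"

definition "zero_event n = avoids (fam n) (\<lambda>S. S)"

definition "set_prob S = (\<Prod>u\<in>S. p u)"

text \<open>A bound for the probability of any single support, obtained from its entry of size at
  least \<open>N / bsum\<close> alone.\<close>

definition "eta N = c * ell N * (real N / real bsum) powr (s - 1)" for N :: nat

definition "beta N = bad_const * (1 + c) ^ h / ell N" for N :: nat

definition "big_p N = c * ell N * thr N powr (s - 1)" for N :: nat

text \<open>The bound of \<open>overlap_sum_le\<close> for \<open>Y = 2 * N\<close>,
  \<open>q = big_p N\<close> and \<open>Z = Y * q\<close>, times 4 for the ordered pairs of two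
  numbers, including equal ones.\<close>

definition "delta N = 4 * (2 * real h * 2 ^ h * real h ^ h * ((2 * real N * big_p N) ^ (2 * h - 1) / (2 * real N)\<^sup>2))" for N :: nat

definition "admissible N \<longleftrightarrow> ell N \<ge> 1 \<and> N > 0 \<and> thr N \<ge> 1 \<and> thr N * real bsum \<le> real N
    \<and> eta N \<le> 1 / 2 \<and> 2 * real N * big_p N \<ge> 1"

lemma finite_fam: "finite (fam n)" "S \<in> fam n \<Longrightarrow> finite S"
  using finite_sols[OF bpos] by (auto simp: fam_def)

lemma finite_good_fam: "finite (good_fam N n)" "S \<in> good_fam N n \<Longrightarrow> finite S"
  using finite_subset[OF _ finite_sols[OF bpos, of n], of "good_sols b h (thr N) n"]
  by (auto simp: good_fam_def good_sols_def)

lemma set_prob_range: "0 \<le> set_prob S" "set_prob S \<le> 1"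
  unfolding set_prob_def by (rule prod_p_range)+

lemma zero_event_events [measurable]: "zero_event n \<in> events"
  unfolding zero_event_def using finite_fam by (intro avoids_events)

lemma zero_event_eq: "zero_event n = {\<omega>\<in>space M. r_count b (A \<omega>) h n = 0}"
  unfolding zero_event_def avoids_def fam_def using finite_sols[OF bpos]
  by (auto simp: r_count_eq)

lemma fam_prob_le:
  assumes N: "admissible N" "n \<ge> N" "n < 2 * N" and S: "S \<in> fam n"
  shows "set_prob S \<le> eta N"
proof -
  from S obtain k where k: "k \<in> sols b h n" "S = nz_supp h k" by (auto simp: fam_def)
  have n: "n > 0" "N > 0" "ell N \<ge> 1" using N by (auto simp: admissible_def)
  obtain i where i: "i < h" "k i > 0" "n \<le> bsum * k i" using sols_bigE[OF k(1) n(1)] .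
  have iS: "k i \<in> S" using i k by (auto simp: nz_supp_def)
  have "real N \<le> real (bsum * k i)" using N i by (intro of_nat_mono) simp
  then have big: "real N / real bsum \<le> real (k i)" using bsum_pos by (simp add: divide_le_eq mult.commute)
  have "set_prob S = p (k i) * (\<Prod>u\<in>S - {k i}. p u)"
    unfolding set_prob_def using iS k by (intro prod.remove) auto
  also have "\<dots> \<le> p (k i) * 1" using p_range prod_p_range by (intro mult_left_mono) auto
  also have "p (k i) \<le> c * ell N * real (k i) powr (s - 1)"
    by (rule p_le_ell) (use i n N sols_le(2)[OF bpos k(1) i(1)] in auto)
  also have "\<dots> \<le> eta N" unfolding eta_def
    using c_pos n s big bsum_pos by (intro mult_left_mono powr_mono2') auto
  finally show ?thesis by simp
qed

lemma sum_set_prob_image_le: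
  assumes "finite X"
  shows "(\<Sum>S\<in>nz_supp h ` X. set_prob S) \<le> (\<Sum>k\<in>X. supp_prob k)"
  using sum_image_le[OF assms, of set_prob "nz_supp h"] set_prob_range
  by (simp add: supp_prob_def set_prob_def o_def)

text \<open>The Harris product runs over supports, and 1 - x \<ge> exp (- x - 2 x^2) with x \<le>
  eta turns it into an exponential of the mean, up to the factor 1 + 2 eta, which tends to 1.
  Passing from tuples to supports only lowers the sum.\<close>

lemma zero_event_prob_ge:
  assumes N: "admissible N" "n \<ge> N" "n < 2 * N"
  shows "exp (- ((1 + 2 * eta N) * mean_count n)) \<le> prob (zero_event n)"
proof -
  have eta: "eta N \<le> 1 / 2" "eta N \<ge> 0" using N c_pos by (auto simp: admissible_def eta_def)
  have "(\<Sum>S\<in>fam n. set_prob S) \<le> mean_count n"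
    unfolding fam_def mean_count_def by (rule sum_set_prob_image_le[OF finite_sols[OF bpos]])
  then have "(1 + 2 * eta N) * (\<Sum>S\<in>fam n. set_prob S) \<le> (1 + 2 * eta N) * mean_count n"
    using eta by (intro mult_left_mono) auto
  then have "exp (- ((1 + 2 * eta N) * mean_count n)) \<le> exp (- ((1 + 2 * eta N) * (\<Sum>S\<in>fam n. set_prob S)))"
    by simp
  also have "\<dots> = (\<Prod>S\<in>fam n. exp (- ((1 + 2 * eta N) * set_prob S)))"
    by (simp add: exp_sum finite_fam sum_distrib_left flip: sum_negf)
  also have "\<dots> \<le> (\<Prod>S\<in>fam n. 1 - set_prob S)"
  proof (intro prod_mono conjI)
    fix S assume "S \<in> fam n"
    then have le: "set_prob S \<le> eta N" using fam_prob_le[OF N] by simp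
    then have "set_prob S * set_prob S \<le> eta N * set_prob S" using set_prob_range by (intro mult_right_mono) auto
    then have "exp (- ((1 + 2 * eta N) * set_prob S)) \<le> exp (- set_prob S - 2 * (set_prob S)\<^sup>2)"
      by (simp add: power2_eq_square algebra_simps)
    also have "\<dots> \<le> 1 - set_prob S" using le eta set_prob_range by (intro exp_le_one_minus) auto
    finally show "exp (- ((1 + 2 * eta N) * set_prob S)) \<le> 1 - set_prob S" .
  qed auto
  also have "\<dots> \<le> prob (zero_event n)"
    unfolding zero_event_def set_prob_def using finite_fam by (intro prob_avoids_ge) auto
  finally show ?thesis .
qed

lemma good_fam_subset:
  assumes "thr N > 0"
  shows "good_fam N n \<subseteq> fam n"
proof
  fix S assume "S \<in> good_fam N n"
  then obtain k where k: "k \<in> good_sols b h (thr N) n" "S = k ` {..<h}" by (auto simp: good_fam_def)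
  then show "S \<in> fam n"
    unfolding fam_def using good_solsD(1,3)[OF k(1) assms] by (intro image_eqI[of _ _ k]) auto
qed

text \<open>Converts the product that Janson's inequality leaves into a probability. By Harris the
  product over all supports is at most \<open>prob (zero_event n)\<close>, and the supports outside
  \<open>good_fam\<close> have total probability at most beta, so their factors cost at most exp (2
  beta).\<close>

lemma good_fam_prod_le:
  assumes N: "admissible N" "n \<ge> N" "n < 2 * N"
  shows "(\<Prod>S\<in>good_fam N n. 1 - set_prob S) \<le> exp (2 * beta N) * prob (zero_event n)"
proof -
  have c: "ell N \<ge> 1" "N > 0" "thr N \<ge> 1" "thr N * real bsum \<le> real N" "thr N > 0" and eta: "eta N \<le> 1 / 2"
    using N by (auto simp: admissible_def)
  have sub: "good_fam N n \<subseteq> fam n" using good_fam_subset[OF c(5)] .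
  let ?B = "sols b h n - good_sols b h (thr N) n"
  have sub2: "fam n - good_fam N n \<subseteq> nz_supp h ` ?B"
    using good_solsD(3)[OF _ c(5)] unfolding fam_def good_fam_def by force
  have "(\<Sum>S\<in>fam n - good_fam N n. set_prob S) \<le> (\<Sum>S\<in>nz_supp h ` ?B. set_prob S)"
    using sub2 finite_sols[OF bpos] set_prob_range by (intro sum_mono2) auto
  also have "\<dots> \<le> (\<Sum>k\<in>?B. supp_prob k)"
    using finite_sols[OF bpos] by (intro sum_set_prob_image_le) auto
  also have "\<dots> \<le> beta N" unfolding beta_def by (rule bad_sum_le(1)) (use c N in auto)
  finally have "exp (- (2 * beta N)) \<le> exp (- (2 * (\<Sum>S\<in>fam n - good_fam N n. set_prob S)))" by simp
  also have "\<dots> = (\<Prod>S\<in>fam n - good_fam N n. exp (- (2 * set_prob S)))"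
    by (simp add: exp_sum finite_fam sum_distrib_left flip: sum_negf)
  also have "\<dots> \<le> (\<Prod>S\<in>fam n - good_fam N n. 1 - set_prob S)"
  proof (intro prod_mono conjI)
    fix S assume "S \<in> fam n - good_fam N n"
    then have le: "set_prob S \<le> 1 / 2" using fam_prob_le[OF N, of S] eta by simp
    then have "set_prob S * set_prob S \<le> 1 / 2 * set_prob S" using set_prob_range by (intro mult_right_mono) auto
    then have "exp (- (2 * set_prob S)) \<le> exp (- set_prob S - 2 * (set_prob S)\<^sup>2)"
      by (simp add: power2_eq_square)
    also have "\<dots> \<le> 1 - set_prob S" using le set_prob_range by (intro exp_le_one_minus) auto
    finally show "exp (- (2 * set_prob S)) \<le> 1 - set_prob S" .
  qed auto
  finally have B: "exp (- (2 * beta N)) \<le> (\<Prod>S\<in>fam n - good_fam N n. 1 - set_prob S)" .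
  have G0: "0 \<le> (\<Prod>S\<in>good_fam N n. 1 - set_prob S)" using set_prob_range by (intro prod_nonneg) auto
  have "exp (- (2 * beta N)) * (\<Prod>S\<in>good_fam N n. 1 - set_prob S)
      \<le> (\<Prod>S\<in>fam n - good_fam N n. 1 - set_prob S) * (\<Prod>S\<in>good_fam N n. 1 - set_prob S)"
    by (rule mult_right_mono[OF B G0])
  also have "\<dots> = (\<Prod>S\<in>fam n. 1 - set_prob S)"
    by (rule prod.subset_diff[OF sub finite_fam(1), symmetric])
  also have "\<dots> \<le> prob (zero_event n)"
    unfolding zero_event_def set_prob_def using finite_fam by (intro prob_avoids_ge) auto
  finally show ?thesis by (simp add: exp_minus field_simps)
qed

lemma good_p_le:
  assumes N: "admissible N" "n < 2 * N" and k: "k \<in> good_sols b h (thr N) n" and u: "u \<in> k ` {..<h}"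
  shows "p u \<le> big_p N"
proof -
  have c: "ell N \<ge> 1" "thr N > 0" using N by (auto simp: admissible_def)
  note g = good_solsD[OF k c(2)]
  from u obtain i where i: "i < h" "u = k i" by auto
  have "p u \<le> c * ell N * real u powr (s - 1)"
    unfolding i by (rule p_le_ell) (use i g(5) sols_le(2)[OF bpos g(1) i(1)] N c in auto)
  also have "\<dots> \<le> big_p N"
    unfolding big_p_def i using c c_pos s g(4)[OF i(1)] by (intro mult_left_mono powr_mono2') auto
  finally show ?thesis .
qed

text \<open>The pairs are ordered, and their members carry their number, so a support common to two
  different numbers forms an overlap with itself.\<close>

definition "overlaps N I = {(i, j). i \<in> Sigma I (good_fam N) \<and> j \<in> Sigma I (good_fam N) \<and> j \<noteq> i \<and> snd j \<inter> snd i \<noteq> {}}"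

text \<open>Every overlapping pair of supports comes from at least one pair of good tuples, so the
  sum over sets is bounded by four sums over tuples as in \<open>overlap_sum_le\<close>.\<close>

lemma overlaps_sum_le:
  assumes N: "admissible N" and I: "I = {n, m}" "n \<noteq> m" "n < 2 * N" "m < 2 * N"
  shows "(\<Sum>(i, j)\<in>overlaps N I. set_prob (snd j \<union> snd i)) \<le> delta N"
proof -
  define q where "q = big_p N"
  have q: "q \<ge> 0" unfolding q_def big_p_def using c_pos N by (auto simp: admissible_def)
  define R where "R x y = {(k, k') \<in> good_sols b h (thr N) x \<times> good_sols b h (thr N) y.
     k ` {..<h} \<inter> k' ` {..<h} \<noteq> {} \<and> (x \<noteq> y \<or> k ` {..<h} \<noteq> k' ` {..<h})}" for x y
  have fin: "finite (good_sols b h (thr N) x)" for x using finite_sols[OF bpos] by (simp add: good_sols_def)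
  have finR: "finite (R x y)" for x y
    by (rule finite_subset[of _ "good_sols b h (thr N) x \<times> good_sols b h (thr N) y"]) (use fin in \<open>auto simp: R_def\<close>)
  have finO: "finite (overlaps N I)"
    by (rule finite_subset[of _ "Sigma I (good_fam N) \<times> Sigma I (good_fam N)"])
      (use I finite_good_fam in \<open>auto simp: overlaps_def\<close>)
  define supports where "supports = (\<lambda>((x :: nat, y :: nat), (k :: nat \<Rightarrow> nat, k' :: nat \<Rightarrow> nat)). ((x, k ` {..<h}), (y, k' ` {..<h})))"
  define weight where "weight = (\<lambda>((x :: nat, y :: nat), (k :: nat \<Rightarrow> nat, k' :: nat \<Rightarrow> nat)). q ^ card (k ` {..<h} \<union> k' ` {..<h}))"
  have finS: "finite (Sigma (I \<times> I) (\<lambda>(x, y). R x y))" using I finR by auto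
  have pairs: "\<forall>z\<in>overlaps N I. \<exists>w\<in>Sigma (I \<times> I) (\<lambda>(x, y). R x y).
        supports w = z \<and>
        (case z of (i, j) \<Rightarrow> set_prob (snd j \<union> snd i)) \<le> weight w"
  proof
    fix z assume z: "z \<in> overlaps N I"
    then obtain x S y T where zz: "z = ((x, S), (y, T))" "x \<in> I" "y \<in> I" "S \<in> good_fam N x" "T \<in> good_fam N y"
      by (auto simp: overlaps_def)
    then obtain k k' where kk: "k \<in> good_sols b h (thr N) x" "S = k ` {..<h}"
      "k' \<in> good_sols b h (thr N) y" "T = k' ` {..<h}"
      by (auto simp: good_fam_def)
    note w = zz(1)[unfolded kk] zz(2,3) kk(1,3)
    have R: "(k, k') \<in> R x y" using z w by (auto simp: overlaps_def R_def)
    have xy: "x < 2 * N" "y < 2 * N" using w I by auto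
    have "set_prob (k' ` {..<h} \<union> k ` {..<h}) \<le> (\<Prod>u\<in>k' ` {..<h} \<union> k ` {..<h}. q)"
      unfolding set_prob_def q_def using good_p_le[OF N] w xy p_range by (intro prod_mono) auto
    also have "\<dots> = q ^ card (k ` {..<h} \<union> k' ` {..<h})" by (simp add: Un_commute)
    finally have "set_prob (k' ` {..<h} \<union> k ` {..<h}) \<le> q ^ card (k ` {..<h} \<union> k' ` {..<h})" .
    then show "\<exists>w\<in>Sigma (I \<times> I) (\<lambda>(x, y). R x y).
      supports w = z \<and>
      (case z of (i, j) \<Rightarrow> set_prob (snd j \<union> snd i)) \<le> weight w"
      using w R by (intro bexI[of _ "((x, y), (k, k'))"]) (auto simp: supports_def weight_def)
  qed
  have "(\<Sum>(i, j)\<in>overlaps N I. set_prob (snd j \<union> snd i))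
     \<le> (\<Sum>((x, y), (k, k'))\<in>Sigma (I \<times> I) (\<lambda>(x, y). R x y). q ^ card (k ` {..<h} \<union> k' ` {..<h}))"
    unfolding weight_def[symmetric] by (rule sum_le_included[OF finO finS _ pairs]) (use q in \<open>auto simp: weight_def\<close>)
  also have "\<dots> = (\<Sum>(x, y)\<in>I \<times> I. \<Sum>(k, k')\<in>R x y. q ^ card (k ` {..<h} \<union> k' ` {..<h}))"
  proof -
    have "finite (I \<times> I)" using I by auto
    moreover have "\<forall>z\<in>I \<times> I. finite (case z of (x, y) \<Rightarrow> R x y)" using finR by auto
    ultimately show ?thesis
      using sum.Sigma[of "I \<times> I" "\<lambda>(x, y). R x y" "\<lambda>z (k, k'). q ^ card (k ` {..<h} \<union> k' ` {..<h})"]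
      by (simp add: case_prod_unfold)
  qed
  also have "\<dots> \<le> (\<Sum>(x, y)\<in>I \<times> I. 2 * real h * 2 ^ h * real h ^ h * ((2 * real N * q) ^ (2 * h - 1) / (real (2 * N))\<^sup>2))"
  proof (rule sum_mono)
    fix z assume "z \<in> I \<times> I"
    then obtain x y where z: "z = (x, y)" "x \<in> I" "y \<in> I" by auto
    have "(\<Sum>(k, k')\<in>R x y. q ^ card (k ` {..<h} \<union> k' ` {..<h}))
        \<le> 2 * real h * 2 ^ h * real h ^ h * ((2 * real N * q) ^ (2 * h - 1) / (real (2 * N))\<^sup>2)"
      unfolding R_def by (rule overlap_sum_le) (use z I q N in \<open>auto simp: admissible_def q_def\<close>)
    then show "(case z of (x, y) \<Rightarrow> \<Sum>(k, k')\<in>R x y. q ^ card (k ` {..<h} \<union> k' ` {..<h})) \<le>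
       (case z of (x, y) \<Rightarrow> 2 * real h * 2 ^ h * real h ^ h * ((2 * real N * q) ^ (2 * h - 1) / (real (2 * N))\<^sup>2))"
      using z by simp
  qed
  also have "\<dots> = delta N"
    using I by (simp add: delta_def q_def card_cartesian_product)
  finally show ?thesis .
qed

text \<open>If neither number is represented, no good support of either is contained in the random
  set. Janson for the joint family yields a product that splits into a part for \<open>n\<close> and
  one for \<open>m\<close>, and \<open>good_fam_prod_le\<close> turns each part into a probability.
  The interaction is confined to \<open>delta N\<close>.\<close>

lemma pair_prob_le:
  assumes N: "admissible N" and n: "n \<in> {N..<2 * N}" and m: "m \<in> {N..<2 * N}" and nm: "n \<noteq> m"
  shows "prob (zero_event n \<inter> zero_event m) \<le> exp (4 * beta N + 2 * delta N) * (prob (zero_event n) * prob (zero_event m))"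
proof -
  have tp: "thr N > 0" and eta: "eta N \<le> 1 / 2" using N by (auto simp: admissible_def)
  define I where "I = Sigma {n, m} (good_fam N)"
  have fI: "finite I" "\<And>i. i \<in> I \<Longrightarrow> finite (snd i)" using finite_good_fam by (auto simp: I_def)
  define D where "D i = (\<Sum>j | j \<in> I \<and> j \<noteq> i \<and> snd j \<inter> snd i \<noteq> {}. set_prob (snd j \<union> snd i))" for i
  have D0: "D i \<ge> 0" for i unfolding D_def using set_prob_range by (intro sum_nonneg) auto
  have half: "set_prob (snd i) \<le> 1 / 2" if "i \<in> I" for i
  proof -
    have "snd i \<in> fam (fst i)" "fst i \<in> {n, m}" using that subsetD[OF good_fam_subset[OF tp]] by (auto simp: I_def)
    then show ?thesis using fam_prob_le[OF N, of "fst i" "snd i"] n m eta by auto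
  qed
  have "prob (zero_event n \<inter> zero_event m) \<le> prob (avoids I snd)"
  proof (rule finite_measure_mono)
    show "zero_event n \<inter> zero_event m \<subseteq> avoids I snd"
      using good_fam_subset[OF tp] by (auto simp: zero_event_def avoids_def I_def)
  qed (use fI in \<open>auto intro: avoids_events\<close>)
  also have "\<dots> \<le> (\<Prod>i\<in>I. 1 - set_prob (snd i) + D i)"
    unfolding D_def set_prob_def by (rule Janson_prob_avoids_le[OF fI]) auto
  also have "\<dots> \<le> (\<Prod>i\<in>I. (1 - set_prob (snd i)) * exp (2 * D i))"
  proof (intro prod_mono conjI)
    fix i assume i: "i \<in> I"
    show "0 \<le> 1 - set_prob (snd i) + D i" using D0[of i] set_prob_range[of "snd i"] by simp
    \<comment> \<open>Since a single support has probability at most 1/2, the added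
      \<open>D i\<close> can be written as a factor 1 + 2 D i, which separates it from the main
      product.\<close>
    have "1 / 2 * (2 * D i) \<le> (1 - set_prob (snd i)) * (2 * D i)"
      using half[OF i] D0 by (intro mult_right_mono) auto
    then have "1 - set_prob (snd i) + D i \<le> (1 - set_prob (snd i)) * (1 + 2 * D i)"
      by (simp add: algebra_simps)
    also have "\<dots> \<le> (1 - set_prob (snd i)) * exp (2 * D i)"
      using set_prob_range by (intro mult_left_mono exp_ge_add_one_self) auto
    finally show "1 - set_prob (snd i) + D i \<le> (1 - set_prob (snd i)) * exp (2 * D i)" .
  qed
  also have "\<dots> = (\<Prod>i\<in>I. 1 - set_prob (snd i)) * exp (2 * (\<Sum>i\<in>I. D i))"
    by (simp add: prod.distrib exp_sum fI sum_distrib_left)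
  also have "(\<Prod>i\<in>I. 1 - set_prob (snd i)) = (\<Prod>x\<in>{n, m}. \<Prod>S\<in>good_fam N x. 1 - set_prob S)"
    unfolding I_def using finite_good_fam by (subst prod.Sigma) (auto simp: case_prod_unfold)
  also have "\<dots> = (\<Prod>S\<in>good_fam N n. 1 - set_prob S) * (\<Prod>S\<in>good_fam N m. 1 - set_prob S)"
    using nm by simp
  also have "(\<Sum>i\<in>I. D i) = (\<Sum>(i, j)\<in>overlaps N {n, m}. set_prob (snd j \<union> snd i))"
  proof -
    have "(\<Sum>i\<in>I. D i) = (\<Sum>(i, j)\<in>Sigma I (\<lambda>i. {j. j \<in> I \<and> j \<noteq> i \<and> snd j \<inter> snd i \<noteq> {}}). set_prob (snd j \<union> snd i))"
      unfolding D_def using fI by (subst sum.Sigma) auto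
    also have "Sigma I (\<lambda>i. {j. j \<in> I \<and> j \<noteq> i \<and> snd j \<inter> snd i \<noteq> {}}) = overlaps N {n, m}"
      by (auto simp: overlaps_def I_def)
    finally show ?thesis .
  qed
  also have "(\<Prod>S\<in>good_fam N n. 1 - set_prob S) * (\<Prod>S\<in>good_fam N m. 1 - set_prob S) *
      exp (2 * (\<Sum>(i, j)\<in>overlaps N {n, m}. set_prob (snd j \<union> snd i)))
     \<le> (exp (2 * beta N) * prob (zero_event n)) * (exp (2 * beta N) * prob (zero_event m)) * exp (2 * delta N)"
  proof (intro mult_mono good_fam_prod_le N)
    show "exp (2 * (\<Sum>(i, j)\<in>overlaps N {n, m}. set_prob (snd j \<union> snd i))) \<le> exp (2 * delta N)"
      using overlaps_sum_le[OF N refl nm] n m by simp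
  qed (use n m set_prob_range in \<open>auto intro!: prod_nonneg mult_nonneg_nonneg\<close>)
  also have "\<dots> = exp (4 * beta N + 2 * delta N) * (prob (zero_event n) * prob (zero_event m))"
  proof -
    have "4 * beta N + 2 * delta N = 2 * beta N + 2 * beta N + 2 * delta N" by simp
    then show ?thesis by (simp only: exp_add mult_ac)
  qed
  finally show ?thesis .
qed

section \<open>Limits of the error terms\<close>

lemma beta_tendsto: "beta \<longlonglongrightarrow> 0"
proof -
  have "(\<lambda>N. K / ell N) \<longlonglongrightarrow> 0" for K unfolding ell_def by real_asymp
  then show ?thesis by (simp add: beta_def[abs_def])
qed

lemma eta_tendsto: "eta \<longlonglongrightarrow> 0"
proof -
  have "(\<lambda>N::nat. c * ln (2 * real N) * (real N / B) powr (s - 1)) \<longlonglongrightarrow> 0" if "B > 0" for B :: real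
    using s that by real_asymp
  from this[of "real bsum"] show ?thesis using bsum_pos by (simp add: eta_def[abs_def] ell_def)
qed

lemma big_p_eq:
  assumes "N > 0" "ell N > 0"
  shows "2 * real N * big_p N = 2 * c * ell N * (ell N ^ (h * (h + 1))) powr (1 - s) * real N powr s"
proof -
  have "thr N powr (s - 1) = real N powr (s - 1) / (ell N ^ (h * (h + 1))) powr (s - 1)"
    unfolding thr_def by (rule powr_divide)
  also have "\<dots> = real N powr (s - 1) * (ell N ^ (h * (h + 1))) powr (1 - s)"
    by (simp add: divide_inverse flip: powr_minus)
  finally have *: "thr N powr (s - 1) = real N powr (s - 1) * (ell N ^ (h * (h + 1))) powr (1 - s)" .
  have "real N * real N powr (s - 1) = real N powr s" using assms by (simp add: powr_diff)
  then show ?thesis unfolding big_p_def * by (simp only: mult_ac) (simp add: mult_ac)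
qed

text \<open>\<open>2 * N * big_p N\<close> is N^(1/h) up to logarithms, so delta has exponent (2h -
  1)/h - 2 = -1/h, which absorbs every power of the logarithm.\<close>

lemma delta_tendsto: "delta \<longlonglongrightarrow> 0"
proof -
  define C where "C = 4 * (2 * real h * 2 ^ h * real h ^ h / 4)"
  have "(\<lambda>N. C * ((2 * c * ln (2 * real N) * (ln (2 * real N) ^ m) powr (1 - s)) ^ l * real N powr (- s))) \<longlonglongrightarrow> 0"
    for m l :: nat using s c_pos by real_asymp
  from this[of "h * (h + 1)" "2 * h - 1"] show ?thesis
  proof (rule Lim_transform_eventually)
    show "\<forall>\<^sub>F N in sequentially. C * ((2 * c * ln (2 * real N) * (ln (2 * real N) ^ (h * (h + 1))) powr (1 - s)) ^ (2 * h - 1) * real N powr (- s)) = delta N"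
      using eventually_scales
    proof eventually_elim
      case (elim N)
      have e: "s * real (2 * h - 1) - 2 = - s" using h2 s_h by (simp add: of_nat_diff algebra_simps)
      have "(real N powr s) ^ (2 * h - 1) = real N powr (s * real (2 * h - 1))"
        using elim by (simp add: powr_powr flip: powr_realpow)
      moreover have "(real N)\<^sup>2 = real N powr 2" using elim by simp
      moreover have "real N powr (s * real (2 * h - 1)) / real N powr 2 = real N powr (- s)"
        by (simp only: e flip: powr_diff)
      ultimately have *: "(real N powr s) ^ (2 * h - 1) / (real N)\<^sup>2 = real N powr (- s)" by simp
      define X where "X = 2 * c * ell N * (ell N ^ (h * (h + 1))) powr (1 - s)"
      have "delta N = C * ((X * real N powr s) ^ (2 * h - 1) / (real N)\<^sup>2)"
        unfolding delta_def C_def X_def using elim by (subst big_p_eq) (auto simp: power_mult_distrib)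
      also have "(X * real N powr s) ^ (2 * h - 1) / (real N)\<^sup>2 = X ^ (2 * h - 1) * ((real N powr s) ^ (2 * h - 1) / (real N)\<^sup>2)"
        by (simp add: power_mult_distrib)
      finally show ?case unfolding * by (simp add: X_def ell_def)
    qed
  qed
qed

lemma eventually_admissible: "\<forall>\<^sub>F N in sequentially. admissible N"
proof -
  have "\<forall>\<^sub>F N in sequentially. eta N < 1 / 2" using eta_tendsto by (rule order_tendstoD) simp
  moreover have "\<forall>\<^sub>F N::nat in sequentially. 1 \<le> 2 * c * ln (2 * real N) * (ln (2 * real N) ^ m) powr (1 - s) * real N powr s" for m
    using s c_pos by real_asymp
  note this[of "h * (h + 1)"]
  ultimately show ?thesis using eventually_scales
  proof eventually_elim
    case (elim N)
    have "2 * real N * big_p N = 2 * c * ell N * (ell N ^ (h * (h + 1))) powr (1 - s) * real N powr s"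
      using elim by (intro big_p_eq) auto
    then show ?case using elim by (simp add: admissible_def ell_def)
  qed
qed

section \<open>Second moment of the number of missed integers in a dyadic window\<close>

definition "window_mean N = (\<Sum>n\<in>{N..<2 * N}. prob (zero_event n))"

lemma window_mean_at_top: "filterlim window_mean at_top sequentially"
proof -
  \<comment> \<open>Two numbers strictly between \<kappa> and 1: the first absorbs the error in the
    mean, the second the factor 1 + 2 eta. What remains is a window sum of order N^(1 -
    \<kappa>2).\<close>
  define \<kappa>1 where "\<kappa>1 = (1 + 2 * \<kappa>) / 3"
  define \<kappa>2 where "\<kappa>2 = (1 + \<kappa>1) / 2"
  have k: "\<kappa> < \<kappa>1" "\<kappa>1 < \<kappa>2" "\<kappa>2 < 1" "\<kappa>1 > 0" unfolding \<kappa>1_def \<kappa>2_def using \<kappa> by (auto simp: field_simps)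
  have "\<forall>\<^sub>F n in sequentially. mean_count n / ln (real n) < \<kappa>1"
    using mean_count_asymp k(1) by (rule order_tendstoD)
  then obtain n0 where n0: "\<And>n. n \<ge> n0 \<Longrightarrow> mean_count n / ln (real n) < \<kappa>1"
    unfolding eventually_sequentially by auto
  have "(\<lambda>N. (1 + 2 * eta N) * \<kappa>1) \<longlonglongrightarrow> (1 + 2 * 0) * \<kappa>1"
    by (intro tendsto_intros eta_tendsto)
  then have "\<forall>\<^sub>F N in sequentially. (1 + 2 * eta N) * \<kappa>1 < \<kappa>2"
    by (rule order_tendstoD) (use k in auto)
  then have "\<forall>\<^sub>F N in sequentially. real N * (2 * real N) powr (- \<kappa>2) \<le> window_mean N"
    using eventually_admissible eventually_ge_at_top[of n0] eventually_ge_at_top[of 2]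
  proof eventually_elim
    case (elim N)
    have eta0: "eta N \<ge> 0" using elim c_pos by (auto simp: admissible_def eta_def)
    have "(\<Sum>n\<in>{N..<2 * N}. (2 * real N) powr (- \<kappa>2)) \<le> window_mean N"
      unfolding window_mean_def
    proof (rule sum_mono)
      fix n assume n: "n \<in> {N..<2 * N}"
      then have l: "ln (real n) > 0" "n \<ge> n0" using elim by auto
      have "mean_count n \<le> \<kappa>1 * ln (real n)" using n0[OF l(2)] l by (simp add: divide_less_eq)
      then have "(1 + 2 * eta N) * mean_count n \<le> (1 + 2 * eta N) * (\<kappa>1 * ln (real n))"
        using eta0 by (intro mult_left_mono) auto
      also have "\<dots> = ((1 + 2 * eta N) * \<kappa>1) * ln (real n)" by simp
      also have "\<dots> \<le> \<kappa>2 * ln (real n)" using elim l by (intro mult_right_mono) auto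
      also have "\<dots> \<le> \<kappa>2 * ln (2 * real N)" using n l k elim by (intro mult_left_mono) auto
      finally have "exp (- (\<kappa>2 * ln (2 * real N))) \<le> exp (- ((1 + 2 * eta N) * mean_count n))" by simp
      moreover have "(2 * real N) powr (- \<kappa>2) = exp (- (\<kappa>2 * ln (2 * real N)))"
        using elim by (simp add: powr_def)
      moreover have "exp (- ((1 + 2 * eta N) * mean_count n)) \<le> prob (zero_event n)"
        by (rule zero_event_prob_ge) (use elim n in auto)
      ultimately show "(2 * real N) powr (- \<kappa>2) \<le> prob (zero_event n)" by linarith
    qed
    then show ?case by simp
  qed
  moreover have "filterlim (\<lambda>N::nat. real N * (2 * real N) powr (- \<kappa>2)) at_top sequentially"
    using k by real_asymp
  ultimately show ?thesis by (rule filterlim_at_top_mono[rotated])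
qed

lemma window_none_tendsto:
  "(\<lambda>N. prob {\<omega>\<in>space M. \<forall>n\<in>{N..<2 * N}. \<omega> \<notin> zero_event n}) \<longlonglongrightarrow> 0"
proof -
  have up: "\<forall>\<^sub>F N in sequentially. prob {\<omega>\<in>space M. \<forall>n\<in>{N..<2 * N}. \<omega> \<notin> zero_event n}
      \<le> 1 / window_mean N + exp (4 * beta N + 2 * delta N) - 1"
    using eventually_admissible window_mean_at_top[THEN filterlim_at_top_dense[THEN iffD1], rule_format, of 0]
  proof eventually_elim
    case (elim N)
    show ?case
      by (rule second_moment_none) (use elim pair_prob_le in \<open>auto simp: window_mean_def\<close>)
  qed
  have "(\<lambda>N. 1 / window_mean N + exp (4 * beta N + 2 * delta N) - 1) \<longlonglongrightarrow> 0 + exp (4 * 0 + 2 * 0) - 1"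
    by (intro tendsto_intros beta_tendsto delta_tendsto real_tendsto_divide_at_top[OF tendsto_const] window_mean_at_top)
  then have lim: "(\<lambda>N. 1 / window_mean N + exp (4 * beta N + 2 * delta N) - 1) \<longlonglongrightarrow> 0" by simp
  have lo: "\<forall>\<^sub>F N in sequentially. 0 \<le> prob {\<omega>\<in>space M. \<forall>n\<in>{N..<2 * N}. \<omega> \<notin> zero_event n}"
    by (intro always_eventually allI measure_nonneg)
  show ?thesis by (rule real_tendsto_sandwich[OF lo up tendsto_const lim])
qed

text \<open>No independence between windows is used. If no number from \<open>N0\<close> on is
  missed, then every later window has no missed number; the probabilities of the latter tend to 0,
  so the former event is null, and countably many \<open>N0\<close> suffice.\<close>

lemma prob_infinitely_many_zeros: "prob {\<omega>\<in>space M. infinite {n. r_count b (A \<omega>) h n = 0}} = 1"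
proof -
  define G where "G N = {\<omega>\<in>space M. \<forall>n\<ge>N. \<omega> \<notin> zero_event n}" for N
  have Gm [measurable]: "G N \<in> events" for N unfolding G_def by measurable
  have G0: "prob (G N0) = 0" for N0
  proof -
    have "\<forall>\<^sub>F N in sequentially. prob (G N0) \<le> prob {\<omega>\<in>space M. \<forall>n\<in>{N..<2 * N}. \<omega> \<notin> zero_event n}"
      using eventually_ge_at_top[of N0]
    proof eventually_elim
      case (elim N)
      show ?case
      proof (rule finite_measure_mono)
        show "G N0 \<subseteq> {\<omega>\<in>space M. \<forall>n\<in>{N..<2 * N}. \<omega> \<notin> zero_event n}" using elim by (auto simp: G_def)
        show "{\<omega>\<in>space M. \<forall>n\<in>{N..<2 * N}. \<omega> \<notin> zero_event n} \<in> events" by measurable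
      qed
    qed
    then have "prob (G N0) \<le> 0"
      by (intro tendsto_lowerbound[OF window_none_tendsto]) auto
    then show ?thesis by (simp add: measure_le_0_iff)
  qed
  have eq: "{\<omega>\<in>space M. infinite {n. r_count b (A \<omega>) h n = 0}} = space M - (\<Union>N. G N)"
  proof -
    have "infinite {n. r_count b (A \<omega>) h n = 0} \<longleftrightarrow> (\<forall>N. \<exists>n\<ge>N. \<omega> \<in> zero_event n)" if "\<omega> \<in> space M" for \<omega>
      using that by (auto simp: infinite_nat_iff_unbounded_le zero_event_eq)
    then have "{\<omega>\<in>space M. infinite {n. r_count b (A \<omega>) h n = 0}} = {\<omega>\<in>space M. \<forall>N. \<exists>n\<ge>N. \<omega> \<in> zero_event n}"
      by blast
    also have "\<dots> = space M - (\<Union>N. G N)" by (auto simp: G_def)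
    finally show ?thesis .
  qed
  have "(\<Union>N. G N) \<in> null_sets M"
    using G0 Gm by (intro null_sets_UN) (auto simp: null_sets_def emeasure_eq_measure)
  then have "prob (\<Union>N. G N) = 0" by (simp add: measure_eq_0_null_sets)
  moreover have "prob (space M - (\<Union>N. G N)) = 1 - prob (\<Union>N. G N)"
    by (rule prob_compl) measurable
  ultimately show ?thesis unfolding eq by simp
qed

end

theorem theorem5:
  fixes h :: nat and b :: "nat \<Rightarrow> nat" and \<epsilon> c :: real
    and M :: "'a measure" and A :: "'a \<Rightarrow> nat set"
  assumes h2: "h \<ge> 2"
    and bpos: "\<forall>i<h. b i > 0"
    and bgcd: "Gcd (b ` {..<h}) = 1"
    and eps: "0 < \<epsilon>" "\<epsilon> < 1/2"
    and c_def: "c = (1 - \<epsilon>) powr (1 / real h)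
                    * (real (\<Prod>i<h. b i)) powr (1 / (real h)^2) / Gamma (1 / real h)"
    and M: "prob_space M"
    and zero_in: "\<forall>\<omega>\<in>space M. 0 \<in> A \<omega>"
    and meas: "\<forall>n. {\<omega>\<in>space M. n \<in> A \<omega>} \<in> sets M"
    and indep: "prob_space.indep_events M (\<lambda>n. {\<omega>\<in>space M. n \<in> A \<omega>}) {1..}"
    and probs: "\<forall>n\<ge>1. measure M {\<omega>\<in>space M. n \<in> A \<omega>}
                   = min (c * (real n * ln (real n)) powr (1 / real h) / real n) 1"
  shows "((\<lambda>n. integral\<^sup>L M (\<lambda>\<omega>. real (r_count b (A \<omega>) h n)))
           \<sim>[at_top] (\<lambda>n. (1 - \<epsilon>) * ln (real n)))
         \<and> measure M {\<omega>\<in>space M. infinite {n. r_count b (A \<omega>) h n = 0}} = 1"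
proof -
  interpret prob_space M by (rule M)
  define p where "p n = prob {\<omega>\<in>space M. n \<in> A \<omega>}" for n
  have G: "Gamma (1 / real h) > 0" using h2 by (intro Gamma_real_pos) auto
  have B: "real (\<Prod>i<h. b i) > 0" using bpos by (auto intro!: prod_pos)
  \<comment> \<open>The independence hypothesis speaks of nonempty sets of positive indices. So 0 is
    removed and restored with \<open>p 0 = 1\<close>, and sets without positive elements are treated
    apart.\<close>
  have prob_subset: "prob {\<omega>\<in>space M. U \<subseteq> A \<omega>} = (\<Prod>u\<in>U. p u)" if U: "finite U" for U
  proof (cases "U - {0} = {}")
    case True
    then have "U = {} \<or> U = {0}" by auto
    then show ?thesis
    proof
      assume "U = {}"
      then show ?thesis by (simp add: prob_space)
    next
      assume "U = {0}"
      then show ?thesis by (simp add: p_def)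
    qed
  next
    case False
    have p0: "p 0 = 1"
    proof -
      have "{\<omega>\<in>space M. 0 \<in> A \<omega>} = space M" using zero_in by auto
      then show ?thesis by (simp add: p_def prob_space)
    qed
    have "{\<omega>\<in>space M. U \<subseteq> A \<omega>} = (\<Inter>u\<in>U - {0}. {\<omega>\<in>space M. u \<in> A \<omega>})"
      using zero_in False by auto
    also have "prob \<dots> = (\<Prod>u\<in>U - {0}. p u)"
    proof -
      have "U - {0} \<subseteq> {1..}" by (auto simp: Suc_le_eq)
      then show ?thesis
        using indep U False unfolding indep_events_def p_def by auto
    qed
    also have "\<dots> = (\<Prod>u\<in>U. p u)"
      by (rule prod.mono_neutral_left) (use U p0 in auto)
    finally show ?thesis .
  qed
  \<comment> \<open>This is the origin of \<open>c\<close>: its \<open>h\<close>-th power cancels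
    the Gamma factors and the powers of the coefficients in the limit constant.\<close>
  have c_power: "c ^ h * (\<Prod>i<h. Gamma (1 / real h) * real (b i) powr (- 1 / real h)) = 1 - \<epsilon>"
  proof -
    have pw: "(x powr y) ^ h = x powr (y * real h)" if "x > 0" for x y :: real
      using that by (simp add: powr_powr flip: powr_realpow)
    have "c ^ h = (1 - \<epsilon>) * real (\<Prod>i<h. b i) powr (1 / real h) / Gamma (1 / real h) ^ h"
      unfolding c_def power_divide power_mult_distrib using B eps h2
      by (simp add: pw power2_eq_square)
    moreover have "(\<Prod>i<h. Gamma (1 / real h) * real (b i) powr (- 1 / real h)) =
        Gamma (1 / real h) ^ h * real (\<Prod>i<h. b i) powr (- 1 / real h)"
      by (simp add: prod.distrib prod_powr_distrib)
    moreover have "real (\<Prod>i<h. b i) powr (1 / real h) * real (\<Prod>i<h. b i) powr (- 1 / real h) = 1"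
      using bpos by (simp flip: powr_add)
    ultimately show ?thesis using G by simp
  qed
  interpret sparse_random_form b h M A p c "1 - \<epsilon>"
  proof unfold_locales
    show "c > 0" unfolding c_def using G bpos eps by (intro divide_pos_pos mult_pos_pos) auto
    show "1 - \<epsilon> = c ^ h * (\<Prod>i<h. Gamma (1 / real h) * real (b i) powr (- 1 / real h))"
      by (rule c_power[symmetric])
  qed (use assms prob_subset in \<open>auto simp: p_def\<close>)
  have "(\<lambda>n. mean_count n / ln (real n) / (1 - \<epsilon>)) \<longlonglongrightarrow> (1 - \<epsilon>) / (1 - \<epsilon>)"
    using eps by (intro tendsto_divide mean_count_asymp tendsto_const) auto
  then have "(\<lambda>n. mean_count n / ((1 - \<epsilon>) * ln (real n))) \<longlonglongrightarrow> 1"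
    using eps by (simp add: mult.commute)
  then have "mean_count \<sim>[at_top] (\<lambda>n. (1 - \<epsilon>) * ln (real n))"
    by (rule asymp_equivI')
  then show ?thesis using prob_infinitely_many_zeros by (simp add: expectation_r_count)
qed

end
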